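(* Let $h$ and $p_0^*$ satisfy Assumptions (A1)–(A3) (given in the context), and let $\beta>0$, $T>0$. Consider the optimal control problem $$\text{minimize over }u:\quad J(u)=\int_0^T\mathsf L(\rho_t,u_t)\,dt+\beta\int_{\mathbb R^d} h(x)\rho_T(x)\,dx\quad\text{subject to}\quad\frac{\partial\rho_t}{\partial t}+\nabla\cdot(\rho_tu_t)=0,\ \ \rho_0=p_0^*,$$ and the associated value function, for a density $\rho$ at time $t\in[0,T]$, $$V(\rho,t)=\inf_u\Big[\int_t^T\mathsf L(\rho_s,u_s)\,ds+\beta\int_{\mathbb R^d} h(x)\rho_T(x)\,dx\Big]$$ where $\partial_s\rho_s+\nabla\cdot(\rho_su_s)=0$ on $[t,T]$ and $\rho_t=\rho$. Then $V$ solves the dynamic programming equation $$\frac{\partial V}{\partial t}(\rho,t)+\inf_{u\in L^2}\mathsf H\Big(\rho,\frac{\partial V}{\partial\rho}(\rho,t),u\Big)=0,\quad t\in[0,T),\qquad V(\rho,T)=\beta\int_{\mathbb R^d} h(x)\rho(x)\,dx .$$ The solution of this equation is given by $$V(\rho,t)=\beta\int_{\mathbb R^d}h(x)\rho(x)\,dx,$$ and the associated optimal control (at each time, with $\rho$ the density at that time) is a solution $u$ of the pde $$\frac1{\rho(x)}\nabla\cdot(\rho(x)u(x))=\beta\,(h(x)-\hat h),\quad\forall x\in\mathbb R^d,\qquad \hat h:=\int_{\mathbb R^d} h(x)\rho(x)\,dx .$$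
   Context: $\mathcal P$ is the set of probability densities $\rho$ on $\mathbb R^d$ with $\int|x|^2\rho\,dx<\infty$. Controls are (time-dependent) vector fields $u_t:\mathbb R^d\to\mathbb R^d$ with $u_t\in L^2(\mathbb R^d;\rho_t)$, for which the continuity equation has a solution $\rho_t\in\mathcal P$. The Lagrangian is $$\mathsf L(\rho,u)=\frac12\int_{\mathbb R^d}\Big|\frac1{\rho(x)}\nabla\cdot(\rho(x)u(x))\Big|^2\rho(x)\,dx+\frac{\beta^2}{2}\int_{\mathbb R^d}|h(x)-\hat h|^2\rho(x)\,dx,\quad\hat h=\int h\rho\,dx,$$ and the Hamiltonian is $\mathsf H(\rho,\mathsf q,u)=\mathsf L(\rho,u)-\int\mathsf q(x)\,\nabla\cdot(\rho(x)u(x))\,dx$ for a function $\mathsf q$ on $\mathbb R^d$. The (Gâteaux) derivative $\frac{\partial E}{\partial\rho}(\rho)\in L^2(\mathbb R^d;\rho)$ of a functional $E$ of densities is the function satisfying $\frac{d}{dt}E(\rho_t)\big|_{t=0}=-\int\frac{\partial E}{\partial\rho}(\rho)(x)\,\nabla\cdot(\rho(x)u(x))\,dx$ for every path $\rho_t$ with $\partial_t\rho_t=-\nabla\cdot(\rho_tu)$, $\rho_0=\rho$, and every vector field $u$. Assumptions. (A1) $p_0^*\in\mathcal P$ has the form $e^{-V_0}$ with $V_0\in C^2(\mathbb R^d)$, $D^2V_0\in L^\infty$, $\liminf_{|x|\to\infty}\nabla V_0(x)\cdot\frac{x}{|x|}=\infty$. (A2) $h:\mathbb R^d\to\mathbb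 R$, $h\in C^2\cap L^2(\mathbb R^d;p_0^* )$, $D^2h\in L^\infty$, $\liminf_{|x|\to\infty}\nabla h(x)\cdot\frac{x}{|x|}>-\infty$. (A3) $h$ has a unique minimizer $\bar x$ with value $\bar h=h(\bar x)$, and there are a compact $D\subset\mathbb R^d$ and $r>0$ with $h(x)>\bar h+r$ for $x\notin D$. The density argument $\rho$ of $V$ is understood to be one for which these assumptions hold with $\rho$ in place of $p_0^*$. *)

theory Defs
  imports "HOL-Analysis.Analysis"
begin

definition prob_densities :: "('a::euclidean_space \<Rightarrow> real) set" where
  "prob_densities = {\<rho>. \<rho> \<in> borel_measurable borel \<and> (\<forall>x. 0 \<le> \<rho> x)
     \<and> integrable lborel \<rho> \<and> (\<integral>x. \<rho> x \<partial>lborel) = 1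
     \<and> integrable lborel (\<lambda>x. (norm x)\<^sup>2 * \<rho> x)}"

definition mean :: "('a::euclidean_space \<Rightarrow> real) \<Rightarrow> ('a \<Rightarrow> real) \<Rightarrow> real" where
  "mean h \<rho> = (\<integral>x. h x * \<rho> x \<partial>lborel)"

definition L2_functions :: "('a::euclidean_space \<Rightarrow> real) \<Rightarrow> ('a \<Rightarrow> real) set" where
  "L2_functions \<rho> = {f. f \<in> borel_measurable borel \<and> integrable lborel (\<lambda>x. (f x)\<^sup>2 * \<rho> x)}"

definition L2_fields :: "('a::euclidean_space \<Rightarrow> real) \<Rightarrow> ('a \<Rightarrow> 'a) set" where
  "L2_fields \<rho> = {u. u \<in> borel_measurable borel \<and> integrable lborel (\<lambda>x. (norm (u x))\<^sup>2 * \<rho> x)}"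

(* f is C^2 with gradient g and Hessian H, and the Hessian is bounded; since it is continuous,
   this is the same as being essentially bounded. *)
definition C2_bounded_hessian ::
  "('a::euclidean_space \<Rightarrow> real) \<Rightarrow> ('a \<Rightarrow> 'a) \<Rightarrow> ('a \<Rightarrow> 'a \<Rightarrow>\<^sub>L 'a) \<Rightarrow> bool" where
  "C2_bounded_hessian f g H \<longleftrightarrow> (\<forall>x. GDERIV f x :> g x)
     \<and> (\<forall>x. (g has_derivative blinfun_apply (H x)) (at x))
     \<and> continuous_on UNIV H \<and> bounded (range H)"

definition A1 :: "('a::euclidean_space \<Rightarrow> real) \<Rightarrow> bool" where
  "A1 \<rho> \<longleftrightarrow> \<rho> \<in> prob_densities \<and>
     (\<exists>V g H. \<rho> = (\<lambda>x. exp (- V x)) \<and> C2_bounded_hessian V g H \<and>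
        Liminf at_infinity (\<lambda>x. ereal (g x \<bullet> (x /\<^sub>R norm x))) = \<infinity>)"

definition A2 :: "('a::euclidean_space \<Rightarrow> real) \<Rightarrow> ('a \<Rightarrow> real) \<Rightarrow> bool" where
  "A2 h \<rho> \<longleftrightarrow> h \<in> L2_functions \<rho> \<and>
     (\<exists>g H. C2_bounded_hessian h g H \<and>
        Liminf at_infinity (\<lambda>x. ereal (g x \<bullet> (x /\<^sub>R norm x))) > - \<infinity>)"

definition A3 :: "('a::euclidean_space \<Rightarrow> real) \<Rightarrow> bool" where
  "A3 h \<longleftrightarrow> (\<exists>xb. (\<forall>x. x \<noteq> xb \<longrightarrow> h xb < h x) \<and>
     (\<exists>D r. compact D \<and> r > 0 \<and> (\<forall>x. x \<notin> D \<longrightarrow> h x > h xb + r)))"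

(* The densities at which the value function is considered. *)
definition admissible_densities :: "('a::euclidean_space \<Rightarrow> real) \<Rightarrow> ('a \<Rightarrow> real) set" where
  "admissible_densities h = {\<rho>. A1 \<rho> \<and> A2 h \<rho>}"

(* phi is a compactly supported C^1 function with gradient phi'. *)
definition test_function :: "('a::euclidean_space \<Rightarrow> real) \<Rightarrow> ('a \<Rightarrow> 'a) \<Rightarrow> bool" where
  "test_function \<phi> \<phi>' \<longleftrightarrow> (\<forall>x. GDERIV \<phi> x :> \<phi>' x) \<and> continuous_on UNIV \<phi>'
     \<and> compact (closure {x. \<phi> x \<noteq> 0})"

definition has_weak_divergence ::
  "('a::euclidean_space \<Rightarrow> 'a) \<Rightarrow> ('a \<Rightarrow> real) \<Rightarrow> bool" where
  "has_weak_divergence m g \<longleftrightarrow> (\<forall>\<phi> \<phi>'. test_function \<phi> \<phi>' \<longrightarrow>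
     integrable lborel (\<lambda>x. \<phi>' x \<bullet> m x) \<and> integrable lborel (\<lambda>x. \<phi> x * g x) \<and>
     (\<integral>x. \<phi>' x \<bullet> m x \<partial>lborel) = - (\<integral>x. \<phi> x * g x \<partial>lborel))"

(* w = (1/rho) div (rho u).  Writing the divergence as rho w rather than dividing by rho
   determines w rho-almost everywhere and avoids the convention z / 0 = 0 where rho vanishes. *)
definition has_weighted_div ::
  "('a::euclidean_space \<Rightarrow> real) \<Rightarrow> ('a \<Rightarrow> 'a) \<Rightarrow> ('a \<Rightarrow> real) \<Rightarrow> bool" where
  "has_weighted_div \<rho> u w \<longleftrightarrow> w \<in> borel_measurable borel \<and>
     has_weak_divergence (\<lambda>x. \<rho> x *\<^sub>R u x) (\<lambda>x. \<rho> x * w x)"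

definition weighted_div ::
  "('a::euclidean_space \<Rightarrow> real) \<Rightarrow> ('a \<Rightarrow> 'a) \<Rightarrow> 'a \<Rightarrow> real" where
  "weighted_div \<rho> u = (SOME w. has_weighted_div \<rho> u w)"

definition lagrangian ::
  "('a::euclidean_space \<Rightarrow> real) \<Rightarrow> real \<Rightarrow> ('a \<Rightarrow> real) \<Rightarrow> ('a \<Rightarrow> 'a) \<Rightarrow> ennreal" where
  "lagrangian h \<beta> \<rho> u =
     (if \<exists>w. has_weighted_div \<rho> u w
      then ennreal (1/2) * (\<integral>\<^sup>+x. ennreal ((weighted_div \<rho> u x)\<^sup>2 * \<rho> x) \<partial>lborel)
         + ennreal (\<beta>\<^sup>2 / 2) * (\<integral>\<^sup>+x. ennreal ((h x - mean h \<rho>)\<^sup>2 * \<rho> x) \<partial>lborel)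
      else \<infinity>)"

(* For q in L^2(rho), the subtracted integral converges absolutely whenever the Lagrangian is finite;
   otherwise the Hamiltonian is infinite. *)
definition hamiltonian ::
  "('a::euclidean_space \<Rightarrow> real) \<Rightarrow> real \<Rightarrow> ('a \<Rightarrow> real) \<Rightarrow> ('a \<Rightarrow> real) \<Rightarrow> ('a \<Rightarrow> 'a) \<Rightarrow> ereal" where
  "hamiltonian h \<beta> \<rho> q u = enn2ereal (lagrangian h \<beta> \<rho> u)
     - ereal (\<integral>x. q x * (\<rho> x * weighted_div \<rho> u x) \<partial>lborel)"

(* r solves the continuity equation with velocity u on [t0,t1]: in its weak form, the integral of
   each test function phi against r_s is absolutely continuous in s, and its derivative is the
   integral of grad phi . (r_s u_s). *)
definition continuity_path ::
  "real \<Rightarrow> real \<Rightarrow> (real \<Rightarrow> 'a::euclidean_space \<Rightarrow> real) \<Rightarrow> (real \<Rightarrow> 'a \<Rightarrow> 'a) \<Rightarrow> bool" where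
  "continuity_path t0 t1 r u \<longleftrightarrow>
     set_borel_measurable borel ({t0..t1} \<times> UNIV) (\<lambda>(s, x). r s x) \<and>
     set_borel_measurable borel ({t0..t1} \<times> UNIV) (\<lambda>(s, x). u s x) \<and>
     (\<forall>s\<in>{t0..t1}. r s \<in> prob_densities \<and> u s \<in> L2_fields (r s)) \<and>
     (\<forall>\<phi> \<phi>'. test_function \<phi> \<phi>' \<longrightarrow>
        set_integrable lborel {t0..t1} (\<lambda>s. \<integral>x. \<phi>' x \<bullet> (r s x *\<^sub>R u s x) \<partial>lborel) \<and>
        (\<forall>s\<in>{t0..t1}. (\<integral>x. \<phi> x * r s x \<partial>lborel) - (\<integral>x. \<phi> x * r t0 x \<partial>lborel) =
           (LINT \<tau>:{t0..s}|lborel. (\<integral>x. \<phi>' x \<bullet> (r \<tau> x *\<^sub>R u \<tau> x) \<partial>lborel))))"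

(* A control is given together with its density path, since for non-smooth u the path need not be
   determined by u.  Measurability of the running cost is required because the nonnegative integral
   of a non-measurable function would be a lower integral. *)
definition admissible_pair ::
  "('a::euclidean_space \<Rightarrow> real) \<Rightarrow> real \<Rightarrow> real \<Rightarrow> real \<Rightarrow> ('a \<Rightarrow> real)
     \<Rightarrow> (real \<Rightarrow> 'a \<Rightarrow> real) \<Rightarrow> (real \<Rightarrow> 'a \<Rightarrow> 'a) \<Rightarrow> bool" where
  "admissible_pair h \<beta> t T \<rho> r u \<longleftrightarrow> continuity_path t T r u \<and> r t = \<rho> \<and>
     (\<lambda>s. lagrangian h \<beta> (r s) (u s) * indicator {t..T} s) \<in> borel_measurable borel"

definition cost ::
  "('a::euclidean_space \<Rightarrow> real) \<Rightarrow> real \<Rightarrow> real \<Rightarrow> real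
     \<Rightarrow> (real \<Rightarrow> 'a \<Rightarrow> real) \<Rightarrow> (real \<Rightarrow> 'a \<Rightarrow> 'a) \<Rightarrow> ereal" where
  "cost h \<beta> t T r u =
     enn2ereal (\<integral>\<^sup>+s. lagrangian h \<beta> (r s) (u s) * indicator {t..T} s \<partial>lborel)
     + ereal (\<beta> * (\<integral>x. h x * r T x \<partial>lborel))"

definition value_function ::
  "('a::euclidean_space \<Rightarrow> real) \<Rightarrow> real \<Rightarrow> real \<Rightarrow> ('a \<Rightarrow> real) \<Rightarrow> real \<Rightarrow> ereal" where
  "value_function h \<beta> T \<rho> t =
     (INF (r, u)\<in>{(r, u). admissible_pair h \<beta> t T \<rho> r u}. cost h \<beta> t T r u)"

definition optimal_pair ::
  "('a::euclidean_space \<Rightarrow> real) \<Rightarrow> real \<Rightarrow> real \<Rightarrow> real \<Rightarrow> ('a \<Rightarrow> real)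
     \<Rightarrow> (real \<Rightarrow> 'a \<Rightarrow> real) \<Rightarrow> (real \<Rightarrow> 'a \<Rightarrow> 'a) \<Rightarrow> bool" where
  "optimal_pair h \<beta> t T \<rho> r u \<longleftrightarrow> admissible_pair h \<beta> t T \<rho> r u \<and>
     (\<forall>r' u'. admissible_pair h \<beta> t T \<rho> r' u' \<longrightarrow> cost h \<beta> t T r u \<le> cost h \<beta> t T r' u')"

(* A path in the class A of densities that starts at rho with velocity v and solves the continuity
   equation; at time 0 the equation holds strongly: the difference quotients of r relative to rho
   converge in L^2(rho) to -w = -(1/rho) div (rho v). *)
definition variation ::
  "('a::euclidean_space \<Rightarrow> real) set \<Rightarrow> ('a \<Rightarrow> real) \<Rightarrow> real
     \<Rightarrow> (real \<Rightarrow> 'a \<Rightarrow> real) \<Rightarrow> ('a \<Rightarrow> 'a) \<Rightarrow> ('a \<Rightarrow> real) \<Rightarrow> bool" where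
  "variation A \<rho> \<epsilon> r v w \<longleftrightarrow> \<epsilon> > 0 \<and> r 0 = \<rho> \<and> (\<forall>s\<in>{0..\<epsilon>}. r s \<in> A) \<and>
     (\<exists>u. continuity_path 0 \<epsilon> r u \<and> u 0 = v) \<and>
     w \<in> L2_functions \<rho> \<and> has_weighted_div \<rho> v w \<and>
     ((\<lambda>s. \<integral>\<^sup>+x. ennreal (((r s x - \<rho> x) / s + \<rho> x * w x)\<^sup>2 / \<rho> x) \<partial>lborel) \<longlongrightarrow> 0) (at_right 0)"

(* q is determined by E and rho only up to an additive constant. *)
definition is_gateaux_derivative ::
  "('a::euclidean_space \<Rightarrow> real) set \<Rightarrow> (('a \<Rightarrow> real) \<Rightarrow> real) \<Rightarrow> ('a \<Rightarrow> real) \<Rightarrow> ('a \<Rightarrow> real) \<Rightarrow> bool" where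
  "is_gateaux_derivative A E \<rho> q \<longleftrightarrow> q \<in> L2_functions \<rho> \<and>
     (\<forall>\<epsilon> r v w. variation A \<rho> \<epsilon> r v w \<longrightarrow>
        ((\<lambda>s. E (r s)) has_real_derivative - (\<integral>x. q x * (\<rho> x * w x) \<partial>lborel)) (at 0 within {0..\<epsilon>}))"

definition solves_dpe ::
  "('a::euclidean_space \<Rightarrow> real) \<Rightarrow> real \<Rightarrow> real \<Rightarrow> (('a \<Rightarrow> real) \<Rightarrow> real \<Rightarrow> ereal) \<Rightarrow> bool" where
  "solves_dpe h \<beta> T W \<longleftrightarrow> (\<forall>\<rho>\<in>admissible_densities h.
     (\<forall>t\<in>{0..T}. \<bar>W \<rho> t\<bar> \<noteq> \<infinity>) \<and>
     (\<forall>t\<in>{0..<T}. \<exists>D.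
        ((\<lambda>s. real_of_ereal (W \<rho> s)) has_real_derivative D) (at t within {0..T}) \<and>
        (\<exists>q. is_gateaux_derivative (admissible_densities h) (\<lambda>\<rho>'. real_of_ereal (W \<rho>' t)) \<rho> q) \<and>
        (\<forall>q. is_gateaux_derivative (admissible_densities h) (\<lambda>\<rho>'. real_of_ereal (W \<rho>' t)) \<rho> q \<longrightarrow>
           ereal D + (INF u\<in>L2_fields \<rho>. hamiltonian h \<beta> \<rho> q u) = 0)) \<and>
     W \<rho> T = ereal (\<beta> * (\<integral>x. h x * \<rho> x \<partial>lborel)))"

(* (1/rho) div (rho u) = beta (h - mean), in the weak sense. *)
definition control_pde ::
  "('a::euclidean_space \<Rightarrow> real) \<Rightarrow> real \<Rightarrow> ('a \<Rightarrow> real) \<Rightarrow> ('a \<Rightarrow> 'a) \<Rightarrow> bool" where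
  "control_pde h \<beta> \<rho> u \<longleftrightarrow> has_weighted_div \<rho> u (\<lambda>x. \<beta> * (h x - mean h \<rho>))"

end

theory Submission
  imports Defs "HOL-Real_Asymp.Real_Asymp"
begin

text \<open>
  The proof is a verification argument around one identity. Write $w = \rho^{-1}\nabla\cdot(\rho u)$. The
  total divergence vanishes, $\int w\rho = 0$, so completing the square gives
  \[ \mathsf L(\rho,u) - \beta\int h\,w\,\rho
     = \frac12\int \big(w - \beta(h-\hat h)\big)^2\rho \ge 0 . \]
  Along a solution of the continuity equation the derivative of $\int h\rho_s$ is $-\int h\,w_s\rho_s$.
  Integrating the inequality over time shows that every admissible pair costs at least $\beta\int h\rho$,
  with equality exactly when the square vanishes at almost every time, which is the pde for the control.
  The same identity evaluates the Hamiltonian at $\mathsf q = \beta h$ and shows that its infimum is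
  zero. The bound is attained along the exponential tilts of $\rho$ with weights
  $e^{-\beta (s-t) h}$, provided that the pde has a square-integrable solution for each of these densities.

  Three points need analysis.

  \<^item> \<^emph>\<open>Solving the pde.\<close> The momentum $\rho u$ is given by Bogovskii's formula: each bit of mass of the
  right-hand side is moved along straight lines to the unit ball and spread there uniformly
  (\<open>bogovskii_weak_divergence\<close>). A potential with bounded Hessian and infinite radial drift grows along
  almost radial rays faster than any linear function (\<open>confining_ray_growth\<close>), so the momentum is dominated
  by the density up to an exponential factor (\<open>bogovskii_bound\<close>), and the density has all exponential moments.
  An explicit formula also makes the field jointly measurable in time and space.

  \<^item> \<^emph>\<open>Testing with an unbounded function.\<close> Along a general path only second moments are known, so $h$ is
  first replaced by a smooth bounded 1-Lipschitz function of $h$, which can be tested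
  (\<open>bounded_C1_along_path\<close>); the Lipschitz property preserves the sign of the gap, and Fatou's lemma removes
  the truncation (\<open>running_cost_bound\<close>). Conversely, a pair that solves the pde at almost every time is not
  known to have finite cost. The pde itself, tested with a cutoff that retains half of the mass at all times,
  bounds the mean of $h$ by an integrable function of time (\<open>running_cost_of_control_pde\<close>).

  \<^item> \<^emph>\<open>Identifying the Gateaux derivative.\<close> It is determined only through variations inside the class of
  admissible densities. Tilting by bounded $C^2$ functions stays inside the class, and products of smooth steps
  show that these functions separate integrable functions. Hence every Gateaux derivative of the value function
  is $\beta h$ plus a constant (\<open>gateaux_unique\<close>), and the constant is invisible to the Hamiltonian.
\<close>

section \<open>Growth of functions with bounded Hessian\<close>

lemma C2_bounded_hessian_continuous:
  assumes "C2_bounded_hessian f g H"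
  shows "continuous_on UNIV f" and "continuous_on UNIV g"
proof -
  have "\<And>x. (f has_derivative (\<lambda>y. y \<bullet> g x)) (at x)"
    using assms by (auto simp: C2_bounded_hessian_def gderiv_def)
  thus "continuous_on UNIV f"
    by (meson UNIV_I continuous_at_imp_continuous_on has_derivative_continuous)
  have "\<And>x. (g has_derivative blinfun_apply (H x)) (at x)"
    using assms by (auto simp: C2_bounded_hessian_def)
  thus "continuous_on UNIV g"
    by (meson UNIV_I continuous_at_imp_continuous_on has_derivative_continuous)
qed

lemma C2_bounded_hessian_gradient_growth:
  assumes "C2_bounded_hessian f g H"
  obtains L where "L > 0" "\<And>x. norm (g x) \<le> L * (1 + norm x)"
proof -
  obtain B where B: "\<And>x. norm (H x) \<le> B"
    using assms by (auto simp: C2_bounded_hessian_def bounded_iff)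
  have d: "\<And>x. (g has_derivative blinfun_apply (H x)) (at x)"
    using assms by (auto simp: C2_bounded_hessian_def)
  have lip: "norm (g x - g 0) \<le> B * norm (x - 0)" for x
  proof (rule differentiable_bound[of UNIV g "\<lambda>x. blinfun_apply (H x)"])
    show "onorm (blinfun_apply (H x)) \<le> B" for x
      using B[of x] by (simp add: norm_blinfun.rep_eq)
  qed (use d in auto)
  have "B \<ge> 0" using B[of 0] norm_ge_zero order_trans by blast
  show thesis
  proof (rule that[of "norm (g 0) + B + 1"])
    show "norm (g 0) + B + 1 > 0" using \<open>B \<ge> 0\<close> norm_ge_zero[of "g 0"] by linarith
    fix x
    have "norm (g x) \<le> norm (g 0) + B * norm x"
      using lip[of x] norm_triangle_sub[of "g x" "g 0"] by simp
    also have "\<dots> \<le> (norm (g 0) + B + 1) * (1 + norm x)"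
      using \<open>B \<ge> 0\<close> by (simp add: algebra_simps)
    finally show "norm (g x) \<le> (norm (g 0) + B + 1) * (1 + norm x)" .
  qed
qed

text \<open>The linear growth of the gradient, integrated along the segment from the origin. It makes such a
  function integrable against every density with finite second moment.\<close>

lemma C2_bounded_hessian_growth:
  assumes "C2_bounded_hessian f g H"
  obtains C where "C > 0" "\<And>x. \<bar>f x\<bar> \<le> C * (1 + (norm x)\<^sup>2)"
proof -
  obtain L where L: "L > 0" "\<And>x. norm (g x) \<le> L * (1 + norm x)"
    using C2_bounded_hessian_gradient_growth[OF assms] by blast
  have d: "\<And>x. (f has_derivative (\<lambda>y. y \<bullet> g x)) (at x)"
    using assms by (auto simp: C2_bounded_hessian_def gderiv_def)
  have lip: "norm (f x - f 0) \<le> (L * (1 + norm x)) * norm (x - 0)" for x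
  proof (rule differentiable_bound[of "cball 0 (norm x)" f "\<lambda>x y. y \<bullet> g x"])
    fix y :: 'a assume y: "y \<in> cball 0 (norm x)"
    show "onorm (\<lambda>z. z \<bullet> g y) \<le> L * (1 + norm x)"
    proof (rule onorm_le)
      fix z
      have "norm (z \<bullet> g y) \<le> norm z * norm (g y)" by (simp add: Cauchy_Schwarz_ineq2)
      also have "norm z * norm (g y) \<le> norm z * (L * (1 + norm x))"
        using L(2)[of y] y L(1) by (intro mult_left_mono) (meson add_left_mono less_imp_le mem_cball_0 mult_left_mono order_trans, simp)
      finally show "norm (z \<bullet> g y) \<le> L * (1 + norm x) * norm z"
        by (simp only: mult_ac)
    qed
  qed (use d in \<open>auto intro: has_derivative_at_withinI\<close>)
  show thesis
  proof (rule that[of "\<bar>f 0\<bar> + 2 * L"])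
    show "\<bar>f 0\<bar> + 2 * L > 0" using L(1) by simp
    fix x :: 'a
    have "norm x \<le> 1 + (norm x)\<^sup>2"
      using zero_le_power2[of "norm x - 1/2"] by (simp add: power2_diff power_divide)
    hence *: "L * norm x \<le> L * (1 + (norm x)\<^sup>2)" using L(1) by simp
    have "\<bar>f x\<bar> \<le> \<bar>f 0\<bar> + (L * (1 + norm x)) * norm x"
      using lip[of x] by simp
    also have "\<dots> = \<bar>f 0\<bar> + L * norm x + L * (norm x)\<^sup>2"
      by (simp add: distrib_left distrib_right power2_eq_square)
    also have "\<dots> \<le> \<bar>f 0\<bar> * (1 + (norm x)\<^sup>2) + L * (1 + (norm x)\<^sup>2) + L * (1 + (norm x)\<^sup>2)"
      using * L(1) mult_left_mono[of 1 "1 + (norm x)\<^sup>2" "\<bar>f 0\<bar>"] by (intro add_mono) auto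
    also have "\<dots> = (\<bar>f 0\<bar> + 2 * L) * (1 + (norm x)\<^sup>2)"
      by (simp only: distrib_right)
    finally show "\<bar>f x\<bar> \<le> (\<bar>f 0\<bar> + 2 * L) * (1 + (norm x)\<^sup>2)" .
  qed
qed

text \<open>The radial component tends to infinity. Clearing the denominator \<open>norm x\<close> turns the condition into
  an inequality that is additive in the field.\<close>

definition coercive_field :: "('a::euclidean_space \<Rightarrow> 'a) \<Rightarrow> bool" where
  "coercive_field g \<longleftrightarrow> (\<forall>M. \<exists>R. \<forall>x. R \<le> norm x \<longrightarrow> M * norm x \<le> g x \<bullet> x)"

lemma radial_part_bound_iff:
  fixes g :: "'a::euclidean_space \<Rightarrow> 'a"
  assumes "x \<noteq> 0"
  shows "M \<le> g x \<bullet> (x /\<^sub>R norm x) \<longleftrightarrow> M * norm x \<le> g x \<bullet> x"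
  using assms by (simp add: field_simps)

lemma coercive_field_iff_Liminf:
  "coercive_field g \<longleftrightarrow> Liminf at_infinity (\<lambda>x. ereal (g x \<bullet> (x /\<^sub>R norm x))) = \<infinity>"
proof
  assume c: "coercive_field g"
  show "Liminf at_infinity (\<lambda>x. ereal (g x \<bullet> (x /\<^sub>R norm x))) = \<infinity>"
  proof (rule ereal_infty_less_eq(1)[THEN iffD1, OF le_Liminf_iff[THEN iffD2]], intro allI impI)
    fix y :: ereal assume "y < \<infinity>"
    then obtain M where M: "y \<le> ereal M" by (cases y) auto
    obtain R where R: "\<And>x. R \<le> norm x \<Longrightarrow> (M + 1) * norm x \<le> g x \<bullet> x"
      using c unfolding coercive_field_def by blast
    have "\<forall>x. max R 1 \<le> norm x \<longrightarrow> y < ereal (g x \<bullet> (x /\<^sub>R norm x))"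
    proof (intro allI impI)
      fix x :: 'a assume x: "max R 1 \<le> norm x"
      hence "x \<noteq> 0" by auto
      hence "M + 1 \<le> g x \<bullet> (x /\<^sub>R norm x)" using R[of x] x radial_part_bound_iff[of x "M+1" g] by simp
      thus "y < ereal (g x \<bullet> (x /\<^sub>R norm x))" using M
        by (smt (verit) le_less_trans less_ereal.simps(1))
    qed
    thus "eventually (\<lambda>x. y < ereal (g x \<bullet> (x /\<^sub>R norm x))) at_infinity"
      unfolding eventually_at_infinity by blast
  qed
next
  assume L: "Liminf at_infinity (\<lambda>x. ereal (g x \<bullet> (x /\<^sub>R norm x))) = \<infinity>"
  show "coercive_field g" unfolding coercive_field_def
  proof
    fix M :: real
    have "eventually (\<lambda>x. ereal M < ereal (g x \<bullet> (x /\<^sub>R norm x))) at_infinity"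
      by (rule less_LiminfD) (unfold L, simp)
    then obtain b where b: "\<And>x. b \<le> norm x \<Longrightarrow> M < g x \<bullet> (x /\<^sub>R norm x)"
      unfolding eventually_at_infinity by auto
    have "M * norm x \<le> g x \<bullet> x" if "max b 1 \<le> norm x" for x
    proof -
      have "x \<noteq> 0" using that by auto
      thus ?thesis using b[of x] that radial_part_bound_iff[of x M g] by simp
    qed
    thus "\<exists>R. \<forall>x. R \<le> norm x \<longrightarrow> M * norm x \<le> g x \<bullet> x" by blast
  qed
qed

definition radially_bounded_below :: "('a::euclidean_space \<Rightarrow> 'a) \<Rightarrow> bool" where
  "radially_bounded_below g \<longleftrightarrow> (\<exists>M R. \<forall>x. R \<le> norm x \<longrightarrow> - M * norm x \<le> g x \<bullet> x)"

lemma radially_bounded_belowI_Liminf: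
  assumes "Liminf at_infinity (\<lambda>x. ereal (g x \<bullet> (x /\<^sub>R norm x))) > - \<infinity>"
  shows "radially_bounded_below g"
proof -
  obtain M where "ereal M < Liminf at_infinity (\<lambda>x. ereal (g x \<bullet> (x /\<^sub>R norm x)))"
    using assms ereal_dense2 by blast
  hence "eventually (\<lambda>x. ereal M < ereal (g x \<bullet> (x /\<^sub>R norm x))) at_infinity"
    by (rule less_LiminfD)
  then obtain b where b: "\<And>x. b \<le> norm x \<Longrightarrow> M < g x \<bullet> (x /\<^sub>R norm x)"
    unfolding eventually_at_infinity by auto
  have "- (- M) * norm x \<le> g x \<bullet> x" if "max b 1 \<le> norm x" for x
  proof -
    have "x \<noteq> 0" using that by auto
    thus ?thesis using b[of x] that radial_part_bound_iff[of x M g] by simp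
  qed
  thus ?thesis unfolding radially_bounded_below_def by blast
qed

text \<open>Adding a multiple of the gradient of the cost does not destroy the confinement; this is where the
  lower bound on its radial derivative enters.\<close>

lemma coercive_field_perturb:
  assumes "coercive_field g" "radially_bounded_below k" "s \<ge> 0"
  shows "coercive_field (\<lambda>x. g x + s *\<^sub>R k x)"
  unfolding coercive_field_def
proof
  fix M
  obtain N R where NR: "\<And>x. R \<le> norm x \<Longrightarrow> - N * norm x \<le> k x \<bullet> x"
    using assms(2) unfolding radially_bounded_below_def by blast
  obtain R' where R': "\<And>x. R' \<le> norm x \<Longrightarrow> (M + s * N) * norm x \<le> g x \<bullet> x"
    using assms(1) unfolding coercive_field_def by blast
  have "M * norm x \<le> (g x + s *\<^sub>R k x) \<bullet> x" if "max R R' \<le> norm x" for x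
    using mult_left_mono[OF NR[of x] \<open>s \<ge> 0\<close>] R'[of x] that
    by (simp add: inner_add_left algebra_simps)
  thus "\<exists>R. \<forall>x. R \<le> norm x \<longrightarrow> M * norm x \<le> (g x + s *\<^sub>R k x) \<bullet> x" by blast
qed

section \<open>Confining potentials\<close>

definition confining :: "('a::euclidean_space \<Rightarrow> real) \<Rightarrow> ('a \<Rightarrow> 'a) \<Rightarrow> bool" where
  "confining V g \<longleftrightarrow> (\<exists>H. C2_bounded_hessian V g H) \<and> coercive_field g"

text \<open>The drift that keeps \<open>V - M s\<close> nondecreasing far out on a ray is the component of the gradient
  along \<open>p - z\<close>, whereas coercivity controls the component along \<open>p\<close>. The two differ by at most the norm
  of the gradient, which grows linearly, and coercivity beats any linear multiple of \<open>norm p\<close>. On the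
  remaining bounded piece of the ray \<open>V - M s\<close> is bounded. The constant does not depend on the base point and
  the direction, which is what the bound on the transport field relies on.\<close>

lemma confining_ray_growth:
  fixes V :: "'a::euclidean_space \<Rightarrow> real"
  assumes "confining V g" "M \<ge> 0"
  obtains C where "C \<ge> 0" "\<And>(z::'a) e s1 s2. norm z \<le> 1 \<Longrightarrow> norm e = 1 \<Longrightarrow> 0 \<le> s1 \<Longrightarrow> s1 \<le> s2 \<Longrightarrow>
     V (z + s1 *\<^sub>R e) + M * (s2 - s1) \<le> V (z + s2 *\<^sub>R e) + C"
proof -
  obtain H where C2: "C2_bounded_hessian V g H" and co: "coercive_field g"
    using assms(1) unfolding confining_def by blast
  obtain L where L: "L > 0" "\<And>x. norm (g x) \<le> L * (1 + norm x)"
    using C2_bounded_hessian_gradient_growth[OF C2] by blast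
  obtain R0 where R0: "\<And>x. R0 \<le> norm x \<Longrightarrow> (2 * L + 2 * M) * norm x \<le> g x \<bullet> x"
    using co unfolding coercive_field_def by blast
  (* A point with parameter s has norm at least s - 1, so beyond S both the coercivity bound
     and norm p \<ge> 1 are available. *)
  define S where "S = max R0 1 + 1"
  have "S \<ge> 0" by (simp add: S_def)
  have contV: "continuous_on UNIV V" using C2_bounded_hessian_continuous[OF C2] by blast
  have "bounded (V ` cball 0 (S + 1))"
    by (intro compact_imp_bounded compact_continuous_image continuous_on_subset[OF contV]) auto
  then obtain K0 where "\<forall>v\<in>V ` cball 0 (S + 1). norm v \<le> K0"
    unfolding bounded_iff by blast
  hence K0: "\<And>x. norm x \<le> S + 1 \<Longrightarrow> \<bar>V x\<bar> \<le> K0" by simp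
  define K where "K = K0 + M * S"
  have far: "(V (z + s1 *\<^sub>R e) - M * s1) \<le> V (z + s2 *\<^sub>R e) - M * s2"
    if z: "norm z \<le> 1" and e: "norm e = 1" and s: "S \<le> s1" "s1 \<le> s2" for z e :: 'a and s1 s2
  proof (rule DERIV_nonneg_imp_nondecreasing[OF s(2)])
    fix s assume s': "s1 \<le> s" "s \<le> s2"
    let ?p = "z + s *\<^sub>R e"
    have np: "norm ?p \<ge> s - 1" using norm_triangle_ineq2[of "s *\<^sub>R e" "- z"] z e s s' \<open>S \<ge> 0\<close>
      by (simp add: add.commute)
    hence p: "norm ?p \<ge> R0" "norm ?p \<ge> 1" using s' s by (auto simp: S_def)
    have s0: "s > 0" using s s' by (auto simp: S_def)
    have "g ?p \<bullet> z \<le> norm (g ?p) * norm z" by (rule norm_cauchy_schwarz)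
    also have "\<dots> \<le> norm (g ?p) * 1" by (intro mult_left_mono z) simp
    also have "\<dots> \<le> L * (1 + norm ?p)" using L(2)[of ?p] by simp
    also have "\<dots> \<le> L * (2 * norm ?p)" using p(2) L(1) by (intro mult_left_mono) auto
    finally have z1: "g ?p \<bullet> z \<le> 2 * L * norm ?p" by simp
    have "M * s \<le> M * (norm ?p + 1)" using np assms(2) by (intro mult_left_mono) auto
    also have "\<dots> \<le> M * (2 * norm ?p)" using p(2) assms(2) by (intro mult_left_mono) auto
    also have "\<dots> \<le> g ?p \<bullet> ?p - g ?p \<bullet> z" using R0[OF p(1)] z1 by (simp add: algebra_simps)
    also have "\<dots> = s * (g ?p \<bullet> e)" by (simp add: inner_add_right)
    finally have "M \<le> g ?p \<bullet> e" using s0 by (simp add: mult.commute)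
    moreover have "((\<lambda>s. V (z + s *\<^sub>R e) - M * s) has_real_derivative (g ?p \<bullet> e - M)) (at s)"
    proof -
      have "(V has_derivative (\<lambda>y. y \<bullet> g ?p)) (at ?p)"
        using C2 by (auto simp: C2_bounded_hessian_def gderiv_def)
      hence "((\<lambda>s. V (z + s *\<^sub>R e)) has_derivative (\<lambda>t. (t *\<^sub>R e) \<bullet> g ?p)) (at s)"
        by (rule has_derivative_compose[rotated]) (auto intro!: derivative_eq_intros)
      hence "((\<lambda>s. V (z + s *\<^sub>R e)) has_real_derivative (g ?p \<bullet> e)) (at s)"
        by (simp add: has_field_derivative_def inner_commute mult_commute_abs)
      thus ?thesis by (auto intro!: derivative_eq_intros)
    qed
    ultimately show "\<exists>y. ((\<lambda>s. V (z + s *\<^sub>R e) - M * s) has_real_derivative y) (at s) \<and> 0 \<le> y"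
      by (intro exI conjI) auto
  qed
  have near: "\<bar>V (z + s *\<^sub>R e) - M * s\<bar> \<le> K"
    if z: "norm z \<le> 1" and e: "norm e = 1" and s: "0 \<le> s" "s \<le> S" for z e :: 'a and s
  proof -
    have "norm (z + s *\<^sub>R e) \<le> S + 1" using norm_triangle_ineq[of z "s *\<^sub>R e"] z e s by simp
    moreover have "M * s \<le> M * S" "0 \<le> M * s" using assms(2) s by (auto intro: mult_left_mono)
    ultimately show ?thesis using K0[of "z + s *\<^sub>R e"] unfolding K_def by linarith
  qed
  have "K \<ge> 0" using K0[of 0] assms(2) \<open>S \<ge> 0\<close> unfolding K_def by (smt (verit) mult_nonneg_nonneg norm_zero)
  show thesis
  proof (rule that[of "2 * K"])
    fix z e :: 'a and s1 s2 :: real assume a: "norm z \<le> 1" "norm e = 1" "0 \<le> s1" "s1 \<le> s2"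
    have "V (z + s1 *\<^sub>R e) - M * s1 \<le> V (z + s2 *\<^sub>R e) - M * s2 + 2 * K"
    proof (cases "s1 \<ge> S")
      case True
      thus ?thesis using far[of z e s1 s2] a \<open>K \<ge> 0\<close> by simp
    next
      case False
      show ?thesis
      proof (cases "s2 \<ge> S")
        case True
        thus ?thesis using far[of z e S s2] near[of z e S] near[of z e s1] a False \<open>S \<ge> 0\<close> by linarith
      next
        case F2: False
        thus ?thesis using near[of z e s2] near[of z e s1] a False by linarith
      qed
    qed
    thus "V (z + s1 *\<^sub>R e) + M * (s2 - s1) \<le> V (z + s2 *\<^sub>R e) + 2 * K"
      unfolding right_diff_distrib by linarith
  qed (use \<open>K \<ge> 0\<close> in simp)
qed

lemma integral_lborel_affine:
  fixes f :: "'a::euclidean_space \<Rightarrow> 'b::{banach, second_countable_topology}"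
  assumes [measurable]: "f \<in> borel_measurable borel" and "c \<noteq> 0"
  shows "(LBINT x. f x) = \<bar>c\<bar> ^ DIM('a) *\<^sub>R (LBINT x. f (a + c *\<^sub>R x))"
proof -
  have "(LBINT x. f x) = (\<integral>x. f x \<partial>density (distr lborel borel (\<lambda>x. a + c *\<^sub>R x)) (\<lambda>_. \<bar>c\<bar>^DIM('a)))"
    using lborel_affine[OF \<open>c \<noteq> 0\<close>, of a] by simp
  also have "\<dots> = \<bar>c\<bar> ^ DIM('a) *\<^sub>R (LBINT x. f (a + c *\<^sub>R x))"
    by (subst integral_density) (auto simp: integral_distr)
  finally show ?thesis .
qed

lemma nn_integral_lborel_affine:
  fixes f :: "'a::euclidean_space \<Rightarrow> ennreal"
  assumes [measurable]: "f \<in> borel_measurable borel" and "c \<noteq> 0"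
  shows "(\<integral>\<^sup>+x. f x \<partial>lborel) = ennreal (\<bar>c\<bar> ^ DIM('a)) * (\<integral>\<^sup>+x. f (a + c *\<^sub>R x) \<partial>lborel)"
proof -
  have "(\<integral>\<^sup>+x. f x \<partial>lborel) = (\<integral>\<^sup>+x. f x \<partial>density (distr lborel borel (\<lambda>x. a + c *\<^sub>R x)) (\<lambda>_. \<bar>c\<bar>^DIM('a)))"
    using lborel_affine[OF \<open>c \<noteq> 0\<close>, of a] by simp
  also have "\<dots> = ennreal (\<bar>c\<bar> ^ DIM('a)) * (\<integral>\<^sup>+x. f (a + c *\<^sub>R x) \<partial>lborel)"
    by (subst nn_integral_density) (auto simp: nn_integral_distr nn_integral_cmult)
  finally show ?thesis .
qed

lemma integrable_bounded_mult:
  fixes f F :: "'a \<Rightarrow> real"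
  assumes "integrable M f" and [measurable]: "F \<in> borel_measurable M" and B: "\<And>x. \<bar>F x\<bar> \<le> B"
  shows "integrable M (\<lambda>x. F x * f x)"
proof (rule Bochner_Integration.integrable_bound)
  have [measurable]: "f \<in> borel_measurable M" using assms(1) by simp
  show "integrable M (\<lambda>x. B * f x)" using assms(1) by simp
  show "(\<lambda>x. F x * f x) \<in> borel_measurable M" by measurable
  show "AE x in M. norm (F x * f x) \<le> norm (B * f x)"
    unfolding real_norm_def abs_mult by (intro AE_I2 mult_right_mono order_trans[OF B abs_ge_self]) simp
qed

lemma integral_tendsto_dominated_by_limit:
  fixes f :: "nat \<Rightarrow> 'a \<Rightarrow> real"
  assumes "integrable M g" "\<And>n. f n \<in> borel_measurable M" "\<And>n x. \<bar>f n x\<bar> \<le> \<bar>g x\<bar>" "\<And>x. (\<lambda>n. f n x) \<longlonglongrightarrow> g x"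
  shows "(\<lambda>n. integral\<^sup>L M (f n)) \<longlonglongrightarrow> integral\<^sup>L M g"
  by (rule integral_dominated_convergence[where w = "\<lambda>x. \<bar>g x\<bar>"]) (use assms in auto)

text \<open>Moving from \<open>x / 2\<close> out to \<open>x\<close> gains any factor \<open>exp (M * norm x)\<close>, and the density at \<open>x / 2\<close>
  is integrable by scaling. So integrability improves itself to all exponential moments.\<close>

lemma exp_moments_of_confining:
  fixes V :: "'a::euclidean_space \<Rightarrow> real"
  assumes "confining V g" and int: "integrable lborel (\<lambda>x. exp (- V x))"
  shows "integrable lborel (\<lambda>x. exp (M * norm x) * exp (- V x))"
proof -
  obtain H where C2: "C2_bounded_hessian V g H" using assms(1) unfolding confining_def by blast
  have [measurable]: "V \<in> borel_measurable borel"
    using C2_bounded_hessian_continuous[OF C2] borel_measurable_continuous_onI by blast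
  obtain C where C: "\<And>(z::'a) e s1 s2. norm z \<le> 1 \<Longrightarrow> norm e = 1 \<Longrightarrow> 0 \<le> s1 \<Longrightarrow> s1 \<le> s2 \<Longrightarrow>
     V (z + s1 *\<^sub>R e) + (2 * \<bar>M\<bar>) * (s2 - s1) \<le> V (z + s2 *\<^sub>R e) + C" and "C \<ge> 0"
    using confining_ray_growth[OF assms(1), of "2 * \<bar>M\<bar>"] by (metis abs_ge_zero mult_nonneg_nonneg zero_le_numeral)
  have *: "V ((1/2) *\<^sub>R x) + \<bar>M\<bar> * norm x \<le> V x + C" for x
  proof (cases "x = 0")
    case False
    thus ?thesis using C[of 0 "x /\<^sub>R norm x" "norm x / 2" "norm x"] by simp
  qed (use \<open>C \<ge> 0\<close> in simp)
  have "integrable lborel (\<lambda>x. exp C * exp (- V ((1/2) *\<^sub>R x)))"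
  proof -
    have "integrable lborel (\<lambda>x. exp (- V (0 + (1/2) *\<^sub>R x)))"
      unfolding integrable_iff_bounded
    proof
      have "ennreal ((1/2) ^ DIM('a)) * (\<integral>\<^sup>+x. ennreal (norm (exp (- V (0 + (1/2) *\<^sub>R x)))) \<partial>lborel)
          = (\<integral>\<^sup>+x. ennreal (norm (exp (- V x))) \<partial>lborel)"
        by (subst nn_integral_lborel_affine[of _ "1/2" 0]) auto
      also have "\<dots> < \<infinity>" using int by (simp add: integrable_iff_bounded)
      finally show "(\<integral>\<^sup>+x. ennreal (norm (exp (- V (0 + (1/2) *\<^sub>R x)))) \<partial>lborel) < \<infinity>"
        by (auto simp: ennreal_mult_less_top)
    qed simp
    thus ?thesis by simp
  qed
  thus ?thesis
  proof (rule Bochner_Integration.integrable_bound)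
    show "AE x in lborel. norm (exp (M * norm x) * exp (- V x)) \<le> norm (exp C * exp (- V ((1/2) *\<^sub>R x)))"
    proof (intro AE_I2)
      fix x :: 'a
      have "M * norm x \<le> \<bar>M\<bar> * norm x" by (intro mult_right_mono) auto
      hence "M * norm x - V x \<le> C - V ((1/2) *\<^sub>R x)" using *[of x] by linarith
      thus "norm (exp (M * norm x) * exp (- V x)) \<le> norm (exp C * exp (- V ((1/2) *\<^sub>R x)))"
        by (simp add: exp_add[symmetric])
    qed
  qed simp
qed

text \<open>The integrand is at most a sum over balls of integer radius with exponentially small weights, and
  the volumes of the balls grow only polynomially.\<close>

lemma nn_integral_exp_norm_finite:
  "(\<integral>\<^sup>+x. ennreal (exp (- norm (x::'a::euclidean_space)) * norm x) \<partial>lborel) < \<infinity>"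
proof -
  define c where "c = measure lborel (ball (0::'a) 1)"
  have c0: "c \<ge> 0" by (simp add: c_def)
  have vol: "emeasure lborel (ball (0::'a) (real n + 1)) = ennreal ((real n + 1) ^ DIM('a) * c)" for n
  proof -
    have "emeasure lborel (ball (0::'a) (real n + 1)) = ennreal (measure lborel (ball (0::'a) (real n + 1)))"
      by (rule emeasure_eq_ennreal_measure) (use emeasure_lborel_ball_finite in \<open>auto simp: less_top\<close>)
    also have "measure lborel (ball (0::'a) (real n + 1)) = (real n + 1) ^ DIM('a) * c"
      unfolding c_def by (subst content_ball_conv_unit_ball) auto
    finally show ?thesis .
  qed
  let ?a = "\<lambda>n::nat. exp (- real n) * (real n + 1) * ((real n + 1) ^ DIM('a) * c)"
  have sm: "summable ?a"
  proof -
    have "summable (\<lambda>n::nat. exp (- real n) * (real n + 1) ^ (DIM('a) + 1))"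
    proof (rule ratio_test_convergence)
      show "eventually (\<lambda>n. exp (- real n) * (real n + 1) ^ (DIM('a) + 1) > 0) sequentially"
        by (intro always_eventually allI mult_pos_pos zero_less_power) auto
      have "(\<lambda>n::nat. (real n + 1) / (real (Suc n) + 1)) \<longlonglongrightarrow> 1" by real_asymp
      hence "(\<lambda>n::nat. exp 1 * ((real n + 1) / (real (Suc n) + 1)) ^ (DIM('a) + 1)) \<longlonglongrightarrow> exp 1 * 1 ^ (DIM('a) + 1)"
        by (intro tendsto_intros)
      moreover have "exp (- real n) * (real n + 1) ^ (DIM('a) + 1) /
           (exp (- real (Suc n)) * (real (Suc n) + 1) ^ (DIM('a) + 1))
         = exp 1 * ((real n + 1) / (real (Suc n) + 1)) ^ (DIM('a) + 1)" for n
      proof -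
        have "exp (- real n) = exp 1 * exp (- real (Suc n))" by (simp add: exp_add[symmetric])
        thus ?thesis by (simp add: power_divide)
      qed
      ultimately have "(\<lambda>n::nat. exp (- real n) * (real n + 1) ^ (DIM('a) + 1) /
           (exp (- real (Suc n)) * (real (Suc n) + 1) ^ (DIM('a) + 1))) \<longlonglongrightarrow> exp 1" by simp
      hence "liminf (\<lambda>n. ereal (exp (- real n) * (real n + 1) ^ (DIM('a) + 1) /
           (exp (- real (Suc n)) * (real (Suc n) + 1) ^ (DIM('a) + 1)))) = ereal (exp 1)"
        by (intro lim_imp_Liminf) auto
      moreover have "1 < ereal (exp 1)" by (simp add: one_ereal_def)
      ultimately show "1 < liminf (\<lambda>n. ereal (exp (- real n) * (real n + 1) ^ (DIM('a) + 1) /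
           (exp (- real (Suc n)) * (real (Suc n) + 1) ^ (DIM('a) + 1))))" by (simp only:)
    qed
    hence "summable (\<lambda>n::nat. (exp (- real n) * (real n + 1) ^ (DIM('a) + 1)) * c)" by (rule summable_mult2)
    thus ?thesis by (simp add: mult_ac)
  qed
  have "(\<integral>\<^sup>+x. ennreal (exp (- norm (x::'a)) * norm x) \<partial>lborel)
     \<le> (\<integral>\<^sup>+x. (\<Sum>n. ennreal (exp (- real n) * (real n + 1)) * indicator (ball (0::'a) (real n + 1)) x) \<partial>lborel)"
  proof (rule nn_integral_mono)
    fix x :: 'a
    define n where "n = nat \<lfloor>norm x\<rfloor>"
    have n: "real n \<le> norm x" "norm x < real n + 1" by (auto simp: n_def)
    have "ennreal (exp (- norm x) * norm x) \<le> ennreal (exp (- real n) * (real n + 1))"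
      using n by (intro ennreal_leI mult_mono) auto
    also have "\<dots> = (\<Sum>n\<in>{n}. ennreal (exp (- real n) * (real n + 1)) * indicator (ball (0::'a) (real n + 1)) x)"
      using n by simp
    also have "\<dots> \<le> (\<Sum>n. ennreal (exp (- real n) * (real n + 1)) * indicator (ball (0::'a) (real n + 1)) x)"
      by (intro sum_le_suminf) auto
    finally show "ennreal (exp (- norm x) * norm x) \<le> (\<Sum>n. ennreal (exp (- real n) * (real n + 1)) * indicator (ball (0::'a) (real n + 1)) x)" .
  qed
  also have "\<dots> = (\<Sum>n. ennreal (exp (- real n) * (real n + 1)) * emeasure lborel (ball (0::'a) (real n + 1)))"
  proof (subst nn_integral_suminf)
    show "(\<lambda>x. ennreal (exp (- real i) * (real i + 1)) * indicator (ball (0::'a) (real i + 1)) x) \<in> borel_measurable lborel" for i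
      by (rule borel_measurable_times_ennreal; (rule borel_measurable_const | rule borel_measurable_indicator)?) simp
  qed (subst nn_integral_cmult_indicator, auto)
  also have "\<dots> = (\<Sum>n. ennreal (?a n))"
    by (rule suminf_cong) (subst vol, subst ennreal_mult[symmetric], auto simp: c0)
  also have "\<dots> = ennreal (\<Sum>n. ?a n)"
    by (rule suminf_ennreal2[OF _ sm]) (intro mult_nonneg_nonneg c0 zero_le_power; simp)
  also have "\<dots> < \<infinity>" by simp
  finally show ?thesis .
qed

section \<open>Solving the divergence equation explicitly\<close>

lemma test_function_bounded:
  assumes "test_function \<phi> \<phi>'"
  obtains B where "B \<ge> 0" "\<And>x. \<bar>\<phi> x\<bar> \<le> B" "\<And>x. norm (\<phi>' x) \<le> B"
proof -
  let ?K = "closure {x. \<phi> x \<noteq> 0}"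
  have d: "\<And>x. (\<phi> has_derivative (\<lambda>y. y \<bullet> \<phi>' x)) (at x)" and c': "continuous_on UNIV \<phi>'"
    and K: "compact ?K"
    using assms by (auto simp: test_function_def gderiv_def)
  have c: "continuous_on UNIV \<phi>"
    using d by (meson UNIV_I continuous_at_imp_continuous_on has_derivative_continuous)
  have out: "\<phi>' x = 0" if "x \<notin> ?K" for x
  proof -
    have "((\<lambda>x. 0) has_derivative (\<lambda>y. y \<bullet> \<phi>' x)) (at x)"
    proof (rule has_derivative_transform_within_open[OF d])
      show "open (- ?K)" by (rule open_Compl) simp
      show "x \<in> - ?K" using that by simp
      show "\<phi> y = 0" if "y \<in> - ?K" for y using that closure_subset[of "{x. \<phi> x \<noteq> 0}"] by blast
    qed
    hence "(\<lambda>y. y \<bullet> \<phi>' x) = (\<lambda>y. 0)" by (rule has_derivative_unique) simp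
    thus ?thesis by (metis inner_eq_zero_iff)
  qed
  have "bounded (\<phi> ` ?K)" "bounded (\<phi>' ` ?K)"
    by (intro compact_imp_bounded compact_continuous_image K continuous_on_subset[OF c] continuous_on_subset[OF c'] subset_UNIV)+
  then obtain B1 B2 where B: "\<forall>v\<in>\<phi> ` ?K. norm v \<le> B1" "\<forall>v\<in>\<phi>' ` ?K. norm v \<le> B2"
    unfolding bounded_iff by blast
  show thesis
  proof (rule that[of "\<bar>B1\<bar> + \<bar>B2\<bar>"])
    fix x
    show "\<bar>\<phi> x\<bar> \<le> \<bar>B1\<bar> + \<bar>B2\<bar>"
    proof (cases "x \<in> ?K")
      case True thus ?thesis using B(1) by fastforce
    next
      case False
      hence "\<phi> x = 0" using closure_subset[of "{x. \<phi> x \<noteq> 0}"] by blast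
      thus ?thesis by simp
    qed
    show "norm (\<phi>' x) \<le> \<bar>B1\<bar> + \<bar>B2\<bar>"
    proof (cases "x \<in> ?K")
      case True thus ?thesis using B(2) by fastforce
    next
      case False
      thus ?thesis using out by simp
    qed
  qed simp
qed

lemma test_function_continuous:
  assumes "test_function \<phi> \<phi>'"
  shows "continuous_on UNIV \<phi>" "continuous_on UNIV \<phi>'"
proof -
  have d: "\<And>x. (\<phi> has_derivative (\<lambda>y. y \<bullet> \<phi>' x)) (at x)"
    using assms by (auto simp: test_function_def gderiv_def)
  show "continuous_on UNIV \<phi>"
    using d by (meson UNIV_I continuous_at_imp_continuous_on has_derivative_continuous)
  show "continuous_on UNIV \<phi>'" using assms by (simp add: test_function_def)
qed

lemma test_function_measurable:
  assumes "test_function \<phi> \<phi>'"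
  shows "\<phi> \<in> borel_measurable borel" "\<phi>' \<in> borel_measurable borel"
  using test_function_continuous[OF assms] by (auto intro: borel_measurable_continuous_onI)

text \<open>The contribution of the pair \<open>(t, z)\<close> to the flow through \<open>x\<close> when the mass of \<open>f\<close> at
  \<open>y = z + (x - z) / t\<close> is moved along the segment from \<open>y\<close> to \<open>z\<close>. One factor \<open>1 / t\<close> turns \<open>x - z\<close> into
  the displacement \<open>y - z\<close>, and the others are the Jacobian of \<open>y\<close> as a function of \<open>x\<close>.\<close>

definition bogovskii_kernel :: "('a::euclidean_space \<Rightarrow> real) \<Rightarrow> 'a \<Rightarrow> real \<times> 'a \<Rightarrow> 'a" where
  "bogovskii_kernel f x p =
     (indicator ({0<..1} \<times> cball 0 1) p * f (snd p + (x - snd p) /\<^sub>R fst p) / fst p ^ (DIM('a) + 1))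
       *\<^sub>R (x - snd p)"

text \<open>The destinations \<open>z\<close> are averaged over the unit ball; with a single destination the flow would,
  in dimension two and higher, be too singular there to be square-integrable. The sign makes the divergence equal to \<open>f\<close> and not to \<open>- f\<close>.\<close>

definition bogovskii :: "('a::euclidean_space \<Rightarrow> real) \<Rightarrow> 'a \<Rightarrow> 'a" where
  "bogovskii f x = - ((LBINT p. bogovskii_kernel f x p) /\<^sub>R measure lborel (cball 0 1 :: 'a set))"

lemma measurable_fst_borel [measurable]: "fst \<in> borel_measurable (borel :: ('a::second_countable_topology \<times> 'b::second_countable_topology) measure)"
  by (simp add: borel_prod[symmetric])

lemma measurable_snd_borel [measurable]: "snd \<in> borel_measurable (borel :: ('a::second_countable_topology \<times> 'b::second_countable_topology) measure)"
  by (simp add: borel_prod[symmetric])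

lemma measurable_bogovskii:
  fixes f :: "real \<Rightarrow> 'a::euclidean_space \<Rightarrow> real"
  assumes [measurable]: "(\<lambda>q. f (fst q) (snd q)) \<in> borel_measurable borel"
  shows "(\<lambda>q. bogovskii (f (fst q)) (snd q)) \<in> borel_measurable borel"
proof -
  have [measurable]: "({0<..1::real} \<times> cball (0::'a) 1) \<in> sets borel"
    by (simp add: borel_prod[symmetric])
  have [measurable]: "(\<lambda>q. f (a q) (b q)) \<in> borel_measurable M"
    if [measurable]: "a \<in> borel_measurable M" "b \<in> borel_measurable M" for a b and M :: "'m measure"
  proof -
    have "(\<lambda>q. (a q, b q)) \<in> borel_measurable M" by (simp add: borel_measurable_Pair)
    from measurable_compose[OF this assms] show ?thesis by simp
  qed
  have "(\<lambda>q. LBINT p. bogovskii_kernel (f (fst q)) (snd q) p) \<in> borel_measurable borel"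
    unfolding bogovskii_kernel_def by measurable
  thus ?thesis unfolding bogovskii_def by measurable
qed

lemma bogovskii_domain:
  shows "({0<..1::real} \<times> cball (0::'a::euclidean_space) 1) \<in> sets borel"
    and "emeasure lborel ({0<..1::real} \<times> cball (0::'a) 1) < \<infinity>"
proof -
  show "({0<..1::real} \<times> cball (0::'a) 1) \<in> sets borel" by (simp add: borel_prod[symmetric])
  have "emeasure lborel ({0<..1::real} \<times> cball (0::'a) 1) = emeasure lborel {0<..1::real} * emeasure lborel (cball (0::'a) 1)"
    by (subst lborel_prod[symmetric]) (simp add: lborel.emeasure_pair_measure_Times)
  also have "\<dots> < \<infinity>" using emeasure_lborel_cball_finite[of "0::'a" 1] by (simp add: ennreal_mult_less_top)
  finally show "emeasure lborel ({0<..1::real} \<times> cball (0::'a) 1) < \<infinity>" .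
qed

text \<open>Substituting \<open>y\<close> for \<open>x\<close> turns the pairing with the gradient into \<open>f y\<close> times the integral of the
  gradient along the segment from \<open>z\<close> to \<open>y\<close>, that is, \<open>\<phi> y - \<phi> z\<close>. The terms with \<open>\<phi> z\<close> cancel because
  \<open>f\<close> has total mass zero.\<close>

lemma bogovskii_weak_divergence:
  fixes f :: "'a::euclidean_space \<Rightarrow> real"
  assumes int: "integrable lborel f" "integrable lborel (\<lambda>y. norm y * f y)"
    and zero: "(LBINT y. f y) = 0"
    and ker: "\<And>x. integrable lborel (bogovskii_kernel f x)"
    and test: "test_function \<phi> \<phi>'"
  shows "integrable lborel (\<lambda>x. \<phi>' x \<bullet> bogovskii f x)"
    and "(LBINT x. \<phi>' x \<bullet> bogovskii f x) = - (LBINT x. \<phi> x * f x)"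
proof -
  have fm [measurable]: "f \<in> borel_measurable borel" using int(1) by (simp add: integrable_iff_bounded)
  note [measurable] = test_function_measurable[OF test]
  note Im [measurable] = bogovskii_domain(1)[where 'a='a]
  have intI: "integrable lborel (indicator ({0<..1::real} \<times> cball (0::'a) 1) :: _ \<Rightarrow> real)"
    by (subst integrable_indicator_iff) (use bogovskii_domain in \<open>auto simp: Im\<close>)
  obtain B where B: "B \<ge> 0" "\<And>x. \<bar>\<phi> x\<bar> \<le> B" "\<And>x. norm (\<phi>' x) \<le> B"
    using test_function_bounded[OF test] by blast
  define c where "c = measure lborel (cball 0 1 :: 'a set)"
  have c0: "c > 0" unfolding c_def by (simp add: content_cball_pos)
  define I where "I = (indicator ({0<..1::real} \<times> cball (0::'a) 1) :: real \<times> 'a \<Rightarrow> real)"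
  have [measurable]: "I \<in> borel_measurable borel" unfolding I_def by measurable
  (* \<Psi> and \<Phi> are the same integrand in the variables y and x = z + t (y - z). *)
  define \<Psi> where "\<Psi> p y = I p * f y * (\<phi>' (snd p + fst p *\<^sub>R (y - snd p)) \<bullet> (y - snd p))" for p y
  define \<Phi> where "\<Phi> p x = \<phi>' x \<bullet> bogovskii_kernel f x p" for p x
  have mPsi: "(\<lambda>q. \<Psi> (fst q) (snd q)) \<in> borel_measurable (lborel \<Otimes>\<^sub>M lborel)"
    unfolding \<Psi>_def by measurable
  have mPhi: "(\<lambda>q. \<Phi> (fst q) (snd q)) \<in> borel_measurable (lborel \<Otimes>\<^sub>M lborel)"
    unfolding \<Phi>_def bogovskii_kernel_def by measurable
  have nPsi: "(\<lambda>q. ennreal (norm (\<Psi> (fst q) (snd q)))) \<in> borel_measurable (lborel \<Otimes>\<^sub>M lborel)"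
    unfolding \<Psi>_def by measurable
  have nPhi: "(\<lambda>q. ennreal (norm (\<Phi> (fst q) (snd q)))) \<in> borel_measurable (lborel \<Otimes>\<^sub>M lborel)"
    unfolding \<Phi>_def bogovskii_kernel_def by measurable
  have subst: "\<Phi> p x = \<bar>1 / fst p\<bar> ^ DIM('a) * \<Psi> p ((snd p - snd p /\<^sub>R fst p) + (1 / fst p) *\<^sub>R x)"
    if "I p \<noteq> 0" for p x
  proof -
    obtain t z where p: "p = (t, z)" by (cases p)
    have t: "0 < t" using that by (auto simp: I_def p indicator_def split: if_splits)
    have y: "(z - z /\<^sub>R t) + (1 / t) *\<^sub>R x = z + (x - z) /\<^sub>R t" using t
      by (simp add: algebra_simps divide_inverse)
    have e: "z + (x - z) /\<^sub>R t - z = (x - z) /\<^sub>R t" "z + t *\<^sub>R ((x - z) /\<^sub>R t) = x"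
      using t by simp_all
    show ?thesis using t
      unfolding \<Phi>_def \<Psi>_def bogovskii_kernel_def p fst_conv snd_conv y e inner_scaleR_right
      by (simp add: I_def power_divide inverse_eq_divide divide_simps)
  qed
  have nn: "(\<integral>\<^sup>+x. ennreal (norm (\<Phi> p x)) \<partial>lborel) = (\<integral>\<^sup>+y. ennreal (norm (\<Psi> p y)) \<partial>lborel)" for p
  proof (cases "I p = 0")
    case True thus ?thesis by (simp add: \<Phi>_def \<Psi>_def bogovskii_kernel_def I_def)
  next
    case False
    hence t: "1 / fst p \<noteq> 0" by (auto simp: I_def indicator_def mem_Times_iff split: if_splits)
    have "(\<integral>\<^sup>+y. ennreal (norm (\<Psi> p y)) \<partial>lborel) = ennreal (\<bar>1 / fst p\<bar> ^ DIM('a)) *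
       (\<integral>\<^sup>+x. ennreal (norm (\<Psi> p ((snd p - snd p /\<^sub>R fst p) + (1 / fst p) *\<^sub>R x))) \<partial>lborel)"
      by (rule nn_integral_lborel_affine[OF _ t]) (unfold \<Psi>_def, measurable)
    also have "\<dots> = (\<integral>\<^sup>+x. ennreal (norm (\<Phi> p x)) \<partial>lborel)"
      unfolding subst[OF False]
      by (subst nn_integral_cmult[symmetric])
         (unfold \<Psi>_def, measurable, simp add: ennreal_mult[symmetric] abs_mult power_abs)
    finally show ?thesis by simp
  qed
  have eq: "(LBINT x. \<Phi> p x) = (LBINT y. \<Psi> p y)" for p
  proof (cases "I p = 0")
    case True thus ?thesis by (simp add: \<Phi>_def \<Psi>_def bogovskii_kernel_def I_def)
  next
    case False
    hence t: "1 / fst p \<noteq> 0" by (auto simp: I_def indicator_def mem_Times_iff split: if_splits)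
    have "(LBINT y. \<Psi> p y) = \<bar>1 / fst p\<bar> ^ DIM('a) *\<^sub>R
       (LBINT x. \<Psi> p ((snd p - snd p /\<^sub>R fst p) + (1 / fst p) *\<^sub>R x))"
      by (rule integral_lborel_affine[OF _ t]) (unfold \<Psi>_def, measurable)
    also have "\<dots> = (LBINT x. \<Phi> p x)"
      unfolding subst[OF False] by simp
    finally show ?thesis by simp
  qed
  define G where "G y = B * (norm y * \<bar>f y\<bar> + \<bar>f y\<bar>)" for y
  have intG: "integrable lborel G"
    using integrable_norm[OF int(1)] integrable_norm[OF int(2)] unfolding G_def by (simp add: abs_mult)
  have int\<Psi>: "integrable (lborel \<Otimes>\<^sub>M lborel) (\<lambda>q. \<Psi> (fst q) (snd q))"
  proof (rule Bochner_Integration.integrable_bound)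
    show "integrable (lborel \<Otimes>\<^sub>M lborel) (\<lambda>q. I (fst q) * G (snd q))"
    proof (rule lborel_pair.Fubini_integrable)
      show "integrable lborel (\<lambda>p. LBINT y. norm (I (fst (p, y)) * G (snd (p, y))))"
        using intI by (simp add: abs_mult I_def)
      show "AE p in lborel. integrable lborel (\<lambda>y. I (fst (p, y)) * G (snd (p, y)))"
        using intG by simp
    qed (unfold G_def, measurable)
    show "AE q in lborel \<Otimes>\<^sub>M lborel. norm (\<Psi> (fst q) (snd q)) \<le> norm (I (fst q) * G (snd q))"
    proof (intro AE_I2)
      fix q :: "(real \<times> 'a) \<times> 'a"
      obtain t z y where q: "q = ((t, z), y)" by (metis surj_pair)
      show "norm (\<Psi> (fst q) (snd q)) \<le> norm (I (fst q) * G (snd q))"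
      proof (cases "I (t, z) = 0")
        case False
        hence z: "norm z \<le> 1" and I1: "I (t, z) = 1" by (auto simp: I_def indicator_def split: if_splits)
        have "\<bar>\<phi>' (z + t *\<^sub>R (y - z)) \<bullet> (y - z)\<bar> \<le> norm (\<phi>' (z + t *\<^sub>R (y - z))) * norm (y - z)"
          by (rule Cauchy_Schwarz_ineq2)
        also have "\<dots> \<le> B * (norm y + 1)"
          using B norm_triangle_ineq4[of y z] z by (intro mult_mono) auto
        finally have "\<bar>f y\<bar> * \<bar>\<phi>' (z + t *\<^sub>R (y - z)) \<bullet> (y - z)\<bar> \<le> \<bar>f y\<bar> * (B * (norm y + 1))"
          by (rule mult_left_mono) simp
        also have "\<dots> = G y" by (simp add: G_def algebra_simps)
        finally show ?thesis using I1 by (simp add: q \<Psi>_def abs_mult)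
      qed (simp add: q \<Psi>_def)
    qed
  qed (rule mPsi)
  have int\<Phi>: "integrable (lborel \<Otimes>\<^sub>M lborel) (\<lambda>q. \<Phi> (fst q) (snd q))"
    unfolding integrable_iff_bounded
  proof
    have "(\<integral>\<^sup>+q. ennreal (norm (\<Phi> (fst q) (snd q))) \<partial>(lborel \<Otimes>\<^sub>M lborel))
        = (\<integral>\<^sup>+p. \<integral>\<^sup>+x. ennreal (norm (\<Phi> p x)) \<partial>lborel \<partial>lborel)"
      by (subst lborel.nn_integral_fst[symmetric]) (rule nPhi, simp)
    also have "\<dots> = (\<integral>\<^sup>+p. \<integral>\<^sup>+x. ennreal (norm (\<Psi> p x)) \<partial>lborel \<partial>lborel)" by (simp only: nn)
    also have "\<dots> = (\<integral>\<^sup>+q. ennreal (norm (\<Psi> (fst q) (snd q))) \<partial>(lborel \<Otimes>\<^sub>M lborel))"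
      by (subst lborel.nn_integral_fst[symmetric]) (rule nPsi, simp)
    also have "\<dots> < \<infinity>" using int\<Psi> by (simp add: integrable_iff_bounded)
    finally show "(\<integral>\<^sup>+q. ennreal (norm (\<Phi> (fst q) (snd q))) \<partial>(lborel \<Otimes>\<^sub>M lborel)) < \<infinity>" .
  qed (rule mPhi)
  have bog: "\<phi>' x \<bullet> bogovskii f x = - ((LBINT p. \<Phi> p x) / c)" for x
    unfolding bogovskii_def \<Phi>_def c_def[symmetric]
    by (subst integral_inner_right) (use ker in \<open>auto simp: divide_inverse_commute\<close>)
  have sw: "(\<lambda>q. \<Phi> (fst q) (snd q)) = case_prod \<Phi>" "(\<lambda>q. \<Psi> (fst q) (snd q)) = case_prod \<Psi>" by auto
  have "integrable lborel (\<lambda>x. LBINT p. \<Phi> p x)"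
    using lborel_pair.integrable_snd[of \<Phi>] int\<Phi> by (simp add: sw)
  thus "integrable lborel (\<lambda>x. \<phi>' x \<bullet> bogovskii f x)" unfolding bog by simp
  define A where "A = (LBINT z. indicator (cball 0 1) z * \<phi> z)"
  have inner: "(LBINT p. \<Psi> p y) = f y * (c * \<phi> y - A)" for y
  proof -
    define \<theta> where "\<theta> t z = I (t, z) * (\<phi>' (z + t *\<^sub>R (y - z)) \<bullet> (y - z))" for t z
    have [measurable]: "case_prod \<theta> \<in> borel_measurable (lborel \<Otimes>\<^sub>M lborel)"
      unfolding \<theta>_def by measurable
    have int\<theta>: "integrable (lborel \<Otimes>\<^sub>M lborel) (case_prod \<theta>)"
    proof (rule Bochner_Integration.integrable_bound)
      show "integrable (lborel \<Otimes>\<^sub>M lborel) (\<lambda>p. (B * (norm y + 1)) * I p)"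
        using intI by (simp add: I_def lborel_prod)
      show "AE p in lborel \<Otimes>\<^sub>M lborel. norm (case_prod \<theta> p) \<le> norm ((B * (norm y + 1)) * I p)"
      proof (intro AE_I2)
        fix p :: "real \<times> 'a" obtain t z where p: "p = (t, z)" by (cases p)
        show "norm (case_prod \<theta> p) \<le> norm ((B * (norm y + 1)) * I p)"
        proof (cases "I p = 0")
          case False
          hence z: "norm z \<le> 1" and I1: "I (t, z) = 1" by (auto simp: p I_def indicator_def split: if_splits)
          have "\<bar>\<phi>' (z + t *\<^sub>R (y - z)) \<bullet> (y - z)\<bar> \<le> norm (\<phi>' (z + t *\<^sub>R (y - z))) * norm (y - z)"
            by (rule Cauchy_Schwarz_ineq2)
          also have "\<dots> \<le> B * (norm y + 1)"
            using B norm_triangle_ineq4[of y z] z by (intro mult_mono) auto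
          also have "\<dots> \<le> \<bar>B * (norm y + 1)\<bar>" by simp
          finally show ?thesis using I1 by (simp add: p \<theta>_def)
        qed (simp add: p \<theta>_def)
      qed
    qed measurable
    have slice: "(LBINT t. \<theta> t z) = indicator (cball 0 1) z * (\<phi> y - \<phi> z)" for z
    proof -
      have "(LBINT t. \<theta> t z)
          = (LBINT t. indicator (cball 0 1) z * ((\<phi>' (z + t *\<^sub>R (y - z)) \<bullet> (y - z)) * indicator {0..1} t))"
      (* The kernel omits t = 0, the fundamental theorem of calculus wants the closed interval. *)
      proof (rule integral_cong_AE)
        have "AE t in lborel. t \<noteq> (0::real)" by (rule AE_lborel_singleton)
        thus "AE t in lborel. \<theta> t z = indicator (cball 0 1) z * ((\<phi>' (z + t *\<^sub>R (y - z)) \<bullet> (y - z)) * indicator {0..1} t)"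
          by eventually_elim (auto simp: \<theta>_def I_def indicator_def)
        show "(\<lambda>t. \<theta> t z) \<in> borel_measurable lborel" unfolding \<theta>_def by measurable
      qed measurable
      also have "\<dots> = indicator (cball 0 1) z * (LBINT t. (\<phi>' (z + t *\<^sub>R (y - z)) \<bullet> (y - z)) * indicator {0..1} t)"
        by simp
      also have "(LBINT t. (\<phi>' (z + t *\<^sub>R (y - z)) \<bullet> (y - z)) * indicator {0..1} t)
          = \<phi> (z + 1 *\<^sub>R (y - z)) - \<phi> (z + 0 *\<^sub>R (y - z))"
      proof (rule integral_FTC_Icc_real)
        fix t :: real
        have "(\<phi> has_derivative (\<lambda>v. v \<bullet> \<phi>' (z + t *\<^sub>R (y - z)))) (at (z + t *\<^sub>R (y - z)))"
          using test by (auto simp: test_function_def gderiv_def)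
        hence "((\<lambda>t. \<phi> (z + t *\<^sub>R (y - z))) has_derivative (\<lambda>s. (s *\<^sub>R (y - z)) \<bullet> \<phi>' (z + t *\<^sub>R (y - z)))) (at t)"
          by (rule has_derivative_compose[rotated]) (auto intro!: derivative_eq_intros)
        thus "((\<lambda>t. \<phi> (z + t *\<^sub>R (y - z))) has_real_derivative (\<phi>' (z + t *\<^sub>R (y - z)) \<bullet> (y - z))) (at t)"
          by (simp add: has_field_derivative_def inner_commute mult_commute_abs)
        have "continuous_on UNIV (\<lambda>t. \<phi>' (z + t *\<^sub>R (y - z)) \<bullet> (y - z))"
          by (intro continuous_intros continuous_on_compose2[OF test_function_continuous(2)[OF test]]) auto
        thus "isCont (\<lambda>t. \<phi>' (z + t *\<^sub>R (y - z)) \<bullet> (y - z)) t"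
          by (simp add: continuous_on_eq_continuous_at)
      qed simp
      finally show ?thesis by simp
    qed
    have "(LBINT p. \<Psi> p y) = (\<integral>p. f y * case_prod \<theta> p \<partial>(lborel \<Otimes>\<^sub>M lborel))"
      by (simp add: lborel_prod \<Psi>_def \<theta>_def split_beta mult_ac)
    also have "\<dots> = f y * (\<integral>z. \<integral>t. \<theta> t z \<partial>lborel \<partial>lborel)"
      by (simp add: lborel_pair.integral_snd[OF int\<theta>])
    also have "(\<integral>z. \<integral>t. \<theta> t z \<partial>lborel \<partial>lborel) = (LBINT z. \<phi> y * indicator (cball 0 1) z - indicator (cball 0 1) z * \<phi> z)"
      unfolding slice by (simp add: algebra_simps)
    also have "\<dots> = \<phi> y * c - A"
    proof -
      have i1: "integrable lborel (indicator (cball (0::'a) 1) :: 'a \<Rightarrow> real)"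
        using emeasure_lborel_cball_finite by (subst integrable_indicator_iff) auto
      have "integrable lborel (\<lambda>z. \<phi> z * indicator (cball (0::'a) 1) z)"
        by (rule integrable_bounded_mult[OF i1 _ B(2)]) measurable
      hence "integrable lborel (\<lambda>z. indicator (cball (0::'a) 1) z * \<phi> z)" by (simp only: mult.commute)
      thus ?thesis unfolding A_def c_def using i1 by simp
    qed
    finally show ?thesis by (simp add: mult.commute)
  qed
  have "(LBINT x. \<phi>' x \<bullet> bogovskii f x) = - ((\<integral>x. \<integral>p. \<Phi> p x \<partial>lborel \<partial>lborel) / c)"
    unfolding bog by simp
  also have "(\<integral>x. \<integral>p. \<Phi> p x \<partial>lborel \<partial>lborel) = (\<integral>p. \<integral>x. \<Phi> p x \<partial>lborel \<partial>lborel)"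
    using lborel_pair.Fubini_integral[of \<Phi>] int\<Phi> by (simp add: sw)
  also have "\<dots> = (\<integral>p. \<integral>y. \<Psi> p y \<partial>lborel \<partial>lborel)" unfolding eq ..
  also have "\<dots> = (\<integral>y. \<integral>p. \<Psi> p y \<partial>lborel \<partial>lborel)"
    using lborel_pair.Fubini_integral[of \<Psi>] int\<Psi> by (simp add: sw)
  also have "\<dots> = (LBINT y. c * (\<phi> y * f y) - A * f y)"
    unfolding inner by (simp add: algebra_simps)
  also have "\<dots> = c * (LBINT y. \<phi> y * f y)"
  proof -
    have "integrable lborel (\<lambda>y. \<phi> y * f y)"
      by (rule integrable_bounded_mult[OF int(1) _ B(2)]) measurable
    thus ?thesis using int(1) zero by simp
  qed
  finally show "(LBINT x. \<phi>' x \<bullet> bogovskii f x) = - (LBINT x. \<phi> x * f x)"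
    using c0 by simp
qed


text \<open>Going outward from \<open>x\<close> to \<open>y\<close>, the ray estimate with slope 2 bounds \<open>exp (- V y)\<close> by a multiple of
  \<open>exp (- V x)\<close> times \<open>exp (- 2 * norm (y - x))\<close>. One half of this decay absorbs the growth of \<open>f\<close> relative to
  the density, and the other makes the kernel integrable uniformly in \<open>x\<close>. For \<open>t \<ge> 1 / 2\<close> the powers of \<open>t\<close>
  are bounded. For \<open>t < 1 / 2\<close> the destination \<open>z\<close> is replaced by the variable \<open>v\<close> with \<open>norm v = norm (y - x)\<close>;
  the Jacobian of this substitution cancels the singularity at \<open>t = 0\<close>.\<close>

lemma nn_integral_bogovskii_kernel_bound:
  fixes V :: "'a::euclidean_space \<Rightarrow> real"
  assumes "confining V g" and fm [measurable]: "f \<in> borel_measurable borel"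
    and f: "\<And>y. \<bar>f y\<bar> \<le> A * (exp (norm y) * exp (- V y))" and "A \<ge> 0"
  obtains C where "C \<ge> 0" "\<And>x. (\<integral>\<^sup>+p. ennreal (norm (bogovskii_kernel f x p)) \<partial>lborel)
      \<le> ennreal (C * (exp (2 * norm x) * exp (- V x)))"
proof -
  obtain C where C: "C \<ge> 0" "\<And>(z::'a) e s1 s2. norm z \<le> 1 \<Longrightarrow> norm e = 1 \<Longrightarrow> 0 \<le> s1 \<Longrightarrow> s1 \<le> s2 \<Longrightarrow>
     V (z + s1 *\<^sub>R e) + 2 * (s2 - s1) \<le> V (z + s2 *\<^sub>R e) + C"
    using confining_ray_growth[OF assms(1), of 2] by (metis zero_le_numeral)
  have ray: "V x + 2 * ((1 / t - 1) * norm (x - z)) \<le> V (z + (x - z) /\<^sub>R t) + C"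
    if "norm z \<le> 1" "0 < t" "t \<le> 1" for x z :: 'a and t :: real
  proof (cases "x = z")
    case False
    define e where "e = (x - z) /\<^sub>R norm (x - z)"
    have "norm e = 1" using False by (simp add: e_def)
    moreover have "norm (x - z) \<le> norm (x - z) / t" using that by (simp add: pos_le_divide_eq mult_left_le)
    moreover have "z + norm (x - z) *\<^sub>R e = x" using False by (simp add: e_def)
    moreover have "z + (norm (x - z) / t) *\<^sub>R e = z + (x - z) /\<^sub>R t"
      using False that by (simp add: e_def inverse_eq_divide)
    ultimately have "V x + 2 * (norm (x - z) / t - norm (x - z)) \<le> V (z + (x - z) /\<^sub>R t) + C"
      using C(2)[of z e "norm (x - z)" "norm (x - z) / t"] that by simp
    thus ?thesis by (simp add: left_diff_distrib)
  qed (use C in simp)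
  have dist: "norm (z + (x - z) /\<^sub>R t) \<le> norm x + (1 / t - 1) * norm (x - z)"
    if "0 < t" "t \<le> 1" for x z :: 'a and t :: real
  proof -
    have "z + (x - z) /\<^sub>R t = x + (1 / t - 1) *\<^sub>R (x - z)"
      by (simp add: scaleR_diff_left inverse_eq_divide)
    also have "norm \<dots> \<le> norm x + \<bar>1 / t - 1\<bar> * norm (x - z)"
      using norm_triangle_ineq[of x "(1 / t - 1) *\<^sub>R (x - z)"] by simp
    also have "\<bar>1 / t - 1\<bar> = 1 / t - 1" using that by simp
    finally show ?thesis .
  qed
  define n where "n = DIM('a)"
  define J where "J = (\<integral>\<^sup>+v. ennreal (exp (- norm (v::'a)) * norm v) \<partial>lborel)"
  have J: "J < \<infinity>" unfolding J_def by (rule nn_integral_exp_norm_finite)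
  define K where "K = measure lborel ({0<..1::real} \<times> cball (0::'a) 1)"
  have Im [measurable]: "({0<..1::real} \<times> cball (0::'a) 1) \<in> sets borel" "({0<..<1/2::real} \<times> (UNIV::'a set)) \<in> sets borel"
    by (simp_all add: borel_prod[symmetric])
  have K: "emeasure lborel ({0<..1::real} \<times> cball (0::'a) 1) = ennreal K"
    unfolding K_def by (rule emeasure_eq_ennreal_measure) (use bogovskii_domain(2)[where 'a='a] in auto)
  (* What remains of the kernel when the factor depending on x alone has been split off. *)
  define k where "k x p = (exp (- ((1 / fst p - 1) * norm (x - snd p))) * norm (x - snd p)) / fst p ^ (n + 1)" for x :: 'a and p
  have [measurable]: "k x \<in> borel_measurable borel" for x unfolding k_def by measurable
  have ker: "norm (bogovskii_kernel f x p) \<le> (A * exp C * (exp (norm x) * exp (- V x))) * (indicator ({0<..1} \<times> cball 0 1) p * k x p)" for x p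
  proof (cases "p \<in> {0<..1} \<times> cball 0 1")
    case True
    then obtain t z where p: "p = (t, z)" and t: "0 < t" "t \<le> 1" and z: "norm z \<le> 1" by auto
    let ?y = "z + (x - z) /\<^sub>R t" and ?d = "(1 / t - 1) * norm (x - z)"
    have "exp (norm ?y) * exp (- V ?y) = exp (norm ?y - V ?y)" by (simp add: exp_add[symmetric])
    also have "\<dots> \<le> exp (norm x - V x + C - ?d)"
      using dist[OF t, of z x] ray[OF z t, of x] by simp
    also have "\<dots> = exp C * (exp (norm x) * exp (- V x)) * exp (- ?d)" by (simp add: exp_add[symmetric])
    finally have "A * (exp (norm ?y) * exp (- V ?y)) \<le> A * (exp C * (exp (norm x) * exp (- V x)) * exp (- ?d))"
      using \<open>A \<ge> 0\<close> by (rule mult_left_mono)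
    hence "\<bar>f ?y\<bar> \<le> A * (exp C * (exp (norm x) * exp (- V x)) * exp (- ?d))"
      using f[of ?y] by linarith
    hence "\<bar>f ?y\<bar> * (norm (x - z) / t ^ (n + 1)) \<le> A * (exp C * (exp (norm x) * exp (- V x)) * exp (- ?d)) * (norm (x - z) / t ^ (n + 1))"
      using t by (intro mult_right_mono) auto
    thus ?thesis using True t by (simp add: bogovskii_kernel_def p k_def n_def abs_mult mult_ac power_abs)
  qed (simp add: bogovskii_kernel_def)
  have split: "ennreal (indicator ({0<..1} \<times> cball 0 1) p * k x p) \<le>
      ennreal ((norm x + 1) * 2 ^ (n + 1)) * indicator ({0<..1} \<times> cball 0 1) p
      + indicator {0<..<1/2} (fst p) * ennreal (k x p)" for x p
  proof (cases "p \<in> {0<..1} \<times> cball 0 1")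
    case True
    then obtain t z where p: "p = (t, z)" and t: "0 < t" "t \<le> 1" and z: "norm z \<le> 1" by auto
    show ?thesis
    proof (cases "t < 1/2")
      case False
      have a: "norm (x - z) \<le> norm x + 1" using norm_triangle_ineq4[of x z] z by linarith
      have b: "1 / t ^ (n + 1) \<le> 2 ^ (n + 1)"
      proof -
        have "(1 / t) ^ (n + 1) \<le> 2 ^ (n + 1)" using False t by (intro power_mono) (auto simp: field_simps)
        thus ?thesis by (simp add: power_one_over)
      qed
      have "exp (- ((1 / t - 1) * norm (x - z))) \<le> 1" using t by simp
      hence "k x p \<le> (1 * norm (x - z)) / t ^ (n + 1)"
        unfolding k_def p fst_conv snd_conv using t by (intro divide_right_mono mult_right_mono) auto
      also have "\<dots> = norm (x - z) * (1 / t ^ (n + 1))" by simp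
      also have "\<dots> \<le> (norm x + 1) * 2 ^ (n + 1)" using a b t by (intro mult_mono) auto
      finally show ?thesis using True False t p by (simp add: ennreal_leI)
    next
      case T: True
      thus ?thesis using True t by (simp add: p)
    qed
  qed simp
  have inner: "(\<integral>\<^sup>+z. ennreal (k x (t, z)) \<partial>lborel) \<le> ennreal (2 ^ (n + 1)) * J" if t: "0 < t" "t < 1/2" for x t
  proof -
    let ?a = "1 / t - 1"
    have a: "?a > 0" using t by (simp add: field_simps)
    have at: "?a * t = 1 - t" using t by (simp add: field_simps)
    have J': "J = ennreal (\<bar>?a\<bar> ^ n) * (\<integral>\<^sup>+z. ennreal (exp (- norm (- (?a *\<^sub>R x) + ?a *\<^sub>R z)) * norm (- (?a *\<^sub>R x) + ?a *\<^sub>R z)) \<partial>lborel)"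
      unfolding J_def n_def using a by (intro nn_integral_lborel_affine) auto
    have nrm: "norm (- (?a *\<^sub>R x) + ?a *\<^sub>R z) = ?a * norm (x - z)" for z
    proof -
      have "- (?a *\<^sub>R x) + ?a *\<^sub>R z = ?a *\<^sub>R (z - x)" by (simp add: scaleR_diff_right)
      thus ?thesis using a by (simp add: norm_minus_commute)
    qed
    have "(\<integral>\<^sup>+z. ennreal (k x (t, z)) \<partial>lborel) = (\<integral>\<^sup>+z. ennreal (1 / (?a * t) ^ (n + 1)) * (ennreal (?a ^ n) * ennreal (exp (- (?a * norm (x - z))) * (?a * norm (x - z)))) \<partial>lborel)"
    proof (rule nn_integral_cong)
      fix z
      have "k x (t, z) = (1 / (?a * t) ^ (n + 1)) * (?a ^ n * (exp (- (?a * norm (x - z))) * (?a * norm (x - z))))"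
        using a t unfolding k_def power_mult_distrib by (simp add: field_simps)
      thus "ennreal (k x (t, z)) = ennreal (1 / (?a * t) ^ (n + 1)) * (ennreal (?a ^ n) * ennreal (exp (- (?a * norm (x - z))) * (?a * norm (x - z))))"
        using a t by (simp add: ennreal_mult[symmetric])
    qed
    also have "\<dots> = ennreal (1 / (?a * t) ^ (n + 1)) * J"
      unfolding J' nrm using a by (simp add: nn_integral_cmult mult.assoc)
    also have "\<dots> \<le> ennreal (2 ^ (n + 1)) * J"
    proof (intro mult_right_mono ennreal_leI)
      have "(1 / (?a * t)) ^ (n + 1) \<le> 2 ^ (n + 1)" unfolding at using t by (intro power_mono) (auto simp: field_simps)
      thus "1 / (?a * t) ^ (n + 1) \<le> 2 ^ (n + 1)" by (simp add: power_one_over)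
    qed simp
    finally show ?thesis .
  qed
  have second: "(\<integral>\<^sup>+p. indicator {0<..<1/2} (fst p) * ennreal (k x p) \<partial>lborel) \<le> ennreal (2 ^ (n + 1)) * J" for x
  proof -
    have meas: "(\<lambda>p. indicator {0<..<1/2} (fst p) * ennreal (k x p)) \<in> borel_measurable (lborel \<Otimes>\<^sub>M lborel)"
      unfolding k_def by measurable
    have "(\<integral>\<^sup>+p. indicator {0<..<1/2} (fst p) * ennreal (k x p) \<partial>lborel)
        = (\<integral>\<^sup>+t. \<integral>\<^sup>+z. indicator {0<..<1/2} t * ennreal (k x (t, z)) \<partial>lborel \<partial>lborel)"
      by (subst lborel_prod[symmetric], subst lborel.nn_integral_fst[symmetric]) (rule meas, simp)
    also have "\<dots> = (\<integral>\<^sup>+t. indicator {0<..<1/2} t * (\<integral>\<^sup>+z. ennreal (k x (t, z)) \<partial>lborel) \<partial>lborel)"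
      by (intro nn_integral_cong nn_integral_cmult) (unfold k_def, measurable)
    also have "\<dots> \<le> (\<integral>\<^sup>+t. (ennreal (2 ^ (n + 1)) * J) * indicator {0<..<1/2::real} t \<partial>lborel)"
      using inner by (intro nn_integral_mono) (auto simp: indicator_def)
    also have "\<dots> = (ennreal (2 ^ (n + 1)) * J) * ennreal (1/2)"
      by (subst nn_integral_cmult_indicator) auto
    also have "\<dots> \<le> (ennreal (2 ^ (n + 1)) * J) * 1" 
      by (intro mult_left_mono) (subst ennreal_1[symmetric], rule ennreal_leI, simp_all)
    finally show ?thesis by simp
  qed
  obtain j where j: "J = ennreal j" "j \<ge> 0" using J by (cases J) auto
  define D where "D = 2 ^ (n + 1) * (K + j)"
  have K0: "K \<ge> 0" by (simp add: K_def)
  have D0: "D \<ge> 0" using K0 j by (simp add: D_def)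
  show thesis
  proof (rule that[of "A * exp C * D"])
    show "A * exp C * D \<ge> 0" using \<open>A \<ge> 0\<close> D0 by simp
    fix x :: 'a
    let ?c = "A * exp C * (exp (norm x) * exp (- V x))"
    have c0: "?c \<ge> 0" using \<open>A \<ge> 0\<close> by simp
    have "(\<integral>\<^sup>+p. ennreal (norm (bogovskii_kernel f x p)) \<partial>lborel)
        \<le> (\<integral>\<^sup>+p. ennreal ?c * ennreal (indicator ({0<..1} \<times> cball 0 1) p * k x p) \<partial>lborel)"
      by (intro nn_integral_mono) (subst ennreal_mult'[OF c0, symmetric], rule ennreal_leI, rule ker)
    also have "\<dots> = ennreal ?c * (\<integral>\<^sup>+p. ennreal (indicator ({0<..1} \<times> cball 0 1) p * k x p) \<partial>lborel)"
      by (rule nn_integral_cmult) measurable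
    also have "\<dots> \<le> ennreal ?c * (\<integral>\<^sup>+p. ennreal ((norm x + 1) * 2 ^ (n + 1)) * indicator ({0<..1} \<times> cball 0 1) p
      + indicator {0<..<1/2} (fst p) * ennreal (k x p) \<partial>lborel)"
      by (intro mult_left_mono nn_integral_mono split) simp
    also have "\<dots> = ennreal ?c * (ennreal ((norm x + 1) * 2 ^ (n + 1)) * ennreal K
      + (\<integral>\<^sup>+p. indicator {0<..<1/2} (fst p) * ennreal (k x p) \<partial>lborel))"
      by (subst nn_integral_add) (measurable, simp add: nn_integral_cmult_indicator Im K)
    also have "\<dots> \<le> ennreal ?c * (ennreal ((norm x + 1) * 2 ^ (n + 1)) * ennreal K + ennreal (2 ^ (n + 1)) * ennreal j)"
      using second[of x] unfolding j(1) by (intro mult_left_mono add_left_mono) auto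
    also have "\<dots> = ennreal (?c * ((norm x + 1) * 2 ^ (n + 1) * K + 2 ^ (n + 1) * j))"
      using c0 K0 j(2) by (simp add: ennreal_mult[symmetric] ennreal_plus[symmetric] del: ennreal_plus)
    also have "\<dots> \<le> ennreal (A * exp C * D * (exp (2 * norm x) * exp (- V x)))"
    proof (rule ennreal_leI)
      have e: "norm x + 1 \<le> exp (norm x)" by (simp add: add.commute exp_ge_add_one_self)
      have "(norm x + 1) * 2 ^ (n + 1) * K + 2 ^ (n + 1) * j \<le> exp (norm x) * 2 ^ (n + 1) * K + exp (norm x) * (2 ^ (n + 1) * j)"
        using e K0 j(2) mult_right_mono[of 1 "exp (norm x)" "2 ^ (n + 1) * j"]
        by (intro add_mono mult_right_mono) auto
      also have "\<dots> = exp (norm x) * D" by (simp add: D_def algebra_simps)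
      finally have "?c * ((norm x + 1) * 2 ^ (n + 1) * K + 2 ^ (n + 1) * j) \<le> ?c * (exp (norm x) * D)"
        using c0 by (rule mult_left_mono)
      also have "\<dots> = A * exp C * D * (exp (2 * norm x) * exp (- V x))"
        by (simp add: mult_ac mult_exp_exp exp_double power2_eq_square)
      finally show "?c * ((norm x + 1) * 2 ^ (n + 1) * K + 2 ^ (n + 1) * j) \<le> A * exp C * D * (exp (2 * norm x) * exp (- V x))" .
    qed
    finally show "(\<integral>\<^sup>+p. ennreal (norm (bogovskii_kernel f x p)) \<partial>lborel) \<le> ennreal (A * exp C * D * (exp (2 * norm x) * exp (- V x)))" .
  qed
qed

lemma bogovskii_bound:
  fixes V :: "'a::euclidean_space \<Rightarrow> real"
  assumes "confining V g" and fm [measurable]: "f \<in> borel_measurable borel"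
    and f: "\<And>y. \<bar>f y\<bar> \<le> A * (exp (norm y) * exp (- V y))" and "A \<ge> 0"
  obtains C where "C \<ge> 0" "\<And>x. norm (bogovskii f x) \<le> C * (exp (2 * norm x) * exp (- V x))"
    "\<And>x. integrable lborel (bogovskii_kernel f x)"
proof -
  obtain C where C: "C \<ge> 0" "\<And>x. (\<integral>\<^sup>+p. ennreal (norm (bogovskii_kernel f x p)) \<partial>lborel)
      \<le> ennreal (C * (exp (2 * norm x) * exp (- V x)))"
    using nn_integral_bogovskii_kernel_bound[OF assms] by blast
  have [measurable]: "({0<..1::real} \<times> cball (0::'a) 1) \<in> sets borel"
    by (simp add: borel_prod[symmetric])
  have int: "integrable lborel (bogovskii_kernel f x)" for x
    unfolding integrable_iff_bounded
  proof
    show "bogovskii_kernel f x \<in> borel_measurable lborel" unfolding bogovskii_kernel_def by measurable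
    show "(\<integral>\<^sup>+p. ennreal (norm (bogovskii_kernel f x p)) \<partial>lborel) < \<infinity>"
      using C(2)[of x] by (simp add: le_less_trans)
  qed
  define c where "c = measure lborel (cball 0 1 :: 'a set)"
  have c0: "c > 0" unfolding c_def by (simp add: content_cball_pos)
  show thesis
  proof (rule that[of "C / c"])
    show "C / c \<ge> 0" using C(1) c0 by simp
    show "integrable lborel (bogovskii_kernel f x)" for x by (rule int)
    fix x
    have "ennreal (norm (LBINT p. bogovskii_kernel f x p)) \<le> ennreal (C * (exp (2 * norm x) * exp (- V x)))"
      using integral_norm_bound_ennreal[OF int[of x]] C(2)[of x] by (rule order_trans)
    hence "norm (LBINT p. bogovskii_kernel f x p) \<le> C * (exp (2 * norm x) * exp (- V x))"
      using C(1) by (simp add: ennreal_le_iff)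
    thus "norm (bogovskii f x) \<le> C / c * (exp (2 * norm x) * exp (- V x))"
      unfolding bogovskii_def c_def[symmetric] using c0 by (simp add: divide_simps mult_ac)
  qed
qed

section \<open>Densities with exponential moments\<close>

text \<open>Closed under sums and products, and integrable against every confining density: these functions
  free the later arguments from tracking individual moments.\<close>

definition exp_growth :: "('a::euclidean_space \<Rightarrow> real) \<Rightarrow> bool" where
  "exp_growth F \<longleftrightarrow> F \<in> borel_measurable borel \<and> (\<exists>C M. \<forall>x. \<bar>F x\<bar> \<le> C * exp (M * norm x))"

lemma exp_growthE:
  assumes "exp_growth F"
  obtains C M where "C \<ge> 0" "M \<ge> 0" "\<And>x. \<bar>F x\<bar> \<le> C * exp (M * norm x)"
proof -
  obtain C M where CM: "\<And>x. \<bar>F x\<bar> \<le> C * exp (M * norm x)"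
    using assms unfolding exp_growth_def by blast
  show thesis
  proof (rule that[of "\<bar>C\<bar>" "\<bar>M\<bar>"])
    fix x
    have "\<bar>F x\<bar> \<le> C * exp (M * norm x)" by (rule CM)
    also have "\<dots> \<le> \<bar>C\<bar> * exp (\<bar>M\<bar> * norm x)"
      by (intro mult_mono) (auto intro: mult_right_mono)
    finally show "\<bar>F x\<bar> \<le> \<bar>C\<bar> * exp (\<bar>M\<bar> * norm x)" .
  qed simp_all
qed

lemma exp_growth_measurable: "exp_growth F \<Longrightarrow> F \<in> borel_measurable borel"
  by (simp add: exp_growth_def)

lemma exp_growth_bounded:
  assumes "F \<in> borel_measurable borel" "\<And>x. \<bar>F x\<bar> \<le> C"
  shows "exp_growth F"
  unfolding exp_growth_def using assms by (intro conjI exI[of _ C] exI[of _ 0]) auto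

lemma exp_growth_const: "exp_growth (\<lambda>x. c)"
  by (rule exp_growth_bounded[of _ "\<bar>c\<bar>"]) auto

lemma exp_growth_mult:
  assumes "exp_growth F" "exp_growth G"
  shows "exp_growth (\<lambda>x. F x * G x)"
proof -
  obtain C M where F: "C \<ge> 0" "M \<ge> 0" "\<And>x. \<bar>F x\<bar> \<le> C * exp (M * norm x)"
    using exp_growthE[OF assms(1)] by blast
  obtain C' M' where G: "C' \<ge> 0" "M' \<ge> 0" "\<And>x. \<bar>G x\<bar> \<le> C' * exp (M' * norm x)"
    using exp_growthE[OF assms(2)] by blast
  have "\<bar>F x * G x\<bar> \<le> (C * C') * exp ((M + M') * norm x)" for x
  proof -
    have "\<bar>F x\<bar> * \<bar>G x\<bar> \<le> (C * exp (M * norm x)) * (C' * exp (M' * norm x))"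
      using F G by (intro mult_mono) auto
    also have "\<dots> = (C * C') * (exp (M * norm x) * exp (M' * norm x))"
      by (simp only: mult_ac)
    also have "exp (M * norm x) * exp (M' * norm x) = exp ((M + M') * norm x)"
      by (simp only: distrib_right exp_add)
    finally show ?thesis by (simp only: abs_mult)
  qed
  thus ?thesis using assms unfolding exp_growth_def by (intro conjI borel_measurable_times) blast+
qed

lemma exp_growth_add:
  assumes "exp_growth F" "exp_growth G"
  shows "exp_growth (\<lambda>x. F x + G x)"
proof -
  obtain C M where F: "C \<ge> 0" "M \<ge> 0" "\<And>x. \<bar>F x\<bar> \<le> C * exp (M * norm x)"
    using exp_growthE[OF assms(1)] by blast
  obtain C' M' where G: "C' \<ge> 0" "M' \<ge> 0" "\<And>x. \<bar>G x\<bar> \<le> C' * exp (M' * norm x)"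
    using exp_growthE[OF assms(2)] by blast
  have "\<bar>F x + G x\<bar> \<le> (C + C') * exp ((M + M') * norm x)" for x
  proof -
    have "C * exp (M * norm x) \<le> C * exp ((M + M') * norm x)"
      using F G by (intro mult_left_mono) (auto intro: mult_right_mono)
    moreover have "C' * exp (M' * norm x) \<le> C' * exp ((M + M') * norm x)"
      using F G by (intro mult_left_mono) (auto intro: mult_right_mono)
    ultimately show ?thesis using F(3)[of x] G(3)[of x] by (simp add: distrib_right)
  qed
  thus ?thesis using assms unfolding exp_growth_def by (intro conjI borel_measurable_add) auto
qed

lemma exp_growth_diff:
  assumes "exp_growth F" "exp_growth G"
  shows "exp_growth (\<lambda>x. F x - G x)"
  using exp_growth_add[OF assms(1) exp_growth_mult[OF exp_growth_const[of "-1"] assms(2)]] by simp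

lemma exp_growth_power2:
  assumes "exp_growth F"
  shows "exp_growth (\<lambda>x. (F x)\<^sup>2)"
  using exp_growth_mult[OF assms assms] by (simp add: power2_eq_square)

lemma one_plus_square_le_exp: "1 + y\<^sup>2 \<le> 2 * exp y" if "y \<ge> 0" for y :: real
  using exp_lower_Taylor_quadratic[OF that] that by simp

lemma C2_bounded_hessian_exp_bound:
  assumes "C2_bounded_hessian f g H"
  obtains C where "C \<ge> 0" "\<And>x. \<bar>f x\<bar> \<le> C * exp (norm x)"
proof -
  obtain C where C: "C > 0" "\<And>x. \<bar>f x\<bar> \<le> C * (1 + (norm x)\<^sup>2)"
    using C2_bounded_hessian_growth[OF assms] by blast
  show thesis
  proof (rule that[of "2 * C"])
    fix x
    have "\<bar>f x\<bar> \<le> C * (2 * exp (norm x))"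
      using C(1) by (intro order_trans[OF C(2)[of x]] mult_left_mono one_plus_square_le_exp) auto
    thus "\<bar>f x\<bar> \<le> 2 * C * exp (norm x)" by (simp add: mult_ac)
  qed (use C in simp)
qed

lemma C2_bounded_hessian_measurable:
  "C2_bounded_hessian f g H \<Longrightarrow> f \<in> borel_measurable borel"
  using C2_bounded_hessian_continuous(1) borel_measurable_continuous_onI by blast

lemma C2_bounded_hessian_exp_growth:
  assumes "C2_bounded_hessian f g H"
  shows "exp_growth f"
proof -
  obtain C where "\<And>x. \<bar>f x\<bar> \<le> C * exp (norm x)"
    using C2_bounded_hessian_exp_bound[OF assms] by blast
  hence "\<forall>x. \<bar>f x\<bar> \<le> C * exp (1 * norm x)" by simp
  thus ?thesis using C2_bounded_hessian_measurable[OF assms] unfolding exp_growth_def by blast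
qed

lemma exp_growth_norm: "exp_growth (\<lambda>x::'a::euclidean_space. norm x)"
proof -
  have "norm x \<le> 1 * exp (1 * norm x)" for x :: 'a
    using exp_ge_add_one_self[of "norm x"] unfolding mult_1_left by linarith
  thus ?thesis unfolding exp_growth_def by (intro conjI exI[of _ 1]) auto
qed

text \<open>The form in which the assumption on the initial density is used, and checked for tilted densities.\<close>

lemma A1_iff_confining:
  "A1 \<rho> \<longleftrightarrow> \<rho> \<in> prob_densities \<and> (\<exists>V g. \<rho> = (\<lambda>x. exp (- V x)) \<and> confining V g)"
  unfolding A1_def confining_def coercive_field_iff_Liminf by blast

lemma A1_pos: "A1 \<rho> \<Longrightarrow> \<rho> x > 0"
  by (auto simp: A1_iff_confining)

lemma A1_integrable_exp_growth:
  assumes "A1 \<rho>" "exp_growth F"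
  shows "integrable lborel (\<lambda>x. F x * \<rho> x)"
proof -
  obtain V g where V: "\<rho> = (\<lambda>x. exp (- V x))" "confining V g" and p: "\<rho> \<in> prob_densities"
    using assms(1) unfolding A1_iff_confining by blast
  have [measurable]: "\<rho> \<in> borel_measurable borel" and int: "integrable lborel \<rho>"
    using p by (auto simp: prob_densities_def)
  have [measurable]: "F \<in> borel_measurable borel" by (rule exp_growth_measurable[OF assms(2)])
  obtain C M where F: "C \<ge> 0" "M \<ge> 0" "\<And>x. \<bar>F x\<bar> \<le> C * exp (M * norm x)"
    using exp_growthE[OF assms(2)] by blast
  have "integrable lborel (\<lambda>x. C * (exp (M * norm x) * \<rho> x))"
    using exp_moments_of_confining[OF V(2)] int unfolding V(1) by simp
  thus ?thesis
  proof (rule Bochner_Integration.integrable_bound)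
    show "AE x in lborel. norm (F x * \<rho> x) \<le> norm (C * (exp (M * norm x) * \<rho> x))"
    proof (intro AE_I2)
      fix x
      have "\<bar>F x\<bar> * \<rho> x \<le> (C * exp (M * norm x)) * \<rho> x"
        using F A1_pos[OF assms(1), of x] by (intro mult_right_mono) auto
      thus "norm (F x * \<rho> x) \<le> norm (C * (exp (M * norm x) * \<rho> x))"
        using A1_pos[OF assms(1), of x] F by (simp add: abs_mult mult_ac)
    qed
  qed simp
qed

definition transport_field :: "('a::euclidean_space \<Rightarrow> real) \<Rightarrow> ('a \<Rightarrow> real) \<Rightarrow> 'a \<Rightarrow> 'a" where
  "transport_field \<rho> w x = bogovskii (\<lambda>y. \<rho> y * w y) x /\<^sub>R \<rho> x"

text \<open>Dividing the momentum by the density leaves a field of exponential growth, hence a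
  square-integrable one.\<close>

lemma transport_field_solves:
  fixes \<rho> :: "'a::euclidean_space \<Rightarrow> real"
  assumes "A1 \<rho>" and wm [measurable]: "w \<in> borel_measurable borel"
    and w: "\<And>x. \<bar>w x\<bar> \<le> A * exp (norm x)" and zero: "(LBINT x. w x * \<rho> x) = 0"
  shows "has_weighted_div \<rho> (transport_field \<rho> w) w"
    and "transport_field \<rho> w \<in> L2_fields \<rho>"
proof -
  let ?f = "\<lambda>y. \<rho> y * w y" and ?u = "transport_field \<rho> w"
  obtain V g where V: "\<rho> = (\<lambda>x. exp (- V x))" "confining V g" and p: "\<rho> \<in> prob_densities"
    using assms(1) unfolding A1_iff_confining by blast
  have [measurable]: "\<rho> \<in> borel_measurable borel" using p by (auto simp: prob_densities_def)
  have pos: "\<rho> x > 0" for x using A1_pos[OF assms(1)] .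
  have A0: "A \<ge> 0" using w[of 0] by simp
  have wg: "exp_growth w" unfolding exp_growth_def using w by (intro conjI exI[of _ A] exI[of _ 1]) auto
  have fb: "\<bar>?f y\<bar> \<le> A * (exp (norm y) * exp (- V y))" for y
    using mult_left_mono[OF w[of y], of "\<rho> y"] pos[of y] by (simp add: abs_mult V(1) mult_ac)
  have fm: "?f \<in> borel_measurable borel" by measurable
  obtain C where C: "C \<ge> 0" "\<And>x. norm (bogovskii ?f x) \<le> C * (exp (2 * norm x) * exp (- V x))"
    "\<And>x. integrable lborel (bogovskii_kernel ?f x)"
    using bogovskii_bound[OF V(2) fm fb A0] by blast
  have i1: "integrable lborel ?f"
    using A1_integrable_exp_growth[OF assms(1) wg] by (simp add: mult.commute)
  have i2: "integrable lborel (\<lambda>y. norm y * ?f y)"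
    using A1_integrable_exp_growth[OF assms(1) exp_growth_mult[OF exp_growth_norm wg]] by (simp add: mult_ac)
  have z: "(LBINT y. ?f y) = 0" using zero by (simp add: mult.commute)
  have mu: "\<rho> x *\<^sub>R ?u x = bogovskii ?f x" for x
    using pos[of x] by (simp add: transport_field_def)
  show "has_weighted_div \<rho> ?u w"
    unfolding has_weighted_div_def has_weak_divergence_def mu
  proof (intro conjI allI impI wm)
    fix \<phi> \<phi>' assume test: "test_function \<phi> (\<phi>' :: 'a \<Rightarrow> 'a)"
    obtain B where "B \<ge> 0" and B: "\<And>x. \<bar>\<phi> x\<bar> \<le> B" and "\<And>x. norm (\<phi>' x) \<le> B" using test_function_bounded[OF test] by blast
    note bw = bogovskii_weak_divergence[OF i1 i2 z C(3) test]
    show "integrable lborel (\<lambda>x. \<phi>' x \<bullet> bogovskii ?f x)" by (rule bw(1))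
    show "(LBINT x. \<phi>' x \<bullet> bogovskii ?f x) = - (LBINT x. \<phi> x * (\<rho> x * w x))" by (rule bw(2))
    have "exp_growth \<phi>" using test_function_measurable(1)[OF test] B by (rule exp_growth_bounded)
    from A1_integrable_exp_growth[OF assms(1) exp_growth_mult[OF this wg]]
    show "integrable lborel (\<lambda>x. \<phi> x * (\<rho> x * w x))" by (simp add: mult_ac)
  qed
  have "(\<lambda>q. bogovskii (\<lambda>y. ?f y) (snd q)) \<in> borel_measurable (borel :: (real \<times> 'a) measure)"
    by (rule measurable_bogovskii[of "\<lambda>_. ?f"]) measurable
  hence bm [measurable]: "bogovskii ?f \<in> borel_measurable borel"
    using measurable_compose[of "\<lambda>x. (0::real, x)" borel borel "\<lambda>q. bogovskii ?f (snd q)" borel] by simp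
  have um [measurable]: "?u \<in> borel_measurable borel"
    unfolding transport_field_def by measurable
  have ub: "norm (?u x) \<le> C * exp (2 * norm x)" for x
    using C(2)[of x] pos[of x] by (simp add: transport_field_def V(1) exp_minus field_simps)
  have "exp_growth (\<lambda>x. (norm (?u x))\<^sup>2)"
    unfolding exp_growth_def
  proof (intro conjI exI allI)
    fix x
    have "(norm (?u x))\<^sup>2 \<le> (C * exp (2 * norm x))\<^sup>2" using ub[of x] by (intro power_mono) auto
    also have "\<dots> = C\<^sup>2 * exp (4 * norm x)" by (simp add: power2_eq_square mult_exp_exp mult_ac)
    finally show "\<bar>(norm (?u x))\<^sup>2\<bar> \<le> C\<^sup>2 * exp (4 * norm x)" by simp
  qed measurable
  from A1_integrable_exp_growth[OF assms(1) this]
  show "?u \<in> L2_fields \<rho>" unfolding L2_fields_def using um by simp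
qed

section \<open>Exponential tilting solves the continuity equation\<close>

lemma C2_bounded_hessian_affine:
  assumes "C2_bounded_hessian f g H" "C2_bounded_hessian f' g' H'"
  shows "C2_bounded_hessian (\<lambda>x. f x + s * f' x + c) (\<lambda>x. g x + s *\<^sub>R g' x) (\<lambda>x. H x + s *\<^sub>R H' x)"
  unfolding C2_bounded_hessian_def
proof (intro conjI allI)
  fix x
  show "GDERIV (\<lambda>x. f x + s * f' x + c) x :> g x + s *\<^sub>R g' x"
  proof -
    have "(f has_derivative (\<lambda>y. y \<bullet> g x)) (at x)" "(f' has_derivative (\<lambda>y. y \<bullet> g' x)) (at x)"
      using assms by (auto simp: C2_bounded_hessian_def gderiv_def)
    thus ?thesis unfolding gderiv_def inner_add_right inner_scaleR_right
      by (auto intro!: derivative_eq_intros)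
  qed
  have "(g has_derivative blinfun_apply (H x)) (at x)" "(g' has_derivative blinfun_apply (H' x)) (at x)"
    using assms by (auto simp: C2_bounded_hessian_def)
  hence "((\<lambda>x. g x + s *\<^sub>R g' x) has_derivative (\<lambda>y. H x y + s *\<^sub>R H' x y)) (at x)"
    by (auto intro!: derivative_eq_intros)
  thus "((\<lambda>x. g x + s *\<^sub>R g' x) has_derivative blinfun_apply (H x + s *\<^sub>R H' x)) (at x)"
    by (simp add: plus_blinfun.rep_eq scaleR_blinfun.rep_eq)
  show "continuous_on UNIV (\<lambda>x. H x + s *\<^sub>R H' x)"
    using assms by (intro continuous_intros) (auto simp: C2_bounded_hessian_def)
  obtain B B' where B: "\<And>x. norm (H x) \<le> B" "\<And>x. norm (H' x) \<le> B'"
    using assms by (auto simp: C2_bounded_hessian_def bounded_iff)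
  have "norm (H x + s *\<^sub>R H' x) \<le> B + \<bar>s\<bar> * B'" for x
    using norm_triangle_ineq[of "H x" "s *\<^sub>R H' x"] B(1)[of x] mult_left_mono[OF B(2)[of x], of "\<bar>s\<bar>"] by simp
  thus "bounded (range (\<lambda>x. H x + s *\<^sub>R H' x))" unfolding bounded_iff by blast
qed

text \<open>For \<open>r s = tilt \<rho> k s\<close> the derivative of \<open>r\<close> in \<open>s\<close> is \<open>- r s * (k - mean k (r s))\<close>. So \<open>r\<close> solves the
  continuity equation with any velocity whose weighted divergence is the centered function \<open>k - mean k (r s)\<close>.
  With \<open>k = \<beta> * h\<close> this is the optimal flow, and with bounded \<open>k\<close> it provides the variations that
  determine Gateaux derivatives.\<close>

definition tilt :: "('a::euclidean_space \<Rightarrow> real) \<Rightarrow> ('a \<Rightarrow> real) \<Rightarrow> real \<Rightarrow> 'a \<Rightarrow> real" where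
  "tilt \<rho> k s x = exp (- s * k x) * \<rho> x / (LBINT y. exp (- s * k y) * \<rho> y)"

text \<open>Adding a constant to \<open>k\<close> leaves the tilted densities unchanged, so nonnegativity is a normalization; it
  bounds \<open>exp (- s * k x)\<close> by 1 for \<open>s \<ge> 0\<close>.\<close>

definition tilting_potential :: "('a::euclidean_space \<Rightarrow> real) \<Rightarrow> bool" where
  "tilting_potential k \<longleftrightarrow> (\<forall>x. 0 \<le> k x) \<and> (\<exists>g H. C2_bounded_hessian k g H \<and> radially_bounded_below g)"

lemma tilting_potential_exp_growth: "tilting_potential k \<Longrightarrow> exp_growth k"
  using C2_bounded_hessian_exp_growth unfolding tilting_potential_def by blast

lemma tilting_weight_exp_growth:
  assumes "tilting_potential k" "s \<ge> 0"
  shows "exp_growth (\<lambda>x. exp (- s * k x))"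
  using exp_growth_measurable[OF tilting_potential_exp_growth[OF assms(1)]] assms
  by (intro exp_growth_bounded[of _ 1]) (auto simp: tilting_potential_def)

lemma A1_total_mass: "A1 \<rho> \<Longrightarrow> (LBINT x. \<rho> x) = 1"
  by (auto simp: A1_def prob_densities_def)

lemma A1_integral_pos:
  assumes "A1 \<rho>" "integrable lborel (\<lambda>x. F x * \<rho> x)" "\<And>x. F x > 0"
  shows "(LBINT x. F x * \<rho> x) > 0"
proof -
  have pos: "F x * \<rho> x > 0" for x using assms(3) A1_pos[OF assms(1)] by simp
  have "(LBINT x. F x * \<rho> x) \<ge> 0" using pos less_imp_le by (intro Bochner_Integration.integral_nonneg) auto
  moreover have "(LBINT x. F x * \<rho> x) \<noteq> 0"
  proof
    assume "(LBINT x. F x * \<rho> x) = 0"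
    hence "AE x in lborel. F x * \<rho> x = 0"
      using integral_nonneg_eq_0_iff_AE[OF assms(2)] pos less_imp_le by blast
    hence "AE x::'a in lborel. False" by eventually_elim (use pos in \<open>metis less_irrefl\<close>)
    thus False by (simp add: eventually_False ae_filter_eq_bot_iff)
  qed
  ultimately show ?thesis by simp
qed

lemma tilt_normalizer_pos:
  assumes "A1 \<rho>" "tilting_potential k" "s \<ge> 0"
  shows "(LBINT y. exp (- s * k y) * \<rho> y) > 0"
  by (intro A1_integral_pos assms A1_integrable_exp_growth tilting_weight_exp_growth) auto

lemma tilt_0: "A1 \<rho> \<Longrightarrow> tilt \<rho> k 0 = \<rho>"
  by (auto simp: tilt_def A1_total_mass)

text \<open>The tilted density has the potential \<open>V + s * k\<close> up to the logarithm of the normalizing constant, and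
  the drift of this potential is still coercive.\<close>

lemma A1_tilt:
  assumes "A1 \<rho>" "tilting_potential k" "s \<ge> 0"
  shows "A1 (tilt \<rho> k s)"
proof -
  obtain V g where V: "\<rho> = (\<lambda>x. exp (- V x))" "confining V g" and p: "\<rho> \<in> prob_densities"
    using assms(1) unfolding A1_iff_confining by blast
  obtain H where H: "C2_bounded_hessian V g H" "coercive_field g" using V(2) unfolding confining_def by blast
  obtain g' H' where k: "C2_bounded_hessian k g' H'" "radially_bounded_below g'"
    using assms(2) unfolding tilting_potential_def by blast
  let ?Z = "\<integral>y. exp (- s * k y) * \<rho> y \<partial>lborel"
  have Z: "?Z > 0" by (rule tilt_normalizer_pos[OF assms])
  have e: "tilt \<rho> k s = (\<lambda>x. exp (- (V x + s * k x + ln ?Z)))"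
    using Z by (auto simp: tilt_def V(1) exp_diff exp_minus field_simps exp_add)
  have c: "confining (\<lambda>x. V x + s * k x + ln ?Z) (\<lambda>x. g x + s *\<^sub>R g' x)"
    unfolding confining_def
    using C2_bounded_hessian_affine[OF H(1) k(1)] coercive_field_perturb[OF H(2) k(2) assms(3)] by blast
  have int: "integrable lborel (\<lambda>x. F x * tilt \<rho> k s x)" if "exp_growth F" for F
  proof -
    have "integrable lborel (\<lambda>x. (F x * exp (- s * k x)) * \<rho> x)"
      by (intro A1_integrable_exp_growth assms exp_growth_mult that tilting_weight_exp_growth)
    hence "integrable lborel (\<lambda>x. (F x * exp (- s * k x)) * \<rho> x / ?Z)" by simp
    thus ?thesis by (simp add: tilt_def mult_ac)
  qed
  have "tilt \<rho> k s \<in> prob_densities"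
    unfolding prob_densities_def mem_Collect_eq
  proof (intro conjI allI)
    show "tilt \<rho> k s \<in> borel_measurable borel"
      using C2_bounded_hessian_measurable[OF H(1)] C2_bounded_hessian_measurable[OF k(1)] unfolding e by measurable
    show "0 \<le> tilt \<rho> k s x" for x unfolding e by simp
    show "integrable lborel (tilt \<rho> k s)" using int[OF exp_growth_const[of 1]] by simp
    show "(LBINT x. tilt \<rho> k s x) = 1" unfolding tilt_def using Z by simp
    show "integrable lborel (\<lambda>x. (norm x)\<^sup>2 * tilt \<rho> k s x)"
      by (intro int exp_growth_power2 exp_growth_norm)
  qed
  thus ?thesis unfolding A1_iff_confining
    by (intro conjI exI[of _ "\<lambda>x. V x + s * k x + ln ?Z"] exI[of _ "\<lambda>x. g x + s *\<^sub>R g' x"] e c)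
qed

lemma exp_minus_diff_bound:
  fixes a b :: real
  assumes "a \<ge> 0" "b \<ge> 0"
  shows "\<bar>exp (- a) - exp (- b)\<bar> \<le> \<bar>a - b\<bar>"
proof -
  have *: "exp (- x) - exp (- y) \<le> y - x" if "0 \<le> x" "x \<le> y" for x y :: real
  proof -
    have "exp (- x) - exp (- y) = exp (- x) * (1 - exp (- (y - x)))"
      by (simp add: right_diff_distrib exp_add[symmetric])
    also have "\<dots> \<le> 1 * (1 - exp (- (y - x)))" using that by (intro mult_right_mono) auto
    also have "\<dots> \<le> y - x" using exp_ge_add_one_self[of "- (y - x)"] unfolding mult_1_left by linarith
    finally show ?thesis .
  qed
  show ?thesis
  proof (cases "a \<le> b")
    case True thus ?thesis using *[of a b] assms by simp
  next
    case False thus ?thesis using *[of b a] assms by simp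
  qed
qed

text \<open>For \<open>s \<ge> 0\<close> the difference quotients of \<open>exp (- s * k x)\<close> are bounded by \<open>k x\<close>, so that
  differentiation and integration may be exchanged. At \<open>s = 0\<close> the derivative is one-sided, since \<open>k\<close> is
  bounded only from below.\<close>

lemma tilted_integral_derivative:
  assumes "A1 \<rho>" "tilting_potential k" "exp_growth F" "s \<ge> 0"
  shows "((\<lambda>s. LBINT x. F x * exp (- s * k x) * \<rho> x) has_real_derivative
     - (LBINT x. F x * k x * exp (- s * k x) * \<rho> x)) (at s within {0..})"
  unfolding has_field_derivative_iff tendsto_at_iff_sequentially
proof (intro allI impI)
  fix X assume X: "\<forall>i. X i \<in> {0..} - {s}" and lim: "X \<longlonglongrightarrow> s"
  note [measurable] = exp_growth_measurable[OF assms(3)] exp_growth_measurable[OF tilting_potential_exp_growth[OF assms(2)]]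
  have [measurable]: "\<rho> \<in> borel_measurable borel" using assms(1) by (auto simp: A1_def prob_densities_def)
  have k0: "k x \<ge> 0" for x using assms(2) by (simp add: tilting_potential_def)
  have int: "integrable lborel (\<lambda>x. F x * exp (- s * k x) * \<rho> x)" if "s \<ge> 0" for s
    by (intro A1_integrable_exp_growth exp_growth_mult tilting_weight_exp_growth assms that)
  let ?q = "\<lambda>i x. F x * ((exp (- X i * k x) - exp (- s * k x)) / (X i - s)) * \<rho> x"
  have eq: "((LBINT x. F x * exp (- X i * k x) * \<rho> x) - (LBINT x. F x * exp (- s * k x) * \<rho> x)) / (X i - s)
      = (LBINT x. ?q i x)" for i
  proof -
    have "(LBINT x. ?q i x) = (LBINT x. (F x * exp (- X i * k x) * \<rho> x - F x * exp (- s * k x) * \<rho> x) / (X i - s))"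
      by (intro Bochner_Integration.integral_cong refl) (simp add: algebra_simps diff_divide_distrib)
    also have "\<dots> = ((LBINT x. F x * exp (- X i * k x) * \<rho> x) - (LBINT x. F x * exp (- s * k x) * \<rho> x)) / (X i - s)"
      using int[of "X i"] int[OF assms(4)] X by simp
    finally show ?thesis by (rule sym)
  qed
  have "(\<lambda>i. LBINT x. ?q i x) \<longlonglongrightarrow> (LBINT x. F x * (- k x * exp (- s * k x)) * \<rho> x)"
  proof (rule integral_dominated_convergence[where w = "\<lambda>x. \<bar>F x * k x * \<rho> x\<bar>"])
    show "integrable lborel (\<lambda>x. \<bar>F x * k x * \<rho> x\<bar>)"
      by (intro integrable_abs A1_integrable_exp_growth exp_growth_mult tilting_potential_exp_growth assms)
    show "AE x in lborel. (\<lambda>i. ?q i x) \<longlonglongrightarrow> F x * (- k x * exp (- s * k x)) * \<rho> x"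
    proof (intro AE_I2 tendsto_intros)
      fix x
      have "((\<lambda>s. exp (- s * k x)) has_real_derivative (- k x * exp (- s * k x))) (at s within {0..})"
        by (auto intro!: derivative_eq_intros)
      thus "(\<lambda>i. (exp (- X i * k x) - exp (- s * k x)) / (X i - s)) \<longlonglongrightarrow> - k x * exp (- s * k x)"
        unfolding has_field_derivative_iff tendsto_at_iff_sequentially using X lim by (auto simp: o_def)
    qed
    show "AE x in lborel. norm (?q i x) \<le> \<bar>F x * k x * \<rho> x\<bar>" for i
    proof (intro AE_I2)
      fix x
      have Xi: "X i \<ge> 0" "X i \<noteq> s" using X by auto
      have "\<bar>exp (- X i * k x) - exp (- s * k x)\<bar> \<le> \<bar>X i * k x - s * k x\<bar>"
        using exp_minus_diff_bound[of "X i * k x" "s * k x"] k0[of x] Xi assms(4) by simp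
      also have "\<dots> = \<bar>X i - s\<bar> * k x" using k0[of x] by (simp add: abs_mult left_diff_distrib[symmetric])
      finally have "\<bar>(exp (- X i * k x) - exp (- s * k x)) / (X i - s)\<bar> \<le> k x"
        using Xi by (simp add: abs_divide divide_le_eq mult.commute)
      hence "\<bar>F x\<bar> * \<bar>(exp (- X i * k x) - exp (- s * k x)) / (X i - s)\<bar> * \<bar>\<rho> x\<bar> \<le> \<bar>F x\<bar> * k x * \<bar>\<rho> x\<bar>"
        by (intro mult_right_mono mult_left_mono) auto
      thus "norm (?q i x) \<le> \<bar>F x * k x * \<rho> x\<bar>" using k0[of x] by (simp add: abs_mult)
    qed
  qed measurable
  moreover have "(LBINT x. F x * (- k x * exp (- s * k x)) * \<rho> x) = - (LBINT x. F x * k x * exp (- s * k x) * \<rho> x)"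
    by (simp add: mult_ac)
  ultimately show "((\<lambda>y. ((LBINT x. F x * exp (- y * k x) * \<rho> x) - (LBINT x. F x * exp (- s * k x) * \<rho> x)) / (y - s)) \<circ> X)
      \<longlonglongrightarrow> - (LBINT x. F x * k x * exp (- s * k x) * \<rho> x)"
    by (simp only: o_def eq)
qed

lemma integral_tilt:
  "(LBINT x. F x * tilt \<rho> k s x) = (LBINT x. F x * exp (- s * k x) * \<rho> x) / (LBINT y. 1 * exp (- s * k y) * \<rho> y)"
  by (simp add: tilt_def mult_ac)

lemma tilted_covariance:
  assumes "A1 \<rho>" "tilting_potential k" "exp_growth F" "s \<ge> 0"
  shows "(LBINT x. F x * (tilt \<rho> k s x * (k x - mean k (tilt \<rho> k s))))
    = (LBINT x. (F x * k x) * tilt \<rho> k s x) - mean k (tilt \<rho> k s) * (LBINT x. F x * tilt \<rho> k s x)"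
proof -
  have A: "A1 (tilt \<rho> k s)" by (rule A1_tilt[OF assms(1,2,4)])
  have "(LBINT x. F x * (tilt \<rho> k s x * (k x - mean k (tilt \<rho> k s))))
     = (LBINT x. (F x * k x) * tilt \<rho> k s x - mean k (tilt \<rho> k s) * (F x * tilt \<rho> k s x))"
    by (intro Bochner_Integration.integral_cong refl) (simp add: algebra_simps)
  thus ?thesis
    using A1_integrable_exp_growth[OF A exp_growth_mult[OF assms(3) tilting_potential_exp_growth[OF assms(2)]]]
      A1_integrable_exp_growth[OF A assms(3)] by simp
qed

text \<open>By the quotient rule the derivative of a tilted mean is minus the covariance with \<open>k\<close>.\<close>

lemma tilted_mean_derivative:
  assumes "A1 \<rho>" "tilting_potential k" "exp_growth F" "s \<ge> 0"
  shows "((\<lambda>s. LBINT x. F x * tilt \<rho> k s x) has_real_derivative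
     - (LBINT x. F x * (tilt \<rho> k s x * (k x - mean k (tilt \<rho> k s))))) (at s within {0..})"
proof -
  let ?N = "\<lambda>F s. \<integral>x. F x * exp (- s * k x) * \<rho> x \<partial>lborel"
  let ?Z = "?N (\<lambda>_. 1)"
  have Z: "?Z s > 0" using tilt_normalizer_pos[OF assms(1,2,4)] by simp
  have kg: "exp_growth k" by (rule tilting_potential_exp_growth[OF assms(2)])
  have dF: "(?N F has_real_derivative - ?N (\<lambda>x. F x * k x) s) (at s within {0..})"
    by (rule tilted_integral_derivative[OF assms])
  have dZ: "(?Z has_real_derivative - ?N k s) (at s within {0..})"
    using tilted_integral_derivative[OF assms(1,2) exp_growth_const[of 1] assms(4)] by simp
  have "((\<lambda>s. ?N F s / ?Z s) has_real_derivative
      (- ?N (\<lambda>x. F x * k x) s * ?Z s - ?N F s * (- ?N k s)) / (?Z s * ?Z s)) (at s within {0..})"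
    using dF dZ by (rule DERIV_divide) (use Z in simp)
  moreover have "(- ?N (\<lambda>x. F x * k x) s * ?Z s - ?N F s * (- ?N k s)) / (?Z s * ?Z s)
     = - (LBINT x. F x * (tilt \<rho> k s x * (k x - mean k (tilt \<rho> k s))))"
  proof -
    note tilted_covariance[OF assms]
    also have "(LBINT x. (F x * k x) * tilt \<rho> k s x) - mean k (tilt \<rho> k s) * (LBINT x. F x * tilt \<rho> k s x)
      = ?N (\<lambda>x. F x * k x) s / ?Z s - ?N k s / ?Z s * (?N F s / ?Z s)"
      unfolding mean_def integral_tilt ..
    finally have eq: "(LBINT x. F x * (tilt \<rho> k s x * (k x - mean k (tilt \<rho> k s))))
       = ?N (\<lambda>x. F x * k x) s / ?Z s - ?N k s / ?Z s * (?N F s / ?Z s)" .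
    have "(- a * z - f * (- b)) / (z * z) = - (a / z - b / z * (f / z))" if "z > 0" for a b f z :: real
      using that by (simp add: field_simps)
    from this[OF Z] show ?thesis unfolding eq .
  qed
  ultimately show ?thesis unfolding integral_tilt by simp
qed

lemma tilted_covariance_continuous:
  assumes "A1 \<rho>" "tilting_potential k" "exp_growth F"
  shows "continuous_on {0..} (\<lambda>s. LBINT x. F x * (tilt \<rho> k s x * (k x - mean k (tilt \<rho> k s))))"
proof -
  have kg: "exp_growth k" by (rule tilting_potential_exp_growth[OF assms(2)])
  have c: "continuous_on {0..} (\<lambda>s. LBINT x. G x * tilt \<rho> k s x)" if "exp_growth G" for G
    unfolding continuous_on_eq_continuous_within
    using tilted_mean_derivative[OF assms(1,2) that] by (meson DERIV_continuous atLeast_iff)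
  have "continuous_on {0..} (\<lambda>s. (LBINT x. (F x * k x) * tilt \<rho> k s x) - mean k (tilt \<rho> k s) * (LBINT x. F x * tilt \<rho> k s x))"
    unfolding mean_def by (intro continuous_intros c exp_growth_mult assms kg)
  moreover have "(LBINT x. F x * (tilt \<rho> k s x * (k x - mean k (tilt \<rho> k s))))
      = (LBINT x. (F x * k x) * tilt \<rho> k s x) - mean k (tilt \<rho> k s) * (LBINT x. F x * tilt \<rho> k s x)"
    if "s \<in> {0..}" for s
    using tilted_covariance[OF assms] that by simp
  ultimately show ?thesis using continuous_on_cong[of "{0..}" "{0..}"] by (metis (no_types, lifting))
qed

definition tilt_field :: "('a::euclidean_space \<Rightarrow> real) \<Rightarrow> ('a \<Rightarrow> real) \<Rightarrow> real \<Rightarrow> 'a \<Rightarrow> 'a" where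
  "tilt_field \<rho> k s = transport_field (tilt \<rho> k s) (\<lambda>x. k x - mean k (tilt \<rho> k s))"

lemma tilt_field_solves:
  assumes "A1 \<rho>" "tilting_potential k" "s \<ge> 0"
  shows "has_weighted_div (tilt \<rho> k s) (tilt_field \<rho> k s) (\<lambda>x. k x - mean k (tilt \<rho> k s))"
    and "tilt_field \<rho> k s \<in> L2_fields (tilt \<rho> k s)"
proof -
  let ?r = "tilt \<rho> k s"
  have A: "A1 ?r" by (rule A1_tilt[OF assms])
  obtain g H where k: "C2_bounded_hessian k g H" using assms(2) unfolding tilting_potential_def by blast
  obtain C where C: "C \<ge> 0" "\<And>x. \<bar>k x\<bar> \<le> C * exp (norm x)"
    using C2_bounded_hessian_exp_bound[OF k] by blast
  have [measurable]: "k \<in> borel_measurable borel" by (rule C2_bounded_hessian_measurable[OF k])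
  have m: "(\<lambda>x. k x - mean k ?r) \<in> borel_measurable borel" by measurable
  have b: "\<bar>k x - mean k ?r\<bar> \<le> (C + \<bar>mean k ?r\<bar>) * exp (norm x)" for x
  proof -
    have "\<bar>mean k ?r\<bar> * 1 \<le> \<bar>mean k ?r\<bar> * exp (norm x)" by (intro mult_left_mono) auto
    thus ?thesis using C(2)[of x] by (simp add: distrib_right)
  qed
  have "(LBINT x. (k x - mean k ?r) * ?r x) = (LBINT x. k x * ?r x) - mean k ?r * (LBINT x. ?r x)"
    using A1_integrable_exp_growth[OF A C2_bounded_hessian_exp_growth[OF k]]
      A1_integrable_exp_growth[OF A exp_growth_const[of 1]] by (simp add: left_diff_distrib)
  hence z: "(LBINT x. (k x - mean k ?r) * ?r x) = 0"
    by (simp add: A1_total_mass[OF A] mean_def)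
  show "has_weighted_div ?r (tilt_field \<rho> k s) (\<lambda>x. k x - mean k ?r)" "tilt_field \<rho> k s \<in> L2_fields ?r"
    unfolding tilt_field_def by (rule transport_field_solves[OF A m b z])+
qed

lemma measurable_tilt:
  assumes [measurable]: "k \<in> borel_measurable borel" "\<rho> \<in> borel_measurable borel" "a \<in> borel_measurable M" "b \<in> borel_measurable M"
  shows "(\<lambda>q. tilt \<rho> k (a q) (b q)) \<in> borel_measurable M"
  unfolding tilt_def by measurable

lemma measurable_tilt_field:
  fixes k \<rho> :: "'a::euclidean_space \<Rightarrow> real"
  assumes [measurable]: "k \<in> borel_measurable borel" "\<rho> \<in> borel_measurable borel"
  shows "(\<lambda>q. tilt_field \<rho> k (fst q) (snd q)) \<in> borel_measurable (borel :: (real \<times> 'a) measure)"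
proof -
  note [measurable] = measurable_tilt
  have [measurable]: "(\<lambda>q. mean k (tilt \<rho> k (fst q))) \<in> borel_measurable (borel :: (real \<times> 'a) measure)"
    unfolding mean_def by measurable
  have m: "(\<lambda>q. tilt \<rho> k (fst q) (snd q) * (k (snd q) - mean k (tilt \<rho> k (fst q)))) \<in> borel_measurable (borel :: (real \<times> 'a) measure)"
    by measurable
  have [measurable]: "(\<lambda>q. bogovskii (\<lambda>y. tilt \<rho> k (fst q) y * (k y - mean k (tilt \<rho> k (fst q)))) (snd q)) \<in> borel_measurable (borel :: (real \<times> 'a) measure)"
    using measurable_bogovskii[of "\<lambda>s y. tilt \<rho> k s y * (k y - mean k (tilt \<rho> k s))", OF m] .
  show ?thesis unfolding tilt_field_def transport_field_def by measurable
qed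

text \<open>For a test function \<open>\<phi>\<close> the pairing of its gradient with the momentum is minus the covariance of \<open>\<phi>\<close>
  and \<open>k\<close>, because the field solves its divergence equation. This is also the derivative of the tilted mean of
  \<open>\<phi>\<close> and it is continuous in time, so the weak equation follows from the fundamental theorem of calculus.\<close>

lemma tilt_continuity_path:
  fixes \<rho> :: "'a::euclidean_space \<Rightarrow> real"
  assumes "A1 \<rho>" "tilting_potential k"
  shows "continuity_path t0 t1 (\<lambda>s. tilt \<rho> k (s - t0)) (\<lambda>s. tilt_field \<rho> k (s - t0))"
  unfolding continuity_path_def
proof (intro conjI ballI allI impI)
  have km [measurable]: "k \<in> borel_measurable borel" by (rule exp_growth_measurable[OF tilting_potential_exp_growth[OF assms(2)]])
  have rm [measurable]: "\<rho> \<in> borel_measurable borel" using assms(1) by (auto simp: A1_def prob_densities_def)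
  have S: "({t0..t1} \<times> (UNIV :: 'a set)) \<in> sets borel" by (simp add: borel_prod[symmetric])
  have m1: "(\<lambda>q. tilt \<rho> k (fst q - t0) (snd q)) \<in> borel_measurable (borel :: (real \<times> 'a) measure)"
    by (rule measurable_tilt) measurable
  have "(\<lambda>q::real \<times> 'a. (fst q - t0, snd q)) \<in> borel_measurable borel" by measurable
  from measurable_compose[OF this measurable_tilt_field[OF km rm]]
  have m2: "(\<lambda>q. tilt_field \<rho> k (fst q - t0) (snd q)) \<in> borel_measurable (borel :: (real \<times> 'a) measure)" by simp
  show "set_borel_measurable borel ({t0..t1} \<times> UNIV) (\<lambda>(s, x). tilt \<rho> k (s - t0) x)"
    unfolding set_borel_measurable_def split_beta
    by (intro borel_measurable_scaleR borel_measurable_indicator S m1)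
  show "set_borel_measurable borel ({t0..t1} \<times> UNIV) (\<lambda>(s, x). tilt_field \<rho> k (s - t0) x)"
    unfolding set_borel_measurable_def split_beta
    by (intro borel_measurable_scaleR borel_measurable_indicator S m2)
  show "tilt \<rho> k (s - t0) \<in> prob_densities" if "s \<in> {t0..t1}" for s
    using A1_tilt[OF assms, of "s - t0"] that by (simp add: A1_def)
  show "tilt_field \<rho> k (s - t0) \<in> L2_fields (tilt \<rho> k (s - t0))" if "s \<in> {t0..t1}" for s
    using tilt_field_solves(2)[OF assms, of "s - t0"] that by simp
  fix \<phi> and \<phi>' :: "'a \<Rightarrow> 'a" assume test: "test_function \<phi> \<phi>'"
  obtain B where "B \<ge> 0" and B: "\<And>x. \<bar>\<phi> x\<bar> \<le> B" and "\<And>x. norm (\<phi>' x) \<le> B" using test_function_bounded[OF test] by blast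
  have phi: "exp_growth \<phi>" using test_function_measurable(1)[OF test] B by (rule exp_growth_bounded)
  let ?D = "\<lambda>s. - (LBINT x. \<phi> x * (tilt \<rho> k (s - t0) x * (k x - mean k (tilt \<rho> k (s - t0)))))"
  have eq: "(LBINT x. \<phi>' x \<bullet> (tilt \<rho> k (s - t0) x *\<^sub>R tilt_field \<rho> k (s - t0) x)) = ?D s" if "s \<ge> t0" for s
    using tilt_field_solves(1)[OF assms, of "s - t0"] that test
    unfolding has_weighted_div_def has_weak_divergence_def by auto
  have cont: "continuous_on {t0..b} ?D" for b
    by (intro continuous_on_minus continuous_on_compose2[OF tilted_covariance_continuous[OF assms phi]] continuous_intros) auto
  have bi: "has_bochner_integral lborel (\<lambda>s. indicator {t0..b} s *\<^sub>R ?D s)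
       ((LBINT x. \<phi> x * tilt \<rho> k (b - t0) x) - (LBINT x. \<phi> x * tilt \<rho> k (t0 - t0) x))" if "t0 \<le> b" for b
  proof (rule has_bochner_integral_FTC_Icc[OF that _ cont])
    fix s assume s: "t0 \<le> s" "s \<le> b"
    have "((\<lambda>s. LBINT x. \<phi> x * tilt \<rho> k s x) has_real_derivative ?D s) (at (s - t0) within {0..})"
      using tilted_mean_derivative[OF assms phi, of "s - t0"] s by simp
    hence "((\<lambda>s. LBINT x. \<phi> x * tilt \<rho> k s x) has_real_derivative ?D s) (at (s - t0) within (\<lambda>s. s - t0) ` {t0..b})"
      by (rule DERIV_subset) auto
    moreover have "((\<lambda>s. s - t0) has_real_derivative 1) (at s within {t0..b})"
      by (auto intro!: derivative_eq_intros)
    ultimately have "(((\<lambda>s. LBINT x. \<phi> x * tilt \<rho> k s x) \<circ> (\<lambda>s. s - t0)) has_real_derivative ?D s * 1) (at s within {t0..b})"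
      by (rule DERIV_image_chain[where g = "\<lambda>s. s - t0"])
    hence "((\<lambda>s. LBINT x. \<phi> x * tilt \<rho> k (s - t0) x) has_real_derivative ?D s) (at s within {t0..b})"
      by (simp add: o_def)
    thus "((\<lambda>s. LBINT x. \<phi> x * tilt \<rho> k (s - t0) x) has_vector_derivative ?D s) (at s within {t0..b})"
      by (simp add: has_real_derivative_iff_has_vector_derivative)
  qed
  let ?I = "\<lambda>s. \<integral>x. \<phi>' x \<bullet> (tilt \<rho> k (s - t0) x *\<^sub>R tilt_field \<rho> k (s - t0) x) \<partial>lborel"
  have ind: "(\<lambda>s. indicator {t0..b} s *\<^sub>R ?I s) = (\<lambda>s. indicator {t0..b} s *\<^sub>R ?D s)" for b
    using eq by (auto simp: indicator_def fun_eq_iff)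
  show "set_integrable lborel {t0..t1} ?I"
  proof (cases "t0 \<le> t1")
    case True
    show ?thesis unfolding set_integrable_def ind using bi[OF True] by (simp add: has_bochner_integral_iff)
  qed (simp add: set_integrable_def)
  show "(LBINT x. \<phi> x * tilt \<rho> k (s - t0) x) - (LBINT x. \<phi> x * tilt \<rho> k (t0 - t0) x)
      = (LINT \<tau>:{t0..s}|lborel. ?I \<tau>)" if "s \<in> {t0..t1}" for s
    unfolding set_lebesgue_integral_def ind using bi[of s] that by (simp add: has_bochner_integral_iff)
qed

section \<open>Bounded C2 functions separate integrable functions\<close>

definition outer_product :: "'a::euclidean_space \<Rightarrow> 'a \<Rightarrow> 'a \<Rightarrow>\<^sub>L 'a" where
  "outer_product a b = blinfun_scaleR_left b o\<^sub>L blinfun_inner_left a"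

lemma outer_product_apply [simp]: "blinfun_apply (outer_product a b) y = (y \<bullet> a) *\<^sub>R b"
  by (simp add: outer_product_def)

lemma norm_outer_product_le: "norm (outer_product a b) \<le> norm a * norm b"
proof (rule norm_blinfun_bound)
  fix y show "norm (blinfun_apply (outer_product a b) y) \<le> norm a * norm b * norm y"
    using mult_right_mono[OF Cauchy_Schwarz_ineq2[of y a], of "norm b"] by (simp add: mult_ac)
qed simp

lemma continuous_on_outer_product:
  assumes "continuous_on S f" "continuous_on S g"
  shows "continuous_on S (\<lambda>x. outer_product (f x) (g x))"
  unfolding outer_product_def
  by (intro bounded_bilinear.continuous_on[OF bounded_bilinear_blinfun_compose]
      bounded_linear.continuous_on[OF bounded_linear_blinfun_scaleR_left]
      bounded_linear.continuous_on[OF bounded_linear_blinfun_inner_left] assms)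

text \<open>Potentials of admissible variations: tilting by such a function changes the density at most by a
  constant factor and its drift at most by a constant.\<close>

definition C2_bounded :: "('a::euclidean_space \<Rightarrow> real) \<Rightarrow> bool" where
  "C2_bounded k \<longleftrightarrow> (\<exists>g H. C2_bounded_hessian k g H \<and> bounded (range k) \<and> bounded (range g))"

lemma C2_bounded_const: "C2_bounded (\<lambda>x::'a::euclidean_space. c)"
  unfolding C2_bounded_def C2_bounded_hessian_def
  by (rule exI[of _ "\<lambda>_. 0"], rule exI[of _ "\<lambda>_. 0"]) (auto simp: gderiv_def zero_blinfun.rep_eq)

text \<open>Functions of one linear coordinate. Their products approximate indicators of boxes.\<close>

lemma C2_bounded_ridge:
  fixes a :: "'a::euclidean_space" and \<theta> \<theta>' \<theta>'' :: "real \<Rightarrow> real"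
  assumes d: "\<And>t. (\<theta> has_real_derivative \<theta>' t) (at t)" "\<And>t. (\<theta>' has_real_derivative \<theta>'' t) (at t)"
    and c: "continuous_on UNIV \<theta>''"
    and b: "bounded (range \<theta>)" "bounded (range \<theta>')" "bounded (range \<theta>'')"
  shows "C2_bounded (\<lambda>x. \<theta> (x \<bullet> a + e))"
proof -
  obtain B0 B1 B2 where B: "\<And>t. \<bar>\<theta> t\<bar> \<le> B0" "\<And>t. \<bar>\<theta>' t\<bar> \<le> B1" "\<And>t. \<bar>\<theta>'' t\<bar> \<le> B2"
    using b unfolding bounded_iff by (metis rangeI real_norm_def)
  have "C2_bounded_hessian (\<lambda>x. \<theta> (x \<bullet> a + e)) (\<lambda>x. \<theta>' (x \<bullet> a + e) *\<^sub>R a) (\<lambda>x. \<theta>'' (x \<bullet> a + e) *\<^sub>R outer_product a a)"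
    unfolding C2_bounded_hessian_def
  proof (intro conjI allI)
    fix x
    have i: "((\<lambda>x. x \<bullet> a + e) has_derivative (\<lambda>y. y \<bullet> a)) (at x)"
      by (auto intro!: derivative_eq_intros)
    have "(\<theta> has_derivative (\<lambda>s. \<theta>' (x \<bullet> a + e) * s)) (at (x \<bullet> a + e))"
      using d(1) by (simp add: has_field_derivative_def)
    from has_derivative_compose[OF i this]
    show "GDERIV (\<lambda>x. \<theta> (x \<bullet> a + e)) x :> \<theta>' (x \<bullet> a + e) *\<^sub>R a"
      by (simp add: gderiv_def mult_ac)
    have "(\<theta>' has_derivative (\<lambda>s. \<theta>'' (x \<bullet> a + e) * s)) (at (x \<bullet> a + e))"
      using d(2) by (simp add: has_field_derivative_def)
    from has_derivative_scaleR_left[OF has_derivative_compose[OF i this], of a]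
    show "((\<lambda>x. \<theta>' (x \<bullet> a + e) *\<^sub>R a) has_derivative blinfun_apply (\<theta>'' (x \<bullet> a + e) *\<^sub>R outer_product a a)) (at x)"
      by (simp add: scaleR_blinfun.rep_eq)
  next
    show "continuous_on UNIV (\<lambda>x. \<theta>'' (x \<bullet> a + e) *\<^sub>R outer_product a a)"
      by (intro continuous_intros continuous_on_compose2[OF c]) auto
    have "norm (\<theta>'' (x \<bullet> a + e) *\<^sub>R outer_product a a) \<le> B2 * norm (outer_product a a)" for x
      using B(3)[of "x \<bullet> a + e"] by (simp add: mult_right_mono)
    thus "bounded (range (\<lambda>x. \<theta>'' (x \<bullet> a + e) *\<^sub>R outer_product a a))" unfolding bounded_iff by blast
  qed
  moreover have "bounded (range (\<lambda>x. \<theta> (x \<bullet> a + e)))" using B(1) unfolding bounded_iff by auto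
  moreover have "norm (\<theta>' (x \<bullet> a + e) *\<^sub>R a) \<le> B1 * norm a" for x
    using B(2)[of "x \<bullet> a + e"] by (simp add: mult_right_mono)
  hence "bounded (range (\<lambda>x. \<theta>' (x \<bullet> a + e) *\<^sub>R a))" unfolding bounded_iff by blast
  ultimately show ?thesis unfolding C2_bounded_def by blast
qed

lemma C2_bounded_mult:
  fixes k l :: "'a::euclidean_space \<Rightarrow> real"
  assumes "C2_bounded k" "C2_bounded l"
  shows "C2_bounded (\<lambda>x. k x * l x)"
proof -
  obtain g H where k: "C2_bounded_hessian k g H" "bounded (range k)" "bounded (range g)"
    using assms(1) unfolding C2_bounded_def by blast
  obtain g' H' where l: "C2_bounded_hessian l g' H'" "bounded (range l)" "bounded (range g')"
    using assms(2) unfolding C2_bounded_def by blast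
  obtain A B C where K: "\<And>x. \<bar>k x\<bar> \<le> A" "\<And>x. norm (g x) \<le> B" "\<And>x. norm (H x) \<le> C"
    using k unfolding C2_bounded_hessian_def bounded_iff by (metis rangeI real_norm_def)
  obtain A' B' C' where L: "\<And>x. \<bar>l x\<bar> \<le> A'" "\<And>x. norm (g' x) \<le> B'" "\<And>x. norm (H' x) \<le> C'"
    using l unfolding C2_bounded_hessian_def bounded_iff by (metis rangeI real_norm_def)
  have nn: "A \<ge> 0" "B \<ge> 0" "C \<ge> 0" "A' \<ge> 0" "B' \<ge> 0" "C' \<ge> 0"
    using K[of 0] L[of 0] norm_ge_zero abs_ge_zero order_trans by blast+
  let ?G = "\<lambda>x. k x *\<^sub>R g' x + l x *\<^sub>R g x"
  let ?H = "\<lambda>x. k x *\<^sub>R H' x + outer_product (g x) (g' x) + l x *\<^sub>R H x + outer_product (g' x) (g x)"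
  have "C2_bounded_hessian (\<lambda>x. k x * l x) ?G ?H"
    unfolding C2_bounded_hessian_def
  proof (intro conjI allI)
    fix x
    have dk: "(k has_derivative (\<lambda>y. y \<bullet> g x)) (at x)" and dl: "(l has_derivative (\<lambda>y. y \<bullet> g' x)) (at x)"
      and dg: "(g has_derivative blinfun_apply (H x)) (at x)" "(g' has_derivative blinfun_apply (H' x)) (at x)"
      using k(1) l(1) by (auto simp: C2_bounded_hessian_def gderiv_def)
    show "GDERIV (\<lambda>x. k x * l x) x :> ?G x"
      using k(1) l(1) by (intro GDERIV_mult) (auto simp: C2_bounded_hessian_def)
    have "(?G has_derivative (\<lambda>y. (k x *\<^sub>R H' x y + (y \<bullet> g x) *\<^sub>R g' x) + (l x *\<^sub>R H x y + (y \<bullet> g' x) *\<^sub>R g x))) (at x)"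
      by (intro has_derivative_add has_derivative_scaleR dk dl dg)
    thus "(?G has_derivative blinfun_apply (?H x)) (at x)"
      by (simp add: plus_blinfun.rep_eq scaleR_blinfun.rep_eq add_ac)
  next
    show "continuous_on UNIV ?H"
      using C2_bounded_hessian_continuous[OF k(1)] C2_bounded_hessian_continuous[OF l(1)] k(1) l(1)
      by (intro continuous_intros continuous_on_outer_product) (auto simp: C2_bounded_hessian_def)
    have "norm (?H x) \<le> A * C' + B * B' + A' * C + B' * B" for x
    proof -
      have "norm (?H x) \<le> norm (k x *\<^sub>R H' x) + norm (outer_product (g x) (g' x)) + norm (l x *\<^sub>R H x) + norm (outer_product (g' x) (g x))"
        by (intro order_trans[OF norm_triangle_ineq] add_mono order_refl)
      also have "\<dots> \<le> A * C' + B * B' + A' * C + B' * B"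
        using K[of x] L[of x] nn
        by (intro add_mono order_trans[OF norm_outer_product_le]) (auto intro!: mult_mono)
      finally show ?thesis .
    qed
    thus "bounded (range ?H)" unfolding bounded_iff by blast
  qed
  moreover have "\<bar>k x * l x\<bar> \<le> A * A'" for x
    using K(1)[of x] L(1)[of x] nn by (auto simp: abs_mult intro!: mult_mono)
  hence "bounded (range (\<lambda>x. k x * l x))" unfolding bounded_iff by auto
  moreover have "norm (?G x) \<le> A * B' + A' * B" for x
    using K[of x] L[of x] nn by (intro order_trans[OF norm_triangle_ineq] add_mono) (auto intro!: mult_mono)
  hence "bounded (range ?G)" unfolding bounded_iff by blast
  ultimately show ?thesis unfolding C2_bounded_def by blast
qed

lemma C2_bounded_prod:
  assumes "finite I" "\<And>i. i \<in> I \<Longrightarrow> C2_bounded (k i)"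
  shows "C2_bounded (\<lambda>x. \<Prod>i\<in>I. k i x)"
  using assms by (induction I rule: finite_induct) (auto simp: C2_bounded_const intro!: C2_bounded_mult)

definition smooth_step :: "real \<Rightarrow> real" where
  "smooth_step t = 1 / 2 + arctan t / pi"

lemma smooth_step_bounds: "0 \<le> smooth_step t" "smooth_step t \<le> 1"
  using arctan_lbound[of t] arctan_ubound[of t] pi_gt_zero by (auto simp: smooth_step_def field_simps)

lemma smooth_step_at_top: "(smooth_step \<longlongrightarrow> 1) at_top"
proof -
  have "(smooth_step \<longlongrightarrow> 1 / 2 + (pi / 2) / pi) at_top"
    unfolding smooth_step_def [abs_def] by (intro tendsto_intros tendsto_arctan_at_top) auto
  thus ?thesis by simp
qed

lemma smooth_step_at_bot: "(smooth_step \<longlongrightarrow> 0) at_bot"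
proof -
  have "(smooth_step \<longlongrightarrow> 1 / 2 + (- (pi / 2)) / pi) at_bot"
    unfolding smooth_step_def [abs_def] by (intro tendsto_intros tendsto_arctan_at_bot) auto
  thus ?thesis by simp
qed

text \<open>The shift by \<open>sqrt n\<close> is negligible against \<open>n * t\<close> and forces the limit 0 at \<open>t = 0\<close>, so that
  products of steps converge to indicators of open boxes at every point, including the boundary.\<close>

lemma smooth_step_limit:
  "(\<lambda>n. smooth_step (real n * t - sqrt (real n))) \<longlonglongrightarrow> indicator {0<..} t"
proof (cases "t > 0")
  case True
  have "filterlim (\<lambda>n. real n * t - sqrt (real n)) at_top sequentially" using True by real_asymp
  from filterlim_compose[OF smooth_step_at_top this] show ?thesis using True by simp
next
  case False
  have "filterlim (\<lambda>n. real n * t - sqrt (real n)) at_bot sequentially"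
  proof (cases "t = 0")
    case True thus ?thesis by simp real_asymp
  next
    case F: False
    with False have "t < 0" by simp
    thus ?thesis by real_asymp
  qed
  from filterlim_compose[OF smooth_step_at_bot this] show ?thesis using False by simp
qed

lemma C2_bounded_smooth_step: "C2_bounded (\<lambda>x::'a::euclidean_space. smooth_step (x \<bullet> a + e))"
proof (rule C2_bounded_ridge)
  fix t :: real
  have p: "1 + t\<^sup>2 > 0" for t :: real by (simp add: add_pos_nonneg)
  show "(smooth_step has_real_derivative (1 / (pi * (1 + t\<^sup>2)))) (at t)"
  proof -
    have "((\<lambda>t. 1 / 2 + arctan t / pi) has_real_derivative 0 + inverse (1 + t\<^sup>2) / pi) (at t)"
      by (intro DERIV_add DERIV_const DERIV_cdivide DERIV_arctan)
    thus ?thesis unfolding smooth_step_def [abs_def] by (simp add: inverse_eq_divide mult.commute)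
  qed
  show "((\<lambda>t. 1 / (pi * (1 + t\<^sup>2))) has_real_derivative - (2 * t / (pi * (1 + t\<^sup>2)\<^sup>2))) (at t)"
  proof -
    have "((\<lambda>t. 1 + t\<^sup>2) has_real_derivative 2 * t) (at t)" by (auto intro!: derivative_eq_intros)
    from DERIV_cdivide[OF DERIV_inverse_fun[OF this], of pi] p[of t]
    have "((\<lambda>t. inverse (1 + t\<^sup>2) / pi) has_real_derivative - (2 * t * inverse ((1 + t\<^sup>2) ^ Suc (Suc 0))) / pi) (at t)"
      by simp
    moreover have "- (2 * t * inverse ((1 + t\<^sup>2) ^ Suc (Suc 0))) / pi = - (2 * t / (pi * (1 + t\<^sup>2)\<^sup>2))"
      by (simp add: numeral_2_eq_2[symmetric] divide_inverse mult_ac)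
    moreover have "(\<lambda>t::real. inverse (1 + t\<^sup>2) / pi) = (\<lambda>t. 1 / (pi * (1 + t\<^sup>2)))"
      by (simp add: fun_eq_iff divide_inverse mult_ac)
    ultimately show ?thesis by (simp only:)
  qed
next
  have p: "1 + t\<^sup>2 > 0" for t :: real by (simp add: add_pos_nonneg)
  show "continuous_on UNIV (\<lambda>t::real. - (2 * t / (pi * (1 + t\<^sup>2)\<^sup>2)))"
    by (intro continuous_intros) (use p in \<open>auto simp: less_imp_neq[THEN not_sym]\<close>)
  show "bounded (range smooth_step)"
    using smooth_step_bounds unfolding bounded_iff by (intro exI[of _ 1]) auto
  have p1: "pi \<ge> 1" using pi_gt3 by simp
  have "\<bar>1 / (pi * (1 + t\<^sup>2))\<bar> \<le> 1" for t :: real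
  proof -
    have "1 * 1 \<le> pi * (1 + t\<^sup>2)" using p1 by (intro mult_mono) auto
    thus ?thesis by simp
  qed
  thus "bounded (range (\<lambda>t::real. 1 / (pi * (1 + t\<^sup>2))))" unfolding bounded_iff by auto
  have "\<bar>- (2 * t / (pi * (1 + t\<^sup>2)\<^sup>2))\<bar> \<le> 1" for t :: real
  proof -
    have a: "2 * \<bar>t\<bar> \<le> 1 + t\<^sup>2" using zero_le_power2[of "\<bar>t\<bar> - 1"] by (simp add: power2_diff)
    have b: "(1 + t\<^sup>2) * 1 \<le> (1 + t\<^sup>2) * (1 + t\<^sup>2)" by (intro mult_left_mono) auto
    have "1 * (1 + t\<^sup>2)\<^sup>2 \<le> pi * (1 + t\<^sup>2)\<^sup>2" using p1 by (intro mult_right_mono) auto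
    hence "2 * \<bar>t\<bar> \<le> pi * (1 + t\<^sup>2)\<^sup>2" using a b by (simp add: power2_eq_square)
    moreover have "pi * (1 + t\<^sup>2)\<^sup>2 > 0" using p[of t] by simp
    ultimately show ?thesis by (simp add: abs_mult)
  qed
  thus "bounded (range (\<lambda>t::real. - (2 * t / (pi * (1 + t\<^sup>2)\<^sup>2))))" unfolding bounded_iff by auto
qed

lemma C2_bounded_measurable: "C2_bounded k \<Longrightarrow> k \<in> borel_measurable borel"
  unfolding C2_bounded_def using C2_bounded_hessian_measurable by blast

text \<open>Products of smooth steps converge boundedly to indicators of open boxes. So the positive and the
  negative part of \<open>f\<close> are densities of measures that agree on a generator stable under intersections.\<close>

lemma AE_zero_if_orthogonal_to_C2_bounded:
  fixes f :: "'a::euclidean_space \<Rightarrow> real"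
  assumes int: "integrable lborel f" and orth: "\<And>k. C2_bounded k \<Longrightarrow> (LBINT x. f x * k x) = 0"
  shows "AE x in lborel. f x = 0"
proof -
  have [measurable]: "f \<in> borel_measurable borel" using int by (simp add: integrable_iff_bounded)
  have box: "(LBINT x. f x * indicator (box a b) x) = 0" for a b :: 'a
  proof -
    define k where "k n x = (\<Prod>i\<in>Basis. smooth_step (real n * (x \<bullet> i - a \<bullet> i) - sqrt (real n))
        * smooth_step (real n * (b \<bullet> i - x \<bullet> i) - sqrt (real n)))" for n and x :: 'a
    have C2: "C2_bounded (k n)" for n
    proof -
      have "C2_bounded (\<lambda>x. \<Prod>i\<in>Basis. smooth_step (x \<bullet> (real n *\<^sub>R i) + (- real n * (a \<bullet> i) - sqrt (real n)))
        * smooth_step (x \<bullet> (- real n *\<^sub>R i) + (real n * (b \<bullet> i) - sqrt (real n))))"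
        by (intro C2_bounded_prod C2_bounded_mult C2_bounded_smooth_step finite_Basis)
      moreover have "(\<lambda>x. \<Prod>i\<in>Basis. smooth_step (x \<bullet> (real n *\<^sub>R i) + (- real n * (a \<bullet> i) - sqrt (real n)))
        * smooth_step (x \<bullet> (- real n *\<^sub>R i) + (real n * (b \<bullet> i) - sqrt (real n)))) = k n"
        unfolding k_def
        by (intro ext prod.cong refl arg_cong2[where f = "\<lambda>s t. smooth_step s * smooth_step t"])
           (simp_all add: algebra_simps)
      ultimately show ?thesis by simp
    qed
    have lim: "(\<lambda>n. k n x) \<longlonglongrightarrow> indicator (box a b) x" for x
    proof -
      have "(\<lambda>n. k n x) \<longlonglongrightarrow> (\<Prod>i\<in>Basis. indicator {0<..} (x \<bullet> i - a \<bullet> i) * indicator {0<..} (b \<bullet> i - x \<bullet> i))"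
        unfolding k_def by (intro tendsto_prod tendsto_mult smooth_step_limit)
      also have "(\<Prod>i\<in>Basis. indicator {0<..} (x \<bullet> i - a \<bullet> i) * indicator {0<..} (b \<bullet> i - x \<bullet> i))
          = (indicator (box a b) x :: real)"
      proof (cases "x \<in> box a b")
        case True thus ?thesis by (auto simp: mem_box intro!: prod.neutral)
      next
        case False
        then obtain i where i: "i \<in> Basis" "\<not> (a \<bullet> i < x \<bullet> i \<and> x \<bullet> i < b \<bullet> i)" by (auto simp: mem_box)
        hence "(indicator {0<..} (x \<bullet> i - a \<bullet> i) * indicator {0<..} (b \<bullet> i - x \<bullet> i) :: real) = 0"
          by (auto simp: indicator_def)
        hence "(\<Prod>i\<in>Basis. indicator {0<..} (x \<bullet> i - a \<bullet> i) * indicator {0<..} (b \<bullet> i - x \<bullet> i)) = (0::real)"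
          using i(1) by (intro prod_zero) auto
        thus ?thesis using False by simp
      qed
      finally show ?thesis .
    qed
    have bound: "\<bar>k n x\<bar> \<le> 1" for n x
    proof -
      have "0 \<le> k n x" unfolding k_def by (intro prod_nonneg) (simp add: smooth_step_bounds)
      moreover have "k n x \<le> 1" unfolding k_def
        by (intro prod_le_1 conjI mult_nonneg_nonneg mult_le_one smooth_step_bounds)
      ultimately show ?thesis by simp
    qed
    have "(\<lambda>n. LBINT x. f x * k n x) \<longlonglongrightarrow> (LBINT x. f x * indicator (box a b) x)"
    proof (rule integral_dominated_convergence[where w = "\<lambda>x. \<bar>f x\<bar>"])
      show "(\<lambda>x. f x * k n x) \<in> borel_measurable lborel" for n
        using C2_bounded_measurable[OF C2[of n]] by simp
      show "(\<lambda>x. f x * indicator (box a b) x) \<in> borel_measurable lborel"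
        by (simp add: borel_measurable_indicator)
      show "AE x in lborel. (\<lambda>n. f x * k n x) \<longlonglongrightarrow> f x * indicator (box a b) x"
        by (intro AE_I2 tendsto_mult lim tendsto_const)
      show "AE x in lborel. norm (f x * k n x) \<le> \<bar>f x\<bar>" for n
        using bound by (intro AE_I2) (simp add: abs_mult mult_left_le)
    qed (use int in simp)
    moreover have "(\<lambda>n. LBINT x. f x * k n x) = (\<lambda>n. 0)" using orth[OF C2] by simp
    ultimately show ?thesis by (simp add: LIMSEQ_const_iff)
  qed
  have fin: "(\<integral>\<^sup>+x. ennreal (f x) \<partial>lborel) < \<infinity>" "(\<integral>\<^sup>+x. ennreal (- f x) \<partial>lborel) < \<infinity>"
    using int unfolding real_integrable_def by (auto simp: less_top)
  let ?M = "density lborel (\<lambda>x. ennreal (f x))" and ?N = "density lborel (\<lambda>x. ennreal (- f x))"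
  have "?M = ?N"
  proof (rule measure_eqI_generator_eq[where E = "range (\<lambda>(a, b). box a b :: 'a set)" and \<Omega> = UNIV
        and A = "\<lambda>n::nat. box (- (real n *\<^sub>R One)) (real n *\<^sub>R One) :: 'a set"])
    show "Int_stable (range (\<lambda>(a, b). box a b :: 'a set))"
      by (auto simp: Int_stable_def box_Int_box)
    show "range (\<lambda>(a, b). box a b :: 'a set) \<subseteq> Pow UNIV" by simp
    show "sets ?M = sigma_sets UNIV (range (\<lambda>(a, b). box a b))" "sets ?N = sigma_sets UNIV (range (\<lambda>(a, b). box a b))"
      by (simp_all add: borel_eq_box)
    show "range (\<lambda>n::nat. box (- (real n *\<^sub>R One)) (real n *\<^sub>R One) :: 'a set) \<subseteq> range (\<lambda>(a, b). box a b)"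
      by auto
    show "(\<Union>n::nat. box (- (real n *\<^sub>R One)) (real n *\<^sub>R One) :: 'a set) = UNIV"
      by (rule UN_box_eq_UNIV)
    show "emeasure ?M (box (- (real n *\<^sub>R One)) (real n *\<^sub>R One)) \<noteq> \<infinity>" for n
    proof -
      have "emeasure ?M (box (- (real n *\<^sub>R One)) (real n *\<^sub>R One))
          = (\<integral>\<^sup>+x. ennreal (f x) * indicator (box (- (real n *\<^sub>R One)) (real n *\<^sub>R One)) x \<partial>lborel)"
        by (intro emeasure_density) auto
      also have "\<dots> \<le> (\<integral>\<^sup>+x. ennreal (f x) \<partial>lborel)"
        by (intro nn_integral_mono) (auto simp: indicator_def)
      finally show ?thesis using fin(1) by (auto simp: top_unique)
    qed
    have inj: "p = q" if "p \<noteq> \<infinity>" "q \<noteq> \<infinity>" "enn2real p = enn2real q" for p q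
      using that by (cases p; cases q) auto
    fix X assume "X \<in> range (\<lambda>(a, b). box a b :: 'a set)"
    then obtain a b where X: "X = box a b" by auto
    have intX: "integrable lborel (\<lambda>x. f x * indicator X x)"
      unfolding X using int by (intro integrable_real_mult_indicator) auto
    have e: "ennreal (f x) * indicator X x = ennreal (f x * indicator X x)"
        "ennreal (- f x) * indicator X x = ennreal (- (f x * indicator X x))" for x
      by (auto simp: indicator_def)
    have em: "emeasure ?M X = (\<integral>\<^sup>+x. ennreal (f x * indicator X x) \<partial>lborel)"
        "emeasure ?N X = (\<integral>\<^sup>+x. ennreal (- (f x * indicator X x)) \<partial>lborel)"
      unfolding e[symmetric] by (intro emeasure_density; simp add: X)+
    have finX: "(\<integral>\<^sup>+x. ennreal (f x * indicator X x) \<partial>lborel) \<noteq> \<infinity>" "(\<integral>\<^sup>+x. ennreal (- (f x * indicator X x)) \<partial>lborel) \<noteq> \<infinity>"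
      using intX unfolding real_integrable_def by auto
    have "enn2real (\<integral>\<^sup>+x. ennreal (f x * indicator X x) \<partial>lborel) = enn2real (\<integral>\<^sup>+x. ennreal (- (f x * indicator X x)) \<partial>lborel)"
      using real_lebesgue_integral_def[OF intX] box[of a b] unfolding X by simp
    thus "emeasure ?M X = emeasure ?N X"
      unfolding em by (rule inj[OF finX])
  qed
  hence "AE x in lborel. ennreal (f x) = ennreal (- f x)"
    by (rule finite_density_unique[THEN iffD1, rotated -1]) (use fin(1) in auto)
  thus ?thesis
  proof eventually_elim
    case (elim x)
    show "f x = 0"
    proof (cases "f x \<ge> 0")
      case True
      hence "ennreal (f x) = 0" using elim by (simp add: ennreal_neg)
      thus ?thesis using True by simp
    next
      case False
      hence "ennreal (- f x) = 0" using elim by (simp add: ennreal_neg)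
      thus ?thesis using False by simp
    qed
  qed
qed

section \<open>Cutoffs and uniqueness of the weighted divergence\<close>

lemma DERIV_max_zero_squared: "((\<lambda>y::real. (max 0 y)\<^sup>2) has_real_derivative 2 * max 0 y) (at y)"
proof -
  consider "y > 0" | "y < 0" | "y = 0" by linarith
  thus ?thesis
  proof cases
    case 1
    have "((\<lambda>y::real. y\<^sup>2) has_real_derivative 2 * max 0 y) (at y)"
      using 1 by (auto intro!: derivative_eq_intros)
    thus ?thesis
      by (rule DERIV_cong_ev[THEN iffD1, rotated -1, OF _ refl])
         (use 1 eventually_nhds_in_open[of "{0<..}" y] in \<open>auto elim!: eventually_mono\<close>)
  next
    case 2
    have "((\<lambda>y::real. 0) has_real_derivative 2 * max 0 y) (at y)" using 2 by simp
    thus ?thesis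
      by (rule DERIV_cong_ev[THEN iffD1, rotated -1, OF _ refl])
         (use 2 eventually_nhds_in_open[of "{..<0}" y] in \<open>auto elim!: eventually_mono\<close>)
  next
    case 3
    have "((\<lambda>h::real. ((max 0 h)\<^sup>2 - 0) / h) \<longlongrightarrow> 0) (at 0)"
    proof (rule Lim_null_comparison)
      show "eventually (\<lambda>h. norm (((max 0 h)\<^sup>2 - 0) / h) \<le> \<bar>h\<bar>) (at (0::real))"
        by (intro always_eventually allI) (auto simp: max_def power2_eq_square)
      show "((\<lambda>h::real. \<bar>h\<bar>) \<longlongrightarrow> 0) (at 0)" by (rule tendsto_rabs_zero) (rule tendsto_ident_at)
    qed
    thus ?thesis using 3 by (simp add: has_field_derivative_iff)
  qed
qed

text \<open>Squaring the positive part makes the cutoff differentiable across the sphere where it starts to vanish.\<close>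

definition cutoff :: "nat \<Rightarrow> 'a::euclidean_space \<Rightarrow> real" where
  "cutoff n x = (max 0 (1 - (x \<bullet> x) / (real n + 1)\<^sup>2))\<^sup>2"

definition cutoff_gradient :: "nat \<Rightarrow> 'a::euclidean_space \<Rightarrow> 'a" where
  "cutoff_gradient n x = (- 4 * max 0 (1 - (x \<bullet> x) / (real n + 1)\<^sup>2) / (real n + 1)\<^sup>2) *\<^sub>R x"

lemma GDERIV_cutoff: "GDERIV (cutoff n) x :> cutoff_gradient n x"
proof -
  have "((\<lambda>x::'a. x \<bullet> x) has_derivative (\<lambda>y. 2 * (y \<bullet> x))) (at x)"
    by (auto intro!: derivative_eq_intros simp: inner_commute)
  from has_derivative_diff[OF has_derivative_const[of 1] has_derivative_mult_right[OF this, of "1 / (real n + 1)\<^sup>2"]]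
  have i: "((\<lambda>x::'a. 1 - (x \<bullet> x) / (real n + 1)\<^sup>2) has_derivative (\<lambda>y. - (2 * (y \<bullet> x)) / (real n + 1)\<^sup>2)) (at x)"
    by simp
  have "((\<lambda>y::real. (max 0 y)\<^sup>2) has_derivative (\<lambda>s. 2 * max 0 (1 - (x \<bullet> x) / (real n + 1)\<^sup>2) * s)) (at (1 - (x \<bullet> x) / (real n + 1)\<^sup>2))"
    using DERIV_max_zero_squared by (simp add: has_field_derivative_def)
  from has_derivative_compose[OF i this]
  show ?thesis unfolding gderiv_def cutoff_def [abs_def] cutoff_gradient_def by (simp add: mult_ac)
qed

lemma continuous_on_cutoff_gradient: "continuous_on UNIV (cutoff_gradient n)"
  unfolding cutoff_gradient_def [abs_def] by (intro continuous_intros) auto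

lemma cutoff_outside: "cutoff n x = 0" if "norm x \<ge> real n + 1"
proof -
  have "(real n + 1)\<^sup>2 \<le> x \<bullet> x" using that by (simp add: dot_square_norm power_mono)
  moreover have "(real n + 1)\<^sup>2 > 0" by simp
  ultimately have "1 \<le> (x \<bullet> x) / (real n + 1)\<^sup>2" by (subst pos_le_divide_eq) auto
  thus ?thesis unfolding cutoff_def by simp
qed

lemma cutoff_bounds: "0 \<le> cutoff n x" "cutoff n x \<le> 1"
  unfolding cutoff_def by (auto intro!: power_le_one)

lemma abs_cutoff_le: "\<bar>cutoff n x\<bar> \<le> 1"
  using cutoff_bounds[of n x] by simp

lemma cutoff_mono: "m \<le> n \<Longrightarrow> cutoff m x \<le> cutoff n x"
  unfolding cutoff_def
  by (intro power_mono max.mono diff_left_mono divide_left_mono order_refl) auto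

lemma cutoff_tendsto: "(\<lambda>n. cutoff n x) \<longlonglongrightarrow> 1"
proof -
  have "(\<lambda>n. (x \<bullet> x) / (real n + 1)\<^sup>2) \<longlonglongrightarrow> 0" by real_asymp
  hence "(\<lambda>n. cutoff n x) \<longlonglongrightarrow> (max 0 (1 - 0))\<^sup>2"
    unfolding cutoff_def by (intro tendsto_intros)
  thus ?thesis by simp
qed

lemma norm_cutoff_gradient: "norm (cutoff_gradient n x) \<le> 4 / (real n + 1)"
proof (cases "norm x < real n + 1")
  case True
  have p: "(real n + 1)\<^sup>2 > 0" by simp
  have m: "\<bar>max 0 (1 - (x \<bullet> x) / (real n + 1)\<^sup>2)\<bar> \<le> 1" by auto
  have "norm (cutoff_gradient n x) = 4 * \<bar>max 0 (1 - (x \<bullet> x) / (real n + 1)\<^sup>2)\<bar> * norm x / (real n + 1)\<^sup>2"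
    by (simp add: cutoff_gradient_def abs_mult)
  also have "\<dots> \<le> 4 * 1 * (real n + 1) / (real n + 1)\<^sup>2"
    using True m by (intro divide_right_mono mult_mono) auto
  also have "\<dots> = 4 / (real n + 1)"
  proof -
    have "4 * 1 * a / a\<^sup>2 = 4 / a" if "a > 0" for a :: real using that by (simp add: power2_eq_square)
    thus ?thesis by (metis of_nat_0_le_iff add_nonneg_pos zero_less_one)
  qed
  finally show ?thesis .
next
  case False
  hence "cutoff n x = 0" by (intro cutoff_outside) simp
  hence "max 0 (1 - (x \<bullet> x) / (real n + 1)\<^sup>2) = 0" unfolding cutoff_def by simp
  thus ?thesis by (simp add: cutoff_gradient_def)
qed

lemma test_function_cutoff_mult:
  assumes "\<And>x. GDERIV \<phi> x :> \<phi>' x" "continuous_on UNIV \<phi>'"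
  shows "test_function (\<lambda>x. cutoff n x * \<phi> x) (\<lambda>x. cutoff n x *\<^sub>R \<phi>' x + \<phi> x *\<^sub>R cutoff_gradient n x)"
  unfolding test_function_def
proof (intro conjI allI)
  show "GDERIV (\<lambda>x. cutoff n x * \<phi> x) x :> cutoff n x *\<^sub>R \<phi>' x + \<phi> x *\<^sub>R cutoff_gradient n x" for x
    by (intro GDERIV_mult GDERIV_cutoff assms)
  have "continuous_on UNIV \<phi>"
    using assms(1) by (metis UNIV_I continuous_at_imp_continuous_on gderiv_def has_derivative_continuous)
  moreover have "continuous_on UNIV (cutoff n :: 'a \<Rightarrow> real)"
    using GDERIV_cutoff by (metis UNIV_I continuous_at_imp_continuous_on gderiv_def has_derivative_continuous)
  ultimately show "continuous_on UNIV (\<lambda>x. cutoff n x *\<^sub>R \<phi>' x + \<phi> x *\<^sub>R cutoff_gradient n x)"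
    by (intro continuous_intros assms(2) continuous_on_cutoff_gradient)
  have "{x. cutoff n x * \<phi> x \<noteq> 0} \<subseteq> ball 0 (real n + 1)"
  proof
    fix x assume "x \<in> {x. cutoff n x * \<phi> x \<noteq> 0}"
    hence "cutoff n x \<noteq> 0" by auto
    hence "\<not> real n + 1 \<le> norm x" using cutoff_outside by blast
    thus "x \<in> ball 0 (real n + 1)" by simp
  qed
  hence "bounded {x. cutoff n x * \<phi> x \<noteq> 0}" using bounded_subset bounded_ball by blast
  thus "compact (closure {x. cutoff n x * \<phi> x \<noteq> 0})" by simp
qed

lemma test_function_cutoff: "test_function (cutoff n) (cutoff_gradient n)"
  using test_function_cutoff_mult[of "\<lambda>_. 1" "\<lambda>_. 0" n] by (simp add: gderiv_def)

lemma cutoff_measurable: "cutoff n \<in> borel_measurable borel"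
  by (rule test_function_measurable(1)[OF test_function_cutoff])

lemma cutoff_integral_tendsto:
  assumes "integrable lborel f"
  shows "(\<lambda>n. LBINT x. cutoff n x * f x) \<longlonglongrightarrow> (LBINT x. f x)"
proof (rule integral_tendsto_dominated_by_limit[OF assms])
  have [measurable]: "f \<in> borel_measurable borel" using assms by (simp add: integrable_iff_bounded)
  note [measurable] = cutoff_measurable
  show "(\<lambda>x. cutoff n x * f x) \<in> borel_measurable lborel" for n by measurable
  show "\<bar>cutoff n x * f x\<bar> \<le> \<bar>f x\<bar>" for n x
    using mult_right_mono[OF abs_cutoff_le[of n x], of "\<bar>f x\<bar>"] by (simp add: abs_mult)
  show "(\<lambda>n. cutoff n x * f x) \<longlonglongrightarrow> f x" for x
    using tendsto_mult[OF cutoff_tendsto[of x] tendsto_const[of "f x"]] by simp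
qed

text \<open>A cutoff turns each bounded C2 function into a test function, and the locally integrable difference
  of two divergences into an integrable function that is orthogonal to all of them.\<close>

lemma weighted_div_unique:
  fixes \<rho> :: "'a::euclidean_space \<Rightarrow> real"
  assumes "has_weighted_div \<rho> u w" "has_weighted_div \<rho> u w'"
  shows "AE x in lborel. \<rho> x * w x = \<rho> x * w' x"
proof -
  define f where "f x = \<rho> x * w x - \<rho> x * w' x" for x
  have orth: "integrable lborel (\<lambda>x. \<phi> x * f x) \<and> (LBINT x. \<phi> x * f x) = 0" if "test_function \<phi> \<phi>'" for \<phi> \<phi>'
  proof -
    have *: "integrable lborel (\<lambda>x. \<phi> x * (\<rho> x * w x))" "integrable lborel (\<lambda>x. \<phi> x * (\<rho> x * w' x))"
      "(LBINT x. \<phi> x * (\<rho> x * w x)) = (LBINT x. \<phi> x * (\<rho> x * w' x))"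
      using assms that unfolding has_weighted_div_def has_weak_divergence_def by fastforce+
    have "(\<lambda>x. \<phi> x * f x) = (\<lambda>x. \<phi> x * (\<rho> x * w x) - \<phi> x * (\<rho> x * w' x))"
      by (simp add: f_def right_diff_distrib)
    thus ?thesis using * by simp
  qed
  have "AE x in lborel. cutoff n x * f x = 0" for n
  proof (rule AE_zero_if_orthogonal_to_C2_bounded)
    show "integrable lborel (\<lambda>x. cutoff n x * f x)" using orth[OF test_function_cutoff] by blast
    fix k :: "'a \<Rightarrow> real" assume "C2_bounded k"
    then obtain g H where C2: "C2_bounded_hessian k g H" unfolding C2_bounded_def by blast
    have "test_function (\<lambda>x. cutoff n x * k x) (\<lambda>x. cutoff n x *\<^sub>R g x + k x *\<^sub>R cutoff_gradient n x)"
      using C2 C2_bounded_hessian_continuous(2)[OF C2]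
      by (intro test_function_cutoff_mult) (auto simp: C2_bounded_hessian_def)
    from orth[OF this] show "(LBINT x. cutoff n x * f x * k x) = 0" by (simp add: mult_ac)
  qed
  hence "AE x in lborel. \<forall>n. cutoff n x * f x = 0" unfolding AE_all_countable by (rule allI)
  thus ?thesis
  proof eventually_elim
    case (elim x)
    have "(\<lambda>n. cutoff n x * f x) \<longlonglongrightarrow> 1 * f x" by (intro tendsto_intros cutoff_tendsto)
    hence "f x = 0" using elim by (simp add: LIMSEQ_const_iff)
    thus ?case by (simp add: f_def)
  qed
qed

section \<open>Testing the continuity equation with bounded functions\<close>

lemma prob_densitiesD:
  assumes "\<rho> \<in> prob_densities"
  shows "\<rho> \<in> borel_measurable borel" "\<And>x. 0 \<le> \<rho> x" "integrable lborel \<rho>" "(LBINT x. \<rho> x) = 1"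
    "integrable lborel (\<lambda>x. (norm x)\<^sup>2 * \<rho> x)"
  using assms by (auto simp: prob_densities_def)

lemma prob_integrable_bounded:
  assumes "\<rho> \<in> prob_densities" "F \<in> borel_measurable borel" "\<And>x. \<bar>F x\<bar> \<le> B"
  shows "integrable lborel (\<lambda>x. F x * \<rho> x)"
  by (rule integrable_bounded_mult[OF prob_densitiesD(3)[OF assms(1)] _ assms(3)]) (use assms(2) in simp)

lemma prob_integrable_C2:
  assumes "\<rho> \<in> prob_densities" "C2_bounded_hessian h g H"
  shows "integrable lborel (\<lambda>x. h x * \<rho> x)"
proof -
  obtain C where C: "C > 0" "\<And>x. \<bar>h x\<bar> \<le> C * (1 + (norm x)\<^sup>2)"
    using C2_bounded_hessian_growth[OF assms(2)] by blast
  note p = prob_densitiesD[OF assms(1)]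
  note [measurable] = p(1) C2_bounded_hessian_measurable[OF assms(2)]
  have "integrable lborel (\<lambda>x. C * (\<rho> x + (norm x)\<^sup>2 * \<rho> x))" using p by simp
  thus ?thesis
  proof (rule Bochner_Integration.integrable_bound)
    show "AE x in lborel. norm (h x * \<rho> x) \<le> norm (C * (\<rho> x + (norm x)\<^sup>2 * \<rho> x))"
    proof (intro AE_I2)
      fix x
      have "\<bar>h x\<bar> * \<rho> x \<le> (C * (1 + (norm x)\<^sup>2)) * \<rho> x" using C p(2)[of x] by (intro mult_right_mono) auto
      also have "\<dots> = C * (\<rho> x + (norm x)\<^sup>2 * \<rho> x)" by (simp add: algebra_simps)
      also have "\<dots> \<le> \<bar>C * (\<rho> x + (norm x)\<^sup>2 * \<rho> x)\<bar>" by simp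
      finally show "norm (h x * \<rho> x) \<le> norm (C * (\<rho> x + (norm x)\<^sup>2 * \<rho> x))"
        using p(2)[of x] by (simp add: abs_mult)
    qed
  qed measurable
qed

lemma L2_product_integrable:
  assumes "f \<in> L2_functions \<rho>" "w \<in> L2_functions \<rho>" "\<And>x. 0 \<le> \<rho> x" "\<rho> \<in> borel_measurable borel"
  shows "integrable lborel (\<lambda>x. f x * (\<rho> x * w x))"
proof (rule Bochner_Integration.integrable_bound)
  have [measurable]: "f \<in> borel_measurable borel" "w \<in> borel_measurable borel" and
    i: "integrable lborel (\<lambda>x. (f x)\<^sup>2 * \<rho> x)" "integrable lborel (\<lambda>x. (w x)\<^sup>2 * \<rho> x)"
    using assms(1,2) by (auto simp: L2_functions_def)
  note [measurable] = assms(4)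
  show "integrable lborel (\<lambda>x. (f x)\<^sup>2 * \<rho> x + (w x)\<^sup>2 * \<rho> x)" using i by simp
  show "(\<lambda>x. f x * (\<rho> x * w x)) \<in> borel_measurable lborel" by measurable
  show "AE x in lborel. norm (f x * (\<rho> x * w x)) \<le> norm ((f x)\<^sup>2 * \<rho> x + (w x)\<^sup>2 * \<rho> x)"
  proof (intro AE_I2)
    fix x
    have "0 \<le> (\<bar>f x\<bar> - \<bar>w x\<bar>)\<^sup>2" by simp
    hence "2 * (\<bar>f x\<bar> * \<bar>w x\<bar>) \<le> (f x)\<^sup>2 + (w x)\<^sup>2" by (simp add: power2_diff)
    moreover have "0 \<le> \<bar>f x\<bar> * \<bar>w x\<bar>" by simp
    ultimately have "\<bar>f x\<bar> * \<bar>w x\<bar> \<le> (f x)\<^sup>2 + (w x)\<^sup>2" by linarith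
    hence "\<bar>f x\<bar> * \<bar>w x\<bar> * \<rho> x \<le> ((f x)\<^sup>2 + (w x)\<^sup>2) * \<rho> x" using assms(3) by (rule mult_right_mono)
    thus "norm (f x * (\<rho> x * w x)) \<le> norm ((f x)\<^sup>2 * \<rho> x + (w x)\<^sup>2 * \<rho> x)"
      using assms(3)[of x] by (simp add: abs_mult mult_ac distrib_left)
  qed
qed

lemma L2_constant: "\<rho> \<in> prob_densities \<Longrightarrow> (\<lambda>_. c) \<in> L2_functions \<rho>"
  using prob_densitiesD(3) by (auto simp: L2_functions_def)

lemma integral_centered:
  assumes "\<rho> \<in> prob_densities" "C2_bounded_hessian h g H"
  shows "integrable lborel (\<lambda>x. \<rho> x * (h x - mean h \<rho>))" "(LBINT x. \<rho> x * (h x - mean h \<rho>)) = 0"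
proof -
  have e: "(\<lambda>x. \<rho> x * (h x - mean h \<rho>)) = (\<lambda>x. h x * \<rho> x - mean h \<rho> * \<rho> x)" by (simp add: algebra_simps)
  note i = prob_integrable_C2[OF assms] prob_densitiesD(3,4)[OF assms(1)]
  show "integrable lborel (\<lambda>x. \<rho> x * (h x - mean h \<rho>))" unfolding e using i by simp
  show "(LBINT x. \<rho> x * (h x - mean h \<rho>)) = 0" unfolding e using i by (simp add: mean_def)
qed

text \<open>Testing with cutoffs, whose gradients tend to zero uniformly, against the integrable momentum.\<close>

lemma integral_weighted_div_zero:
  fixes \<rho> :: "'a::euclidean_space \<Rightarrow> real"
  assumes \<rho>: "\<rho> \<in> prob_densities" and u: "u \<in> L2_fields \<rho>"
    and div: "has_weighted_div \<rho> u w" and int: "integrable lborel (\<lambda>x. \<rho> x * w x)"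
  shows "(LBINT x. \<rho> x * w x) = 0"
proof -
  note p = prob_densitiesD[OF \<rho>]
  have um [measurable]: "u \<in> borel_measurable borel" and u2: "integrable lborel (\<lambda>x. (norm (u x))\<^sup>2 * \<rho> x)"
    using u by (auto simp: L2_fields_def)
  note [measurable] = p(1) cutoff_measurable test_function_measurable(2)[OF test_function_cutoff]
  have intu: "integrable lborel (\<lambda>x. \<rho> x * norm (u x))"
    using L2_product_integrable[OF L2_constant[OF \<rho>, of 1] _ p(2,1), of "\<lambda>x. norm (u x)"] u2
    by (simp add: L2_functions_def)
  have eq: "(LBINT x. cutoff n x * (\<rho> x * w x)) = - (LBINT x. cutoff_gradient n x \<bullet> (\<rho> x *\<^sub>R u x))" for n
    using div test_function_cutoff[of n] unfolding has_weighted_div_def has_weak_divergence_def by fastforce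
  have l1: "(\<lambda>n. LBINT x. cutoff n x * (\<rho> x * w x)) \<longlonglongrightarrow> (LBINT x. \<rho> x * w x)"
    by (rule cutoff_integral_tendsto[OF int])
  have l2: "(\<lambda>n. LBINT x. cutoff n x * (\<rho> x * w x)) \<longlonglongrightarrow> 0"
  proof (rule Lim_null_comparison)
    show "eventually (\<lambda>n. norm (LBINT x. cutoff n x * (\<rho> x * w x)) \<le> 4 / (real n + 1) * (LBINT x. \<rho> x * norm (u x))) sequentially"
    proof (intro always_eventually allI)
      fix n
      have "norm (LBINT x. cutoff n x * (\<rho> x * w x)) = norm (LBINT x. cutoff_gradient n x \<bullet> (\<rho> x *\<^sub>R u x))"
        unfolding eq by simp
      also have "\<dots> \<le> (LBINT x. norm (cutoff_gradient n x \<bullet> (\<rho> x *\<^sub>R u x)))" by (rule integral_norm_bound)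
      also have "\<dots> \<le> (LBINT x. 4 / (real n + 1) * (\<rho> x * norm (u x)))"
      proof (rule integral_mono_AE')
        show "integrable lborel (\<lambda>x. 4 / (real n + 1) * (\<rho> x * norm (u x)))" using intu by simp
        show "AE x in lborel. norm (cutoff_gradient n x \<bullet> (\<rho> x *\<^sub>R u x)) \<le> 4 / (real n + 1) * (\<rho> x * norm (u x))"
        proof (intro AE_I2)
          fix x
          have "norm (cutoff_gradient n x \<bullet> (\<rho> x *\<^sub>R u x)) \<le> norm (cutoff_gradient n x) * norm (\<rho> x *\<^sub>R u x)"
            by (simp only: real_norm_def Cauchy_Schwarz_ineq2)
          also have "\<dots> \<le> 4 / (real n + 1) * norm (\<rho> x *\<^sub>R u x)" by (intro mult_right_mono norm_cutoff_gradient) simp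
          finally show "norm (cutoff_gradient n x \<bullet> (\<rho> x *\<^sub>R u x)) \<le> 4 / (real n + 1) * (\<rho> x * norm (u x))"
            using p(2)[of x] by simp
        qed
      qed (use p(2) in simp)
      finally show "norm (LBINT x. cutoff n x * (\<rho> x * w x)) \<le> 4 / (real n + 1) * (LBINT x. \<rho> x * norm (u x))" by simp
    qed
    have "(\<lambda>n. 4 / (real n + 1)) \<longlonglongrightarrow> 0" by real_asymp
    thus "(\<lambda>n. 4 / (real n + 1) * (LBINT x. \<rho> x * norm (u x))) \<longlonglongrightarrow> 0" by (rule tendsto_mult_left_zero)
  qed
  from LIMSEQ_unique[OF l1 l2] show ?thesis by simp
qed

text \<open>The gradient of \<open>\<phi>\<close> may be unbounded. Therefore the gradient term is rewritten through the weighted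
  divergence while a cutoff is still present, and the cutoff is removed afterwards under the majorant \<open>G\<close>. The
  function \<open>D\<close> is a measurable representative: at the exceptional times nothing is known about \<open>w s\<close>, so that
  the integrals on the right need not depend measurably on \<open>s\<close>.\<close>

lemma bounded_C1_along_path:
  fixes r :: "real \<Rightarrow> 'a::euclidean_space \<Rightarrow> real"
  assumes path: "continuity_path t0 t1 r u" and le: "t0 \<le> t1"
    and div: "AE s\<in>{t0..t1} in lborel. has_weighted_div (r s) (u s) (w s)
        \<and> integrable lborel (\<lambda>x. r s x * w s x) \<and> (LBINT x. \<bar>r s x * w s x\<bar>) \<le> G s"
    and G: "set_integrable lborel {t0..t1} G"
    and \<phi>: "\<And>x. GDERIV \<phi> x :> \<phi>' x" "continuous_on UNIV \<phi>'" "\<And>x. \<bar>\<phi> x\<bar> \<le> B"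
  obtains D where "set_integrable lborel {t0..t1} D"
    "AE s\<in>{t0..t1} in lborel. D s = (LBINT x. \<phi> x * (r s x * w s x))"
    "(LBINT x. \<phi> x * r t0 x) - (LBINT x. \<phi> x * r t1 x) = (LINT s:{t0..t1}|lborel. D s)"
proof -
  have B0: "B \<ge> 0" using \<phi>(3)[of 0] by simp
  let ?f = "\<lambda>n x. cutoff n x * \<phi> x"
  let ?f' = "\<lambda>n x. cutoff n x *\<^sub>R \<phi>' x + \<phi> x *\<^sub>R cutoff_gradient n x"
  have test: "test_function (?f n) (?f' n)" for n by (rule test_function_cutoff_mult[OF \<phi>(1,2)])
  have cphi: "continuous_on UNIV \<phi>"
    using \<phi>(1) by (metis UNIV_I continuous_at_imp_continuous_on gderiv_def has_derivative_continuous)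
  have [measurable]: "\<phi> \<in> borel_measurable borel" using cphi by (rule borel_measurable_continuous_onI)
  note [measurable] = cutoff_measurable
  have fb: "\<bar>?f n x\<bar> \<le> \<bar>\<phi> x\<bar>" for n x using cutoff_bounds[of n x] by (simp add: abs_mult mult_left_le_one_le)
  define E where "E n s = indicator {t0..t1} s *\<^sub>R (LBINT x. ?f' n x \<bullet> (r s x *\<^sub>R u s x))" for n s
  have intE: "integrable lborel (E n)" for n
    using path test[of n] unfolding continuity_path_def set_integrable_def E_def by blast
  hence [measurable]: "E n \<in> borel_measurable borel" for n by (simp add: integrable_iff_bounded)
  define L where "L s = lim (\<lambda>n. E n s)" for s
  have [measurable]: "L \<in> borel_measurable borel" unfolding L_def [abs_def] by (rule borel_measurable_lim_metric) measurable
  have ptw: "AE s in lborel. (\<lambda>n. E n s) \<longlonglongrightarrow> - (indicator {t0..t1} s * (LBINT x. \<phi> x * (r s x * w s x)))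
      \<and> (\<forall>n. \<bar>E n s\<bar> \<le> B * (indicator {t0..t1} s *\<^sub>R G s))"
    using div
  proof eventually_elim
    case (elim s)
    show ?case
    proof (cases "s \<in> {t0..t1}")
      case True
      with elim have w: "has_weighted_div (r s) (u s) (w s)" and iw: "integrable lborel (\<lambda>x. r s x * w s x)"
        and wG: "(LBINT x. \<bar>r s x * w s x\<bar>) \<le> G s" by auto
      have [measurable]: "(\<lambda>x. r s x * w s x) \<in> borel_measurable borel" using iw by (simp add: integrable_iff_bounded)
      have E: "E n s = - (LBINT x. ?f n x * (r s x * w s x))" for n
        using w test[of n] True unfolding E_def has_weighted_div_def has_weak_divergence_def by auto
      have bd: "norm (?f n x * (r s x * w s x)) \<le> B * \<bar>r s x * w s x\<bar>" for n x
        unfolding real_norm_def abs_mult[of "?f n x"] using fb[of n x] \<phi>(3)[of x] by (intro mult_right_mono) auto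
      have "integrable lborel (\<lambda>x. \<phi> x * (r s x * w s x))"
        by (rule integrable_bounded_mult[OF iw _ \<phi>(3)]) measurable
      from cutoff_integral_tendsto[OF this]
      have lim: "(\<lambda>n. E n s) \<longlonglongrightarrow> - (LBINT x. \<phi> x * (r s x * w s x))"
        unfolding E by (intro tendsto_minus) (simp only: mult.assoc)
      have "\<bar>E n s\<bar> \<le> B * G s" for n
      proof -
        have "\<bar>E n s\<bar> = norm (LBINT x. ?f n x * (r s x * w s x))" unfolding E by simp
        also have "\<dots> \<le> (LBINT x. norm (?f n x * (r s x * w s x)))" by (rule integral_norm_bound)
        also have "\<dots> \<le> (LBINT x. B * \<bar>r s x * w s x\<bar>)"
          by (rule integral_mono_AE') (use iw bd B0 in auto)
        also have "\<dots> \<le> B * G s" using wG B0 by (simp add: mult_left_mono)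
        finally show ?thesis .
      qed
      thus ?thesis using lim True by simp
    next
      case False
      thus ?thesis by (simp add: E_def)
    qed
  qed
  have intG: "integrable lborel (\<lambda>s. B * (indicator {t0..t1} s *\<^sub>R G s))" using G unfolding set_integrable_def by simp
  have limL: "AE s in lborel. (\<lambda>n. E n s) \<longlonglongrightarrow> L s" 
    using ptw by eventually_elim (auto simp: L_def limI)
  have bdE: "AE s in lborel. norm (E n s) \<le> B * (indicator {t0..t1} s *\<^sub>R G s)" for n
    using ptw by eventually_elim auto
  have intL: "integrable lborel L"
    by (rule integrable_dominated_convergence[OF _ _ intG limL bdE]) measurable
  have convL: "(\<lambda>n. LBINT s. E n s) \<longlonglongrightarrow> (LBINT s. L s)"
    by (rule integral_dominated_convergence[OF _ _ intG limL bdE]) measurable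
  have Lind: "AE s in lborel. indicator {t0..t1} s *\<^sub>R (- L s) = - L s"
    using ptw
  proof eventually_elim
    case (elim s)
    hence "L s = - (indicator {t0..t1} s * (LBINT x. \<phi> x * (r s x * w s x)))" unfolding L_def by (blast intro: limI)
    thus ?case by (auto simp: indicator_def)
  qed
  have rconv: "(\<lambda>n. LBINT x. ?f n x * r s x) \<longlonglongrightarrow> (LBINT x. \<phi> x * r s x)" if "s \<in> {t0..t1}" for s
  proof -
    have rp: "r s \<in> prob_densities" using path that by (simp add: continuity_path_def)
    have "integrable lborel (\<lambda>x. \<phi> x * r s x)"
      by (rule prob_integrable_bounded[OF rp _ \<phi>(3)]) measurable
    from cutoff_integral_tendsto[OF this] show ?thesis by (simp only: mult.assoc)
  qed
  have eqn: "(LBINT x. ?f n x * r t1 x) - (LBINT x. ?f n x * r t0 x) = (LBINT s. E n s)" for n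
    using path test[of n] le unfolding continuity_path_def E_def set_lebesgue_integral_def by fastforce
  have "(\<lambda>n. (LBINT x. ?f n x * r t1 x) - (LBINT x. ?f n x * r t0 x)) \<longlonglongrightarrow>
      (LBINT x. \<phi> x * r t1 x) - (LBINT x. \<phi> x * r t0 x)"
    by (intro tendsto_diff rconv) (use le in auto)
  with convL have final: "(LBINT x. \<phi> x * r t1 x) - (LBINT x. \<phi> x * r t0 x) = (LBINT s. L s)"
    unfolding eqn by (rule LIMSEQ_unique[rotated])
  show thesis
  proof (rule that[of "\<lambda>s. - L s"])
    show "set_integrable lborel {t0..t1} (\<lambda>s. - L s)"
      unfolding set_integrable_def using intL by (intro integrable_mult_indicator) auto
    show "AE s\<in>{t0..t1} in lborel. - L s = (LBINT x. \<phi> x * (r s x * w s x))"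
      using ptw
    proof eventually_elim
      case (elim s)
      hence "L s = - (indicator {t0..t1} s * (LBINT x. \<phi> x * (r s x * w s x)))" unfolding L_def by (blast intro: limI)
      thus ?case by auto
    qed
    have "(LINT s:{t0..t1}|lborel. - L s) = (LBINT s. - L s)"
      unfolding set_lebesgue_integral_def by (rule integral_cong_AE) (use Lind in auto)
    thus "(LBINT x. \<phi> x * r t0 x) - (LBINT x. \<phi> x * r t1 x) = (LINT s:{t0..t1}|lborel. - L s)"
      using final by simp
  qed
qed

text \<open>Bounded, so that \<open>trunc n \<circ> h\<close> may be tested along paths; 1-Lipschitz, so that truncation does not
  increase the deviation from the mean; and nondecreasing, so that truncated covariances with \<open>h\<close> are nonnegative.\<close>

definition trunc :: "nat \<Rightarrow> real \<Rightarrow> real" where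
  "trunc n y = (real n + 1) * arctan (y / (real n + 1))"

definition trunc_deriv :: "nat \<Rightarrow> real \<Rightarrow> real" where
  "trunc_deriv n y = 1 / (1 + (y / (real n + 1))\<^sup>2)"

lemma DERIV_trunc: "(trunc n has_real_derivative trunc_deriv n y) (at y)"
proof -
  have c: "real n + 1 \<noteq> 0" by simp
  have "((\<lambda>y. y / (real n + 1)) has_real_derivative 1 / (real n + 1)) (at y)"
    by (intro DERIV_cdivide DERIV_ident)
  from DERIV_cmult[OF DERIV_chain2[OF DERIV_arctan this], of "real n + 1"]
  show ?thesis unfolding trunc_def [abs_def] trunc_deriv_def using c by (simp add: inverse_eq_divide)
qed

lemma trunc_deriv_bounds: "0 \<le> trunc_deriv n y" "trunc_deriv n y \<le> 1"
  unfolding trunc_deriv_def by (auto simp: divide_le_eq add_nonneg_pos add_pos_nonneg)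

lemma trunc_mono: "y \<le> z \<Longrightarrow> trunc n y \<le> trunc n z"
  by (rule DERIV_nonneg_imp_nondecreasing) (use DERIV_trunc trunc_deriv_bounds in blast)+

lemma trunc_lipschitz: "\<bar>trunc n y - trunc n z\<bar> \<le> \<bar>y - z\<bar>"
proof -
  have *: "trunc n z - trunc n y \<le> z - y" if "y \<le> z" for y z
  proof -
    have "y - trunc n y \<le> z - trunc n z"
    proof (rule DERIV_nonneg_imp_nondecreasing[OF that])
      fix x
      have "((\<lambda>x. x - trunc n x) has_real_derivative 1 - trunc_deriv n x) (at x)"
        by (intro DERIV_diff DERIV_ident DERIV_trunc)
      thus "\<exists>d. ((\<lambda>x. x - trunc n x) has_real_derivative d) (at x) \<and> 0 \<le> d"
        using trunc_deriv_bounds(2)[of n x] by (intro exI conjI) auto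
    qed
    thus ?thesis by simp
  qed
  show ?thesis
  proof (cases "y \<le> z")
    case True thus ?thesis using *[of y z] trunc_mono[of y z n] by simp
  next
    case False thus ?thesis using *[of z y] trunc_mono[of z y n] by simp
  qed
qed

lemma trunc_0 [simp]: "trunc n 0 = 0" by (simp add: trunc_def)

lemma trunc_abs_le: "\<bar>trunc n y\<bar> \<le> \<bar>y\<bar>"
  using trunc_lipschitz[of n y 0] by simp

lemma trunc_bounded: "\<bar>trunc n y\<bar> \<le> (real n + 1) * pi"
proof -
  have "\<bar>arctan (y / (real n + 1))\<bar> \<le> pi"
    using arctan_lbound[of "y / (real n + 1)"] arctan_ubound[of "y / (real n + 1)"] pi_gt_zero by linarith
  hence "(real n + 1) * \<bar>arctan (y / (real n + 1))\<bar> \<le> (real n + 1) * pi" by (intro mult_left_mono) auto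
  thus ?thesis by (simp add: trunc_def abs_mult)
qed

lemma trunc_tendsto: "(\<lambda>n. trunc n y) \<longlonglongrightarrow> y"
proof (cases "y = 0")
  case False
  thus ?thesis unfolding trunc_def by real_asymp
qed simp

lemma trunc_continuous: "continuous_on UNIV (trunc n)"
  using DERIV_trunc by (meson DERIV_isCont continuous_at_imp_continuous_on)

lemma GDERIV_trunc:
  assumes "C2_bounded_hessian h g H"
  shows "GDERIV (\<lambda>x. trunc n (h x)) x :> trunc_deriv n (h x) *\<^sub>R g x"
    and "continuous_on UNIV (\<lambda>x. trunc_deriv n (h x) *\<^sub>R g x)"
proof -
  show "GDERIV (\<lambda>x. trunc n (h x)) x :> trunc_deriv n (h x) *\<^sub>R g x"
    using assms by (intro GDERIV_DERIV_compose DERIV_trunc) (auto simp: C2_bounded_hessian_def)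
  have "1 + y\<^sup>2 \<noteq> 0" for y :: real by (metis add_pos_nonneg less_irrefl zero_le_power2 zero_less_one)
  thus "continuous_on UNIV (\<lambda>x. trunc_deriv n (h x) *\<^sub>R g x)"
    unfolding trunc_deriv_def by (intro continuous_intros C2_bounded_hessian_continuous[OF assms]) auto
qed

lemma trunc_measurable: "h \<in> borel_measurable borel \<Longrightarrow> (\<lambda>x. trunc n (h x)) \<in> borel_measurable borel"
  using measurable_compose[OF _ borel_measurable_continuous_onI[OF trunc_continuous]] .

lemma trunc_integral_tendsto:
  assumes "integrable lborel (\<lambda>x. h x * f x)" and [measurable]: "h \<in> borel_measurable borel" "f \<in> borel_measurable borel"
  shows "(\<lambda>n. LBINT x. trunc n (h x) * f x) \<longlonglongrightarrow> (LBINT x. h x * f x)"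
proof (rule integral_tendsto_dominated_by_limit[OF assms(1)])
  note [measurable] = trunc_measurable
  show "(\<lambda>x. trunc n (h x) * f x) \<in> borel_measurable lborel" for n by measurable
  show "\<bar>trunc n (h x) * f x\<bar> \<le> \<bar>h x * f x\<bar>" for n x
    by (simp add: abs_mult mult_right_mono trunc_abs_le)
  show "(\<lambda>n. trunc n (h x) * f x) \<longlonglongrightarrow> h x * f x" for x
    by (intro tendsto_intros trunc_tendsto)
qed

lemma trunc_mean_tendsto:
  assumes "\<rho> \<in> prob_densities" "C2_bounded_hessian h g H"
  shows "(\<lambda>n. LBINT x. trunc n (h x) * \<rho> x) \<longlonglongrightarrow> (LBINT x. h x * \<rho> x)"
  by (rule trunc_integral_tendsto[OF prob_integrable_C2[OF assms] C2_bounded_hessian_measurable[OF assms(2)] prob_densitiesD(1)[OF assms(1)]])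

section \<open>The running cost as a completed square\<close>

lemma lagrangian_finiteD:
  fixes \<rho> :: "'a::euclidean_space \<Rightarrow> real"
  assumes \<rho>: "\<rho> \<in> prob_densities" and u: "u \<in> L2_fields \<rho>" and h: "C2_bounded_hessian h g H" and "\<beta> > 0"
    and fin: "lagrangian h \<beta> \<rho> u < \<infinity>"
  defines "w \<equiv> weighted_div \<rho> u"
  shows "has_weighted_div \<rho> u w" "integrable lborel (\<lambda>x. (w x)\<^sup>2 * \<rho> x)"
    "integrable lborel (\<lambda>x. (h x - mean h \<rho>)\<^sup>2 * \<rho> x)"
    "lagrangian h \<beta> \<rho> u = ennreal (1 / 2 * (LBINT x. (w x)\<^sup>2 * \<rho> x) + \<beta>\<^sup>2 / 2 * (LBINT x. (h x - mean h \<rho>)\<^sup>2 * \<rho> x))"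
    "integrable lborel (\<lambda>x. \<rho> x * w x)" "(LBINT x. \<rho> x * w x) = 0"
    "(LBINT x. \<bar>\<rho> x * w x\<bar>) \<le> enn2real (lagrangian h \<beta> \<rho> u) + 1"
proof -
  note p = prob_densitiesD[OF \<rho>]
  note [measurable] = p(1) C2_bounded_hessian_measurable[OF h]
  have ex: "\<exists>w. has_weighted_div \<rho> u w" using fin unfolding lagrangian_def by (auto split: if_splits)
  show w: "has_weighted_div \<rho> u w" unfolding w_def weighted_div_def using ex by (rule someI_ex)
  hence wm [measurable]: "w \<in> borel_measurable borel" by (simp add: has_weighted_div_def)
  have L: "lagrangian h \<beta> \<rho> u = ennreal (1/2) * (\<integral>\<^sup>+x. ennreal ((w x)\<^sup>2 * \<rho> x) \<partial>lborel)
         + ennreal (\<beta>\<^sup>2 / 2) * (\<integral>\<^sup>+x. ennreal ((h x - mean h \<rho>)\<^sup>2 * \<rho> x) \<partial>lborel)"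
    using ex by (simp add: lagrangian_def w_def)
  have "ennreal (1/2) * (\<integral>\<^sup>+x. ennreal ((w x)\<^sup>2 * \<rho> x) \<partial>lborel) < \<infinity>"
    "ennreal (\<beta>\<^sup>2 / 2) * (\<integral>\<^sup>+x. ennreal ((h x - mean h \<rho>)\<^sup>2 * \<rho> x) \<partial>lborel) < \<infinity>"
    using fin unfolding L by auto
  hence f: "(\<integral>\<^sup>+x. ennreal ((w x)\<^sup>2 * \<rho> x) \<partial>lborel) < \<infinity>" "(\<integral>\<^sup>+x. ennreal ((h x - mean h \<rho>)\<^sup>2 * \<rho> x) \<partial>lborel) < \<infinity>"
    using \<open>\<beta> > 0\<close> by (auto simp: ennreal_mult_less_top)
  show i1: "integrable lborel (\<lambda>x. (w x)\<^sup>2 * \<rho> x)"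
    using f(1) p(2) by (intro integrableI_nonneg) auto
  show i2: "integrable lborel (\<lambda>x. (h x - mean h \<rho>)\<^sup>2 * \<rho> x)"
    using f(2) p(2) by (intro integrableI_nonneg) auto
  have nn: "(\<integral>\<^sup>+x. ennreal ((w x)\<^sup>2 * \<rho> x) \<partial>lborel) = ennreal (LBINT x. (w x)\<^sup>2 * \<rho> x)"
    "(\<integral>\<^sup>+x. ennreal ((h x - mean h \<rho>)\<^sup>2 * \<rho> x) \<partial>lborel) = ennreal (LBINT x. (h x - mean h \<rho>)\<^sup>2 * \<rho> x)"
    using i1 i2 p(2) by (intro nn_integral_eq_integral; simp)+
  have n0: "(LBINT x. (w x)\<^sup>2 * \<rho> x) \<ge> 0" "(LBINT x. (h x - mean h \<rho>)\<^sup>2 * \<rho> x) \<ge> 0"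
    using p(2) by (intro Bochner_Integration.integral_nonneg; simp)+
  show Leq: "lagrangian h \<beta> \<rho> u = ennreal (1 / 2 * (LBINT x. (w x)\<^sup>2 * \<rho> x) + \<beta>\<^sup>2 / 2 * (LBINT x. (h x - mean h \<rho>)\<^sup>2 * \<rho> x))"
  proof -
    have e: "ennreal a * ennreal b = ennreal (a * b)" if "a \<ge> 0" "b \<ge> 0" for a b
      using that by (rule ennreal_mult[symmetric])
    have a: "(0::real) \<le> 1 / 2" "0 \<le> \<beta>\<^sup>2 / 2" by simp_all
    show ?thesis unfolding L nn e[OF a(1) n0(1)] e[OF a(2) n0(2)]
      by (rule ennreal_plus[symmetric]; intro mult_nonneg_nonneg a n0)
  qed
  have bd: "\<bar>\<rho> x * w x\<bar> \<le> 1 / 2 * ((w x)\<^sup>2 * \<rho> x) + 1 / 2 * \<rho> x" for x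
  proof -
    have "\<bar>w x\<bar> \<le> 1 / 2 * ((w x)\<^sup>2 + 1)" using zero_le_power2[of "\<bar>w x\<bar> - 1"] by (simp add: power2_diff)
    hence "\<rho> x * \<bar>w x\<bar> \<le> \<rho> x * (1 / 2 * ((w x)\<^sup>2 + 1))" using p(2) by (rule mult_left_mono)
    thus ?thesis using p(2)[of x] by (simp add: abs_mult algebra_simps)
  qed
  have ib: "integrable lborel (\<lambda>x. 1 / 2 * ((w x)\<^sup>2 * \<rho> x) + 1 / 2 * \<rho> x)" using i1 p(3) by simp
  show i3: "integrable lborel (\<lambda>x. \<rho> x * w x)"
    by (rule Bochner_Integration.integrable_bound[OF ib]) (measurable, use bd in \<open>auto intro!: AE_I2 order_trans[OF bd]\<close>)
  show "(LBINT x. \<rho> x * w x) = 0" by (rule integral_weighted_div_zero[OF \<rho> u w i3])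
  have "(LBINT x. \<bar>\<rho> x * w x\<bar>) \<le> (LBINT x. 1 / 2 * ((w x)\<^sup>2 * \<rho> x) + 1 / 2 * \<rho> x)"
    using bd i3 ib by (intro integral_mono) auto
  also have "\<dots> = 1 / 2 * (LBINT x. (w x)\<^sup>2 * \<rho> x) + 1 / 2" using i1 p(3,4) by simp
  also have "\<dots> \<le> enn2real (lagrangian h \<beta> \<rho> u) + 1"
    unfolding Leq using n0 by (subst enn2real_ennreal) auto
  finally show "(LBINT x. \<bar>\<rho> x * w x\<bar>) \<le> enn2real (lagrangian h \<beta> \<rho> u) + 1" .
qed

text \<open>The weighted divergence has mean zero, so the mean of \<open>h\<close> can be subtracted in the mixed term, and
  the square is complete. After truncation the constant \<open>trunc n (mean h \<rho>)\<close> is subtracted instead, and the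
  Lipschitz property of \<open>trunc n\<close> preserves the inequality.\<close>

lemma lagrangian_completed_square:
  fixes \<rho> :: "'a::euclidean_space \<Rightarrow> real"
  assumes \<rho>: "\<rho> \<in> prob_densities" and u: "u \<in> L2_fields \<rho>" and h: "C2_bounded_hessian h g H" and \<beta>: "\<beta> > 0"
    and fin: "lagrangian h \<beta> \<rho> u < \<infinity>"
  defines "w \<equiv> weighted_div \<rho> u"
  shows "integrable lborel (\<lambda>x. h x * (\<rho> x * w x))"
    and "integrable lborel (\<lambda>x. (w x - \<beta> * (h x - mean h \<rho>))\<^sup>2 * \<rho> x)"
    and "enn2real (lagrangian h \<beta> \<rho> u) - \<beta> * (LBINT x. h x * (\<rho> x * w x))
       = 1 / 2 * (LBINT x. (w x - \<beta> * (h x - mean h \<rho>))\<^sup>2 * \<rho> x)"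
    and "\<beta> * (LBINT x. trunc n (h x) * (\<rho> x * w x)) \<le> enn2real (lagrangian h \<beta> \<rho> u)"
    and "(\<lambda>n. LBINT x. trunc n (h x) * (\<rho> x * w x)) \<longlonglongrightarrow> (LBINT x. h x * (\<rho> x * w x))"
proof -
  note p = prob_densitiesD[OF \<rho>]
  note L = lagrangian_finiteD[OF \<rho> u h \<beta> fin, folded w_def]
  let ?m = "mean h \<rho>"
  have hm [measurable]: "h \<in> borel_measurable borel" by (rule C2_bounded_hessian_measurable[OF h])
  have [measurable]: "w \<in> borel_measurable borel" using L(1) by (simp add: has_weighted_div_def)
  note [measurable] = p(1)
  have tm [measurable]: "(\<lambda>x. trunc n (h x)) \<in> borel_measurable borel" for n by (rule trunc_measurable[OF hm])
  let ?W = "\<integral>x. (w x)\<^sup>2 * \<rho> x \<partial>lborel" and ?S = "\<integral>x. (h x - ?m)\<^sup>2 * \<rho> x \<partial>lborel"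
  have W0: "?W \<ge> 0" "?S \<ge> 0" using p(2) by (intro Bochner_Integration.integral_nonneg; simp)+
  have Lr: "enn2real (lagrangian h \<beta> \<rho> u) = 1 / 2 * ?W + \<beta>\<^sup>2 / 2 * ?S"
    unfolding L(4) using W0 by (intro enn2real_ennreal) auto
  have am: "\<bar>a * b\<bar> \<le> 1 / 2 * (a\<^sup>2 + b\<^sup>2)" for a b :: real
    using zero_le_power2[of "\<bar>a\<bar> - \<bar>b\<bar>"] by (simp add: power2_diff abs_mult)
  have wL: "w \<in> L2_functions \<rho>" using L(2) by (simp add: L2_functions_def)
  have cross: "integrable lborel (\<lambda>x. F x * (\<rho> x * w x))"
    if [measurable]: "F \<in> borel_measurable borel" and F: "integrable lborel (\<lambda>x. (F x)\<^sup>2 * \<rho> x)" for F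
    by (rule L2_product_integrable[OF _ wL p(2,1)]) (use F in \<open>simp add: L2_functions_def\<close>)
  have icc: "integrable lborel (\<lambda>x. (h x - ?m) * (\<rho> x * w x))" using L(3) by (intro cross) simp_all
  have e1: "(\<lambda>x. h x * (\<rho> x * w x)) = (\<lambda>x. (h x - ?m) * (\<rho> x * w x) + ?m * (\<rho> x * w x))"
    by (simp add: algebra_simps)
  show ihw: "integrable lborel (\<lambda>x. h x * (\<rho> x * w x))" unfolding e1 using icc L(5) by simp
  have hw: "(LBINT x. h x * (\<rho> x * w x)) = (LBINT x. (h x - ?m) * (\<rho> x * w x))"
    unfolding e1 using icc L(5,6) by simp
  have sq: "(\<lambda>x. (w x - \<beta> * (h x - ?m))\<^sup>2 * \<rho> x)
     = (\<lambda>x. (w x)\<^sup>2 * \<rho> x + \<beta>\<^sup>2 * ((h x - ?m)\<^sup>2 * \<rho> x) - 2 * \<beta> * ((h x - ?m) * (\<rho> x * w x)))"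
    by (simp add: fun_eq_iff power2_eq_square algebra_simps)
  show "integrable lborel (\<lambda>x. (w x - \<beta> * (h x - ?m))\<^sup>2 * \<rho> x)"
    unfolding sq using L(2,3) icc by simp
  have "(LBINT x. (w x - \<beta> * (h x - ?m))\<^sup>2 * \<rho> x) = ?W + \<beta>\<^sup>2 * ?S - 2 * \<beta> * (LBINT x. h x * (\<rho> x * w x))"
    unfolding sq hw using L(2,3) icc by simp
  thus "enn2real (lagrangian h \<beta> \<rho> u) - \<beta> * (LBINT x. h x * (\<rho> x * w x))
       = 1 / 2 * (LBINT x. (w x - \<beta> * (h x - ?m))\<^sup>2 * \<rho> x)"
    unfolding Lr by (simp add: field_simps)
  show "(\<lambda>n. LBINT x. trunc n (h x) * (\<rho> x * w x)) \<longlonglongrightarrow> (LBINT x. h x * (\<rho> x * w x))"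
    by (rule trunc_integral_tendsto[OF ihw]) measurable
  show "\<beta> * (LBINT x. trunc n (h x) * (\<rho> x * w x)) \<le> enn2real (lagrangian h \<beta> \<rho> u)"
  proof -
    let ?F = "\<lambda>x. trunc n (h x) - trunc n ?m"
    have F2: "(?F x)\<^sup>2 \<le> (h x - ?m)\<^sup>2" for x using trunc_lipschitz[of n "h x" ?m] by (simp add: abs_le_square_iff)
    have iF: "integrable lborel (\<lambda>x. (?F x)\<^sup>2 * \<rho> x)"
      by (rule Bochner_Integration.integrable_bound[OF L(3)])
         (measurable, use F2 p(2) in \<open>auto simp: abs_mult intro!: AE_I2 mult_right_mono\<close>)
    have Fm: "?F \<in> borel_measurable borel" by measurable
    have icF: "integrable lborel (\<lambda>x. ?F x * (\<rho> x * w x))" by (rule cross[OF Fm iF])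
    have e2: "(\<lambda>x. trunc n (h x) * (\<rho> x * w x)) = (\<lambda>x. ?F x * (\<rho> x * w x) + trunc n ?m * (\<rho> x * w x))"
      by (simp add: algebra_simps)
    have "\<beta> * (LBINT x. trunc n (h x) * (\<rho> x * w x)) = (LBINT x. \<beta> * (?F x * (\<rho> x * w x)))"
      unfolding e2 using icF L(5,6) by simp
    also have "\<dots> \<le> (LBINT x. 1 / 2 * ((w x)\<^sup>2 * \<rho> x) + \<beta>\<^sup>2 / 2 * ((h x - ?m)\<^sup>2 * \<rho> x))"
    proof (rule integral_mono)
      show "integrable lborel (\<lambda>x. \<beta> * (?F x * (\<rho> x * w x)))" using icF by simp
      show "integrable lborel (\<lambda>x. 1 / 2 * ((w x)\<^sup>2 * \<rho> x) + \<beta>\<^sup>2 / 2 * ((h x - ?m)\<^sup>2 * \<rho> x))" using L(2,3) by simp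
      have distr: "(1 / 2 * a + b / 2 * c) * d = 1 / 2 * (a * d) + b / 2 * (c * d)" for a b c d :: real
        by (simp add: algebra_simps)
      fix x
      have "\<beta> * ?F x * w x \<le> 1 / 2 * ((\<beta> * ?F x)\<^sup>2 + (w x)\<^sup>2)" using am[of "\<beta> * ?F x" "w x"] by linarith
      also have "\<dots> \<le> 1 / 2 * (w x)\<^sup>2 + \<beta>\<^sup>2 / 2 * (h x - ?m)\<^sup>2"
        using mult_left_mono[OF F2[of x], of "\<beta>\<^sup>2 / 2"] by (simp add: power_mult_distrib distrib_left)
      finally have "\<beta> * ?F x * w x * \<rho> x \<le> (1 / 2 * (w x)\<^sup>2 + \<beta>\<^sup>2 / 2 * (h x - ?m)\<^sup>2) * \<rho> x"
        using p(2) by (rule mult_right_mono)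
      thus "\<beta> * (?F x * (\<rho> x * w x)) \<le> 1 / 2 * ((w x)\<^sup>2 * \<rho> x) + \<beta>\<^sup>2 / 2 * ((h x - ?m)\<^sup>2 * \<rho> x)"
        unfolding distr by (simp only: mult_ac)
    qed
    also have "\<dots> = enn2real (lagrangian h \<beta> \<rho> u)" unfolding Lr using L(2,3) by simp
    finally show ?thesis .
  qed
qed

lemma control_pde_if_weighted_div_eq:
  fixes \<rho> :: "'a::euclidean_space \<Rightarrow> real"
  assumes \<rho>: "\<rho> \<in> prob_densities" and h: "C2_bounded_hessian h g H"
    and w: "has_weighted_div \<rho> u w" and ae: "AE x in lborel. (w x - \<beta> * (h x - mean h \<rho>))\<^sup>2 * \<rho> x = 0"
  shows "control_pde h \<beta> \<rho> u"
proof -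
  note [measurable] = C2_bounded_hessian_measurable[OF h] prob_densitiesD(1)[OF \<rho>]
  have [measurable]: "w \<in> borel_measurable borel" using w by (simp add: has_weighted_div_def)
  let ?v = "\<lambda>x. \<beta> * (h x - mean h \<rho>)"
  have ae': "AE x in lborel. \<rho> x * w x = \<rho> x * ?v x" using ae by eventually_elim auto
  show ?thesis unfolding control_pde_def has_weighted_div_def has_weak_divergence_def
  proof (intro conjI allI impI)
    fix \<phi> and \<phi>' :: "'a \<Rightarrow> 'a" assume test: "test_function \<phi> \<phi>'"
    note [measurable] = test_function_measurable(1)[OF test]
    have *: "integrable lborel (\<lambda>x. \<phi>' x \<bullet> (\<rho> x *\<^sub>R u x))" "integrable lborel (\<lambda>x. \<phi> x * (\<rho> x * w x))"
      "(LBINT x. \<phi>' x \<bullet> (\<rho> x *\<^sub>R u x)) = - (LBINT x. \<phi> x * (\<rho> x * w x))"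
      using w test unfolding has_weighted_div_def has_weak_divergence_def by blast+
    show "integrable lborel (\<lambda>x. \<phi>' x \<bullet> (\<rho> x *\<^sub>R u x))" by (rule *)
    have aeq: "AE x in lborel. \<phi> x * (\<rho> x * w x) = \<phi> x * (\<rho> x * ?v x)" using ae' by eventually_elim simp
    show "integrable lborel (\<lambda>x. \<phi> x * (\<rho> x * ?v x))"
      using *(2) by (rule integrable_cong_AE_imp) (use aeq in \<open>auto elim!: eventually_mono\<close>)
    have "(LBINT x. \<phi> x * (\<rho> x * w x)) = (LBINT x. \<phi> x * (\<rho> x * ?v x))"
      by (rule integral_cong_AE) (use aeq in auto)
    thus "(LBINT x. \<phi>' x \<bullet> (\<rho> x *\<^sub>R u x)) = - (LBINT x. \<phi> x * (\<rho> x * ?v x))" using *(3) by simp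
  qed measurable
qed

lemma trunc_along_path:
  fixes r :: "real \<Rightarrow> 'a::euclidean_space \<Rightarrow> real"
  assumes path: "continuity_path t T r u" and le: "t \<le> T"
    and div: "AE s\<in>{t..T} in lborel. has_weighted_div (r s) (u s) (w s)
        \<and> integrable lborel (\<lambda>x. r s x * w s x) \<and> (LBINT x. \<bar>r s x * w s x\<bar>) \<le> G s"
    and G: "set_integrable lborel {t..T} G"
    and h: "C2_bounded_hessian h g H"
  shows "\<exists>D. \<forall>n. set_integrable lborel {t..T} (D n) \<and>
    (AE s\<in>{t..T} in lborel. D n s = (LBINT x. trunc n (h x) * (r s x * w s x))) \<and>
    (LBINT x. trunc n (h x) * r t x) - (LBINT x. trunc n (h x) * r T x) = (LINT s:{t..T}|lborel. D n s)"
proof -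
  show ?thesis
  proof (intro choice allI)
    fix n
    show "\<exists>D. set_integrable lborel {t..T} D \<and>
      (AE s\<in>{t..T} in lborel. D s = (LBINT x. trunc n (h x) * (r s x * w s x))) \<and>
      (LBINT x. trunc n (h x) * r t x) - (LBINT x. trunc n (h x) * r T x) = (LINT s:{t..T}|lborel. D s)"
      by (rule bounded_C1_along_path[OF path le div G GDERIV_trunc(1)[OF h] GDERIV_trunc(2)[OF h] trunc_bounded, of n])
         (intro exI conjI; assumption)
  qed
qed

text \<open>The gap between the running cost and the truncated mixed term is nonnegative at almost every time, and
  its integral converges to the total gap. If the total gap is zero, Fatou's lemma makes the pointwise limit, half
  the integral of the completed square, vanish at almost every time.\<close>

lemma running_cost_bound:
  fixes h :: "'a::euclidean_space \<Rightarrow> real"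
  assumes adm: "admissible_pair h \<beta> t T \<rho> r u" and le: "t \<le> T" and h: "C2_bounded_hessian h g H" and \<beta>: "\<beta> > 0"
    and fin: "(\<integral>\<^sup>+s. lagrangian h \<beta> (r s) (u s) * indicator {t..T} s \<partial>lborel) < \<infinity>"
  defines "J \<equiv> enn2real (\<integral>\<^sup>+s. lagrangian h \<beta> (r s) (u s) * indicator {t..T} s \<partial>lborel)"
  shows "\<beta> * ((LBINT x. h x * r t x) - (LBINT x. h x * r T x)) \<le> J"
    and "\<beta> * ((LBINT x. h x * r t x) - (LBINT x. h x * r T x)) = J \<Longrightarrow>
      AE s\<in>{t..T} in lborel. control_pde h \<beta> (r s) (u s)"
proof -
  have path: "continuity_path t T r u" and Lm: "(\<lambda>s. lagrangian h \<beta> (r s) (u s) * indicator {t..T} s) \<in> borel_measurable borel"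
    using adm by (auto simp: admissible_pair_def)
  have rp: "r s \<in> prob_densities" and ru: "u s \<in> L2_fields (r s)" if "s \<in> {t..T}" for s
    using path that by (auto simp: continuity_path_def)
  note [measurable] = Lm
  define \<Lambda> where "\<Lambda> s = lagrangian h \<beta> (r s) (u s) * indicator {t..T} s" for s
  have [measurable]: "\<Lambda> \<in> borel_measurable borel" unfolding \<Lambda>_def by measurable
  have \<Lambda>fin: "(\<integral>\<^sup>+s. \<Lambda> s \<partial>lborel) < \<infinity>" using fin by (simp add: \<Lambda>_def)
  hence AEfin: "AE s in lborel. \<Lambda> s \<noteq> \<infinity>" by (intro nn_integral_noteq_infinite) auto
  define l where "l s = enn2real (\<Lambda> s)" for s
  have [measurable]: "l \<in> borel_measurable borel" unfolding l_def by measurable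
  have nl: "(\<integral>\<^sup>+s. ennreal (l s) \<partial>lborel) = (\<integral>\<^sup>+s. \<Lambda> s \<partial>lborel)"
    by (rule nn_integral_cong_AE) (use AEfin in \<open>auto simp: l_def less_top elim!: eventually_mono\<close>)
  have l0: "l s \<ge> 0" for s by (simp add: l_def)
  have il: "integrable lborel l" using nl \<Lambda>fin l0 by (intro integrableI_nonneg) auto
  have Jl: "J = (LBINT s. l s)"
    unfolding J_def \<Lambda>_def[symmetric] nl[symmetric] using il l0 by (subst nn_integral_eq_integral) auto
  define w where "w s = weighted_div (r s) (u s)" for s
  have Lfin: "AE s\<in>{t..T} in lborel. lagrangian h \<beta> (r s) (u s) < \<infinity> \<and> l s = enn2real (lagrangian h \<beta> (r s) (u s))"
    using AEfin by eventually_elim (auto simp: \<Lambda>_def l_def less_top)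
  have div: "AE s\<in>{t..T} in lborel. has_weighted_div (r s) (u s) (w s)
        \<and> integrable lborel (\<lambda>x. r s x * w s x) \<and> (LBINT x. \<bar>r s x * w s x\<bar>) \<le> l s + 1"
    using Lfin
  proof eventually_elim
    case (elim s)
    show ?case
    proof
      assume s: "s \<in> {t..T}"
      note D = lagrangian_finiteD[OF rp[OF s] ru[OF s] h \<beta>, folded w_def]
      show "has_weighted_div (r s) (u s) (w s) \<and> integrable lborel (\<lambda>x. r s x * w s x) \<and> (LBINT x. \<bar>r s x * w s x\<bar>) \<le> l s + 1"
        using D(1,5,7) elim s by auto
    qed
  qed
  have G: "set_integrable lborel {t..T} (\<lambda>s. l s + 1)"
  proof (rule set_integral_add(1))
    show "set_integrable lborel {t..T} l"
      unfolding set_integrable_def by (intro integrable_mult_indicator il) auto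
    have "integrable lborel (\<lambda>s. indicator {t..T} s *\<^sub>R (1::real))"
      by (intro integrable_indicator) (use le in auto)
    thus "set_integrable lborel {t..T} (\<lambda>s. 1::real)" by (simp add: set_integrable_def)
  qed
  obtain D where D0: "\<forall>n. set_integrable lborel {t..T} (D n) \<and>
      (AE s\<in>{t..T} in lborel. D n s = (LBINT x. trunc n (h x) * (r s x * w s x))) \<and>
      (LBINT x. trunc n (h x) * r t x) - (LBINT x. trunc n (h x) * r T x) = (LINT s:{t..T}|lborel. D n s)"
    using trunc_along_path[OF path le div G h] by (rule exE)
  note D = D0[THEN spec, THEN conjunct1] D0[THEN spec, THEN conjunct2, THEN conjunct1]
    D0[THEN spec, THEN conjunct2, THEN conjunct2]
  define e where "e n s = l s - \<beta> * (indicator {t..T} s *\<^sub>R D n s)" for n s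
  have iD: "integrable lborel (\<lambda>s. indicator {t..T} s *\<^sub>R D n s)" for n using D(1) by (simp add: set_integrable_def)
  have ie: "integrable lborel (e n)" for n unfolding e_def [abs_def] using iD[of n] il by simp
  hence [measurable]: "e n \<in> borel_measurable borel" for n by (simp add: integrable_iff_bounded)
  have l_out: "l s = 0" if "s \<notin> {t..T}" for s using that by (simp add: l_def \<Lambda>_def)
  have int_e: "(LBINT s. e n s) = J - \<beta> * ((LBINT x. trunc n (h x) * r t x) - (LBINT x. trunc n (h x) * r T x))" for n
    unfolding e_def D(3) set_lebesgue_integral_def Jl using iD[of n] il by simp
  have lim: "(\<lambda>n. LBINT s. e n s) \<longlonglongrightarrow> J - \<beta> * ((LBINT x. h x * r t x) - (LBINT x. h x * r T x))"
    unfolding int_e by (intro tendsto_intros trunc_mean_tendsto[OF rp h]) (use le in auto)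
  have AED: "AE s in lborel. \<forall>n. s \<in> {t..T} \<longrightarrow> D n s = (LBINT x. trunc n (h x) * (r s x * w s x))"
    unfolding AE_all_countable by (intro allI D(2))
  have e0: "AE s in lborel. \<forall>n. 0 \<le> e n s"
    using Lfin AED
  proof eventually_elim
    case (elim s)
    show ?case
    proof (cases "s \<in> {t..T}")
      case True
      have "\<beta> * (LBINT x. trunc n (h x) * (r s x * w s x)) \<le> l s" for n
        using lagrangian_completed_square(4)[OF rp[OF True] ru[OF True] h \<beta>, folded w_def] elim(1) True by auto
      thus ?thesis using True elim(2) by (simp add: e_def)
    qed (simp add: e_def l_out)
  qed
  have "0 \<le> (LBINT s. e n s)" for n
    using e0 by (intro integral_nonneg_AE) (auto elim: eventually_mono)
  hence "0 \<le> J - \<beta> * ((LBINT x. h x * r t x) - (LBINT x. h x * r T x))"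
    by (intro LIMSEQ_le_const[OF lim]) auto
  thus "\<beta> * ((LBINT x. h x * r t x) - (LBINT x. h x * r T x)) \<le> J" by simp
  assume eqJ: "\<beta> * ((LBINT x. h x * r t x) - (LBINT x. h x * r T x)) = J"
  have "(\<integral>\<^sup>+s. liminf (\<lambda>n. ennreal (e n s)) \<partial>lborel) \<le> liminf (\<lambda>n. \<integral>\<^sup>+s. ennreal (e n s) \<partial>lborel)"
    by (rule nn_integral_liminf) measurable
  also have "(\<lambda>n. \<integral>\<^sup>+s. ennreal (e n s) \<partial>lborel) = (\<lambda>n. ennreal (LBINT s. e n s))"
    using e0 ie by (intro ext nn_integral_eq_integral) (auto elim: eventually_mono)
  also have "liminf (\<lambda>n. ennreal (LBINT s. e n s)) = ennreal 0"
    using lim eqJ by (intro lim_imp_Liminf tendsto_ennrealI) auto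
  finally have "(\<integral>\<^sup>+s. liminf (\<lambda>n. ennreal (e n s)) \<partial>lborel) = 0" by simp
  hence "AE s in lborel. liminf (\<lambda>n. ennreal (e n s)) = 0"
    by (subst (asm) nn_integral_0_iff_AE) auto
  thus "AE s\<in>{t..T} in lborel. control_pde h \<beta> (r s) (u s)"
    using Lfin AED
  proof eventually_elim
    case (elim s)
    show ?case
    proof
      assume s: "s \<in> {t..T}"
      have fin: "lagrangian h \<beta> (r s) (u s) < \<infinity>" using elim(2) s by simp
      note C = lagrangian_completed_square[OF rp[OF s] ru[OF s] h \<beta> fin, folded w_def]
      let ?Q = "\<integral>x. (w s x - \<beta> * (h x - mean h (r s)))\<^sup>2 * r s x \<partial>lborel"
      have "(\<lambda>n. e n s) = (\<lambda>n. enn2real (lagrangian h \<beta> (r s) (u s)) - \<beta> * (LBINT x. trunc n (h x) * (r s x * w s x)))"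
        using elim(2,3) s by (simp add: e_def)
      moreover have "\<dots> \<longlonglongrightarrow> enn2real (lagrangian h \<beta> (r s) (u s)) - \<beta> * (LBINT x. h x * (r s x * w s x))"
        by (intro tendsto_intros C(5))
      ultimately have "(\<lambda>n. e n s) \<longlonglongrightarrow> 1 / 2 * ?Q" unfolding C(3) by simp
      hence "liminf (\<lambda>n. ennreal (e n s)) = ennreal (1 / 2 * ?Q)"
        by (intro lim_imp_Liminf tendsto_ennrealI) auto
      hence "ennreal (1 / 2 * ?Q) = 0" using elim(1) by simp
      hence "?Q \<le> 0" by (simp add: ennreal_eq_0_iff)
      moreover have nn: "(w s x - \<beta> * (h x - mean h (r s)))\<^sup>2 * r s x \<ge> 0" for x
        using prob_densitiesD(2)[OF rp[OF s]] by simp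
      ultimately have "?Q = 0" by (meson Bochner_Integration.integral_nonneg order_antisym)
      hence "AE x in lborel. (w s x - \<beta> * (h x - mean h (r s)))\<^sup>2 * r s x = 0"
        using integral_nonneg_eq_0_iff_AE[OF C(2)] nn by blast
      thus "control_pde h \<beta> (r s) (u s)"
        using lagrangian_finiteD(1)[OF rp[OF s] ru[OF s] h \<beta> fin, folded w_def]
        by (intro control_pde_if_weighted_div_eq[OF rp[OF s] h])
    qed
  qed
qed

section \<open>Paths driven by the control equation\<close>

lemma set_integral_initial_segment_tendsto:
  fixes f :: "real \<Rightarrow> real"
  assumes f: "set_integrable lborel {a..b} f" and X: "\<And>k. X k \<in> {a..b}" and lim: "X \<longlonglongrightarrow> x" and x: "x \<in> {a..b}"
  shows "(\<lambda>k. LINT \<tau>:{a..X k}|lborel. f \<tau>) \<longlonglongrightarrow> (LINT \<tau>:{a..x}|lborel. f \<tau>)"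
proof -
  let ?f = "\<lambda>\<tau>. indicator {a..b} \<tau> *\<^sub>R f \<tau>"
  have intf: "integrable lborel ?f" using f by (simp add: set_integrable_def)
  hence fm [measurable]: "?f \<in> borel_measurable borel" by (simp add: integrable_iff_bounded)
  have e: "indicator {a..y} \<tau> *\<^sub>R f \<tau> = indicator {a..y} \<tau> * ?f \<tau>" if "y \<in> {a..b}" for y \<tau>
    using that by (auto simp: indicator_def)
  have "(\<lambda>k. \<integral>\<tau>. indicator {a..X k} \<tau> * ?f \<tau> \<partial>lborel) \<longlonglongrightarrow> (\<integral>\<tau>. indicator {a..x} \<tau> * ?f \<tau> \<partial>lborel)"
  proof (rule integral_dominated_convergence[where w = "\<lambda>\<tau>. \<bar>?f \<tau>\<bar>"])
    show "(\<lambda>\<tau>. indicator {a..x} \<tau> * ?f \<tau>) \<in> borel_measurable lborel" by measurable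
    show "(\<lambda>\<tau>. indicator {a..X k} \<tau> * ?f \<tau>) \<in> borel_measurable lborel" for k by measurable
    show "integrable lborel (\<lambda>\<tau>. \<bar>?f \<tau>\<bar>)" using intf by (rule integrable_abs)
    have "AE \<tau> in lborel. \<tau> \<noteq> x" by (rule AE_lborel_singleton)
    thus "AE \<tau> in lborel. (\<lambda>k. indicator {a..X k} \<tau> * ?f \<tau>) \<longlonglongrightarrow> indicator {a..x} \<tau> * ?f \<tau>"
    proof eventually_elim
      case (elim \<tau>)
      have "eventually (\<lambda>k. indicator {a..X k} \<tau> = (indicator {a..x} \<tau> :: real)) sequentially"
      proof (cases "\<tau> < x")
        case True
        from order_tendstoD(1)[OF lim this] show ?thesis
          by eventually_elim (use True in \<open>auto simp: indicator_def\<close>)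
      next
        case False
        hence "x < \<tau>" using elim by simp
        from order_tendstoD(2)[OF lim this] show ?thesis
          by eventually_elim (use False elim in \<open>auto simp: indicator_def\<close>)
      qed
      hence "(\<lambda>k. indicator {a..X k} \<tau>) \<longlonglongrightarrow> (indicator {a..x} \<tau> :: real)" by (rule tendsto_eventually)
      thus ?case by (intro tendsto_intros)
    qed
    show "AE \<tau> in lborel. norm (indicator {a..X k} \<tau> * ?f \<tau>) \<le> \<bar>?f \<tau>\<bar>" for k
      by (intro AE_I2) (auto simp: indicator_def)
  qed
  thus ?thesis unfolding set_lebesgue_integral_def e[OF X] e[OF x] .
qed

text \<open>Dini's argument: the mass retained by the \<open>n\<close>-th cutoff is continuous in time, increases with \<open>n\<close>
  and tends to one at each time, so on a compact interval one cutoff retains half of the mass throughout.\<close>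

lemma continuity_path_tight:
  fixes r :: "real \<Rightarrow> 'a::euclidean_space \<Rightarrow> real"
  assumes path: "continuity_path t T r u"
  obtains n where "\<And>s. s \<in> {t..T} \<Longrightarrow> 1 / 2 \<le> (LBINT x. cutoff n x * r s x)"
proof (rule ccontr)
  assume "\<not> thesis"
  hence "\<forall>n. \<exists>s. s \<in> {t..T} \<and> (LBINT x. cutoff n x * r s x) < 1 / 2"
    using that by (meson not_less)
  then obtain S where S: "\<And>n. S n \<in> {t..T}" "\<And>n. (LBINT x. cutoff n x * r (S n) x) < 1 / 2" by metis
  have rp: "r s \<in> prob_densities" if "s \<in> {t..T}" for s using path that by (auto simp: continuity_path_def)
  obtain x \<sigma> where x: "x \<in> {t..T}" and \<sigma>: "strict_mono \<sigma>" and lim: "(S \<circ> \<sigma>) \<longlonglongrightarrow> x"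
    using compact_Icc[of t T] S(1) unfolding compact_def by metis
  have cint: "integrable lborel (\<lambda>x. cutoff m x * r s x)" if "s \<in> {t..T}" for m s
    by (rule prob_integrable_bounded[OF rp[OF that] cutoff_measurable abs_cutoff_le])
  have le: "(LBINT y. cutoff m y * r x y) \<le> 1 / 2" for m
  proof (rule LIMSEQ_le_const2)
    let ?f = "\<lambda>\<tau>. \<integral>x. cutoff_gradient m x \<bullet> (r \<tau> x *\<^sub>R u \<tau> x) \<partial>lborel"
    have P: "set_integrable lborel {t..T} ?f \<and> (\<forall>s\<in>{t..T}. (LBINT x. cutoff m x * r s x) - (LBINT x. cutoff m x * r t x)
        = (LINT \<tau>:{t..s}|lborel. ?f \<tau>))"
      using path test_function_cutoff[of m] unfolding continuity_path_def by blast
    hence si: "set_integrable lborel {t..T} ?f" by (rule conjunct1)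
    have eq: "(LBINT x. cutoff m x * r s x) = (LBINT x. cutoff m x * r t x) + (LINT \<tau>:{t..s}|lborel. ?f \<tau>)"
      if "s \<in> {t..T}" for s
      using P[THEN conjunct2, THEN bspec, OF that] by linarith
    have "(\<lambda>k. (LBINT x. cutoff m x * r t x) + (LINT \<tau>:{t..(S \<circ> \<sigma>) k}|lborel. ?f \<tau>))
        \<longlonglongrightarrow> (LBINT x. cutoff m x * r t x) + (LINT \<tau>:{t..x}|lborel. ?f \<tau>)"
      using S(1) by (intro tendsto_add tendsto_const set_integral_initial_segment_tendsto[OF si _ lim x]) auto
    thus "(\<lambda>k. LBINT y. cutoff m y * r ((S \<circ> \<sigma>) k) y) \<longlonglongrightarrow> (LBINT y. cutoff m y * r x y)"
      using eq[OF x] eq[OF S(1)] by simp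
    have "(LBINT y. cutoff m y * r ((S \<circ> \<sigma>) k) y) \<le> 1 / 2" if "k \<ge> m" for k
    proof -
      have "m \<le> \<sigma> k" using that seq_suble[OF \<sigma>, of k] by simp
      have "(LBINT y. cutoff m y * r ((S \<circ> \<sigma>) k) y) \<le> (LBINT y. cutoff (\<sigma> k) y * r (S (\<sigma> k)) y)"
        unfolding o_def
        by (intro integral_mono cint S(1) mult_right_mono cutoff_mono \<open>m \<le> \<sigma> k\<close> prob_densitiesD(2)[OF rp[OF S(1)]])
      thus ?thesis using S(2)[of "\<sigma> k"] by linarith
    qed
    thus "\<exists>N. \<forall>k\<ge>N. (LBINT y. cutoff m y * r ((S \<circ> \<sigma>) k) y) \<le> 1 / 2" by blast
  qed
  have "(LBINT y. r x y) \<le> 1 / 2" using cutoff_integral_tendsto[OF prob_densitiesD(3)[OF rp[OF x]]] by (rule LIMSEQ_le_const2) (use le in blast)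
  thus False using prob_densitiesD(4)[OF rp[OF x]] by simp
qed

text \<open>By uniqueness of the weighted divergence the two terms of the Lagrangian are equal.\<close>

lemma lagrangian_control_pde:
  fixes \<rho> :: "'a::euclidean_space \<Rightarrow> real"
  assumes \<rho>: "\<rho> \<in> prob_densities" and h: "C2_bounded_hessian h g H" and c: "control_pde h \<beta> \<rho> u"
  shows "lagrangian h \<beta> \<rho> u = ennreal (\<beta>\<^sup>2) * (\<integral>\<^sup>+x. ennreal ((h x - mean h \<rho>)\<^sup>2 * \<rho> x) \<partial>lborel)"
    and "AE x in lborel. \<rho> x * weighted_div \<rho> u x = \<rho> x * (\<beta> * (h x - mean h \<rho>))"
proof -
  let ?v = "\<lambda>x. \<beta> * (h x - mean h \<rho>)" and ?w = "weighted_div \<rho> u"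
  have v: "has_weighted_div \<rho> u ?v" using c by (simp add: control_pde_def)
  hence ex: "\<exists>w. has_weighted_div \<rho> u w" by blast
  have w: "has_weighted_div \<rho> u ?w" unfolding weighted_div_def using ex by (rule someI_ex)
  show ae: "AE x in lborel. \<rho> x * ?w x = \<rho> x * ?v x" by (rule weighted_div_unique[OF w v])
  note [measurable] = C2_bounded_hessian_measurable[OF h] prob_densitiesD(1)[OF \<rho>]
  let ?X = "\<integral>\<^sup>+x. ennreal ((h x - mean h \<rho>)\<^sup>2 * \<rho> x) \<partial>lborel"
  have "(\<integral>\<^sup>+x. ennreal ((?w x)\<^sup>2 * \<rho> x) \<partial>lborel) = (\<integral>\<^sup>+x. ennreal (\<beta>\<^sup>2) * ennreal ((h x - mean h \<rho>)\<^sup>2 * \<rho> x) \<partial>lborel)"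
  proof (rule nn_integral_cong_AE)
    show "AE x in lborel. ennreal ((?w x)\<^sup>2 * \<rho> x) = ennreal (\<beta>\<^sup>2) * ennreal ((h x - mean h \<rho>)\<^sup>2 * \<rho> x)"
      using ae
    proof eventually_elim
      case (elim x)
      have "(?w x)\<^sup>2 * \<rho> x = \<beta>\<^sup>2 * ((h x - mean h \<rho>)\<^sup>2 * \<rho> x)"
        using elim by (cases "\<rho> x = 0") (auto simp: power_mult_distrib)
      thus ?case by (metis ennreal_mult' zero_le_power2)
    qed
  qed
  also have "\<dots> = ennreal (\<beta>\<^sup>2) * ?X" by (rule nn_integral_cmult) measurable
  finally have W: "(\<integral>\<^sup>+x. ennreal ((?w x)\<^sup>2 * \<rho> x) \<partial>lborel) = ennreal (\<beta>\<^sup>2) * ?X" .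
  have "lagrangian h \<beta> \<rho> u = ennreal (1 / 2) * (ennreal (\<beta>\<^sup>2) * ?X) + ennreal (\<beta>\<^sup>2 / 2) * ?X"
    using ex unfolding lagrangian_def W by simp
  also have "ennreal (1 / 2) * (ennreal (\<beta>\<^sup>2) * ?X) = ennreal (\<beta>\<^sup>2 / 2) * ?X"
    unfolding mult.assoc[symmetric] by (subst ennreal_mult[symmetric]) auto
  also have "ennreal (\<beta>\<^sup>2 / 2) * ?X + ennreal (\<beta>\<^sup>2 / 2) * ?X = ennreal (\<beta>\<^sup>2) * ?X"
    unfolding distrib_right[symmetric] by (subst ennreal_plus[symmetric]) auto
  finally show "lagrangian h \<beta> \<rho> u = ennreal (\<beta>\<^sup>2) * ?X" .
qed

text \<open>The total cost might be infinite, and the mean of \<open>h\<close> might not be integrable in time. The equation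
  excludes this: paired with the gradient of a cutoff that keeps half of the mass, the momentum yields
  \<open>\<beta> * (mean h (r s) - hmin)\<close> times this mass, up to a bounded term, and this pairing is integrable in time by the
  definition of a path. The resulting majorant allows truncations of \<open>h\<close> to be tested. Their covariances with \<open>h\<close>
  are nonnegative and converge to the variance, so Fatou's lemma in space and in time bounds the cost.\<close>

lemma running_cost_of_control_pde:
  fixes h :: "'a::euclidean_space \<Rightarrow> real"
  assumes path: "continuity_path t T r u" and le: "t \<le> T" and h: "C2_bounded_hessian h g H" and \<beta>: "\<beta> > 0"
    and bdd: "\<And>x. hmin \<le> h x"
    and pde: "AE s\<in>{t..T} in lborel. control_pde h \<beta> (r s) (u s)"
  shows "(\<integral>\<^sup>+s. lagrangian h \<beta> (r s) (u s) * indicator {t..T} s \<partial>lborel)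
     \<le> ennreal (\<beta> * ((LBINT x. h x * r t x) - (LBINT x. h x * r T x)))"
    and "0 \<le> \<beta> * ((LBINT x. h x * r t x) - (LBINT x. h x * r T x))"
proof -
  have rp: "r s \<in> prob_densities" if "s \<in> {t..T}" for s using path that by (auto simp: continuity_path_def)
  have hm [measurable]: "h \<in> borel_measurable borel" by (rule C2_bounded_hessian_measurable[OF h])
  define w where "w s x = \<beta> * (h x - mean h (r s))" for s x
  obtain n where n: "\<And>s. s \<in> {t..T} \<Longrightarrow> 1 / 2 \<le> (LBINT x. cutoff n x * r s x)"
    using continuity_path_tight[OF path] by blast
  have hd: "\<And>x. GDERIV (\<lambda>x. h x - hmin) x :> g x" and hc: "continuous_on UNIV g"
    using h C2_bounded_hessian_continuous[OF h] by (auto simp: C2_bounded_hessian_def gderiv_def intro!: derivative_eq_intros)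
  obtain C where C: "C \<ge> 0" "\<And>x. \<bar>cutoff n x * (h x - hmin)\<bar> \<le> C"
    using test_function_bounded[OF test_function_cutoff_mult[OF hd hc, of n]] by metis
  define d where "d s = (LBINT x. cutoff_gradient n x \<bullet> (r s x *\<^sub>R u s x))" for s
  have id: "set_integrable lborel {t..T} d"
    using path test_function_cutoff[of n] unfolding continuity_path_def d_def [abs_def] by blast
  (* Twice the bound on \<beta> (mean h (r s) - hmin) derived below; the factor comes from bounding
     \<bar>h - mean\<bar> by (h - hmin) + (mean - hmin). *)
  define G where "G s = 4 * \<bar>d s\<bar> + 4 * \<beta> * C" for s
  have iG: "set_integrable lborel {t..T} G"
    unfolding G_def
  proof (rule set_integral_add(1))
    show "set_integrable lborel {t..T} (\<lambda>s. 4 * \<bar>d s\<bar>)" using set_integrable_abs[OF id] by simp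
    have "integrable lborel (\<lambda>s. indicator {t..T} s *\<^sub>R (4 * \<beta> * C))"
      by (intro integrable_indicator) (use le in auto)
    thus "set_integrable lborel {t..T} (\<lambda>s. 4 * \<beta> * C)" by (simp add: set_integrable_def)
  qed
  have div: "AE s\<in>{t..T} in lborel. has_weighted_div (r s) (u s) (w s)
        \<and> integrable lborel (\<lambda>x. r s x * w s x) \<and> (LBINT x. \<bar>r s x * w s x\<bar>) \<le> G s"
    using pde
  proof eventually_elim
    case (elim s)
    show ?case
    proof
      assume s: "s \<in> {t..T}"
      note p = prob_densitiesD[OF rp[OF s]]
      note [measurable] = p(1)
      let ?m = "mean h (r s)"
      have wd: "has_weighted_div (r s) (u s) (w s)"
        using elim s unfolding control_pde_def w_def [abs_def] by simp
      have ihr: "integrable lborel (\<lambda>x. h x * r s x)" by (rule prob_integrable_C2[OF rp[OF s] h])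
      have e: "(\<lambda>x. r s x * w s x) = (\<lambda>x. \<beta> * (r s x * (h x - ?m)))" by (simp add: w_def mult_ac)
      have iw: "integrable lborel (\<lambda>x. r s x * w s x)" unfolding e using integral_centered(1)[OF rp[OF s] h] by simp
      have ih: "integrable lborel (\<lambda>x. (h x - hmin) * r s x)"
        using ihr p(3) by (simp add: left_diff_distrib)
      have ihm: "(LBINT x. (h x - hmin) * r s x) = ?m - hmin"
        using ihr p(3,4) by (simp add: left_diff_distrib mean_def)
      have m0: "?m - hmin \<ge> 0" unfolding ihm[symmetric] using bdd p(2) by (intro Bochner_Integration.integral_nonneg) simp
      have ic: "integrable lborel (\<lambda>x. cutoff n x * r s x)"
        by (rule prob_integrable_bounded[OF rp[OF s] cutoff_measurable abs_cutoff_le])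
      have ich: "integrable lborel (\<lambda>x. (cutoff n x * (h x - hmin)) * r s x)"
        by (rule prob_integrable_bounded[OF rp[OF s] _ C(2)]) (use cutoff_measurable in measurable)
      have "d s = - (LBINT x. cutoff n x * (r s x * w s x))"
        using wd test_function_cutoff[of n] unfolding d_def has_weighted_div_def has_weak_divergence_def by blast
      also have "(\<lambda>x. cutoff n x * (r s x * w s x)) = (\<lambda>x. \<beta> * ((cutoff n x * (h x - hmin)) * r s x) - \<beta> * (?m - hmin) * (cutoff n x * r s x))"
        by (simp add: w_def fun_eq_iff algebra_simps)
      also have "- (LBINT x. \<beta> * ((cutoff n x * (h x - hmin)) * r s x) - \<beta> * (?m - hmin) * (cutoff n x * r s x))
          = \<beta> * (?m - hmin) * (LBINT x. cutoff n x * r s x) - \<beta> * (LBINT x. (cutoff n x * (h x - hmin)) * r s x)"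
        using ic ich by simp
      finally have d: "\<beta> * (?m - hmin) * (LBINT x. cutoff n x * r s x) = d s + \<beta> * (LBINT x. (cutoff n x * (h x - hmin)) * r s x)"
        by simp
      have "(LBINT x. (cutoff n x * (h x - hmin)) * r s x) \<le> (LBINT x. C * r s x)"
        using ich p C(2) by (intro integral_mono mult_right_mono) (auto intro: order_trans[OF abs_ge_self])
      also have "\<dots> = C" using p(3,4) by simp
      finally have "\<beta> * (LBINT x. (cutoff n x * (h x - hmin)) * r s x) \<le> \<beta> * C" using \<beta> by simp
      moreover have "\<beta> * (?m - hmin) * (1 / 2) \<le> \<beta> * (?m - hmin) * (LBINT x. cutoff n x * r s x)"
        using n[OF s] m0 \<beta> by (intro mult_left_mono) auto
      ultimately have bm: "\<beta> * (?m - hmin) \<le> 2 * \<bar>d s\<bar> + 2 * \<beta> * C" using d by linarith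
      have "(LBINT x. \<bar>r s x * w s x\<bar>) \<le> (LBINT x. \<beta> * ((h x - hmin) * r s x + (?m - hmin) * r s x))"
      proof (rule integral_mono)
        show "integrable lborel (\<lambda>x. \<bar>r s x * w s x\<bar>)" using iw by simp
        show "integrable lborel (\<lambda>x. \<beta> * ((h x - hmin) * r s x + (?m - hmin) * r s x))" using ih p(3) by simp
        fix x
        have "\<bar>h x - ?m\<bar> \<le> (h x - hmin) + (?m - hmin)" using bdd[of x] m0 by linarith
        hence "\<beta> * (\<bar>h x - ?m\<bar> * r s x) \<le> \<beta> * (((h x - hmin) + (?m - hmin)) * r s x)"
          using \<beta> p(2)[of x] by (intro mult_left_mono mult_right_mono) auto
        moreover have "\<bar>r s x * w s x\<bar> = \<beta> * (\<bar>h x - ?m\<bar> * r s x)"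
          using \<beta> p(2)[of x] by (simp add: w_def abs_mult mult_ac)
        ultimately show "\<bar>r s x * w s x\<bar> \<le> \<beta> * ((h x - hmin) * r s x + (?m - hmin) * r s x)"
          by (simp only: distrib_right)
      qed
      also have "\<dots> = \<beta> * ((?m - hmin) + (?m - hmin))" using ih p(3,4) by (simp add: ihm)
      also have "\<dots> \<le> G s" using bm unfolding G_def distrib_left by linarith
      finally show "has_weighted_div (r s) (u s) (w s) \<and> integrable lborel (\<lambda>x. r s x * w s x) \<and> (LBINT x. \<bar>r s x * w s x\<bar>) \<le> G s"
        using wd iw by blast
    qed
  qed
  obtain D where D0: "\<forall>n. set_integrable lborel {t..T} (D n) \<and>
      (AE s\<in>{t..T} in lborel. D n s = (LBINT x. trunc n (h x) * (r s x * w s x))) \<and>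
      (LBINT x. trunc n (h x) * r t x) - (LBINT x. trunc n (h x) * r T x) = (LINT s:{t..T}|lborel. D n s)"
    using trunc_along_path[OF path le div iG h] by (rule exE)
  note D = D0[THEN spec, THEN conjunct1] D0[THEN spec, THEN conjunct2, THEN conjunct1]
    D0[THEN spec, THEN conjunct2, THEN conjunct2]
  define e where "e n s = \<beta> * (indicator {t..T} s *\<^sub>R D n s)" for n s
  have ie: "integrable lborel (e n)" for n unfolding e_def [abs_def] using D(1)[of n] by (simp add: set_integrable_def)
  hence [measurable]: "e n \<in> borel_measurable borel" for n by (simp add: integrable_iff_bounded)
  have int_e: "(LBINT s. e n s) = \<beta> * ((LBINT x. trunc n (h x) * r t x) - (LBINT x. trunc n (h x) * r T x))" for n
    unfolding e_def D(3) set_lebesgue_integral_def by simp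
  have lim: "(\<lambda>n. LBINT s. e n s) \<longlonglongrightarrow> \<beta> * ((LBINT x. h x * r t x) - (LBINT x. h x * r T x))"
    unfolding int_e by (intro tendsto_intros trunc_mean_tendsto[OF rp h]) (use le in auto)
  have AED: "AE s in lborel. \<forall>n. s \<in> {t..T} \<longrightarrow> D n s = (LBINT x. trunc n (h x) * (r s x * w s x))"
    unfolding AE_all_countable by (intro allI D(2))
  have key: "AE s in lborel. (\<forall>n. 0 \<le> e n s) \<and> lagrangian h \<beta> (r s) (u s) * indicator {t..T} s \<le> liminf (\<lambda>n. ennreal (e n s))"
    using AED pde
  proof eventually_elim
    case (elim s)
    show ?case
    proof (cases "s \<in> {t..T}")
      case False
      thus ?thesis by (simp add: e_def)
    next
      case s: True
      note p = prob_densitiesD[OF rp[OF s]]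
      note [measurable] = p(1) trunc_measurable[OF hm]
      let ?m = "mean h (r s)"
      let ?F = "\<lambda>n x. (trunc n (h x) - trunc n ?m) * (h x - ?m) * r s x"
      have F0: "0 \<le> ?F n x" for n x
      proof (cases "h x \<le> ?m")
        case True
        thus ?thesis using trunc_mono[OF True, of n] p(2)[of x] by (intro mult_nonneg_nonneg mult_nonpos_nonpos) auto
      next
        case False
        thus ?thesis using trunc_mono[of ?m "h x" n] p(2)[of x] by (intro mult_nonneg_nonneg) auto
      qed
      have ic: "integrable lborel (\<lambda>x. r s x * (h x - ?m))" "(LBINT x. r s x * (h x - ?m)) = 0"
        using integral_centered[OF rp[OF s] h] by auto
      have it: "integrable lborel (\<lambda>x. trunc n (h x) * (r s x * (h x - ?m)))" for n
        by (rule integrable_bounded_mult[OF ic(1) _ trunc_bounded]) measurable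
      have eF: "?F n = (\<lambda>x. trunc n (h x) * (r s x * (h x - ?m)) - trunc n ?m * (r s x * (h x - ?m)))" for n
        by (simp add: fun_eq_iff algebra_simps)
      have iF: "integrable lborel (?F n)" for n unfolding eF using it ic by simp
      have DF: "e n s = \<beta>\<^sup>2 * (LBINT x. ?F n x)" for n
      proof -
        have "e n s = \<beta> * (LBINT x. trunc n (h x) * (r s x * w s x))" using elim(1) s by (simp add: e_def)
        also have "(\<lambda>x. trunc n (h x) * (r s x * w s x)) = (\<lambda>x. \<beta> * (trunc n (h x) * (r s x * (h x - ?m))))"
          by (simp add: w_def mult_ac)
        finally have "e n s = \<beta>\<^sup>2 * (LBINT x. trunc n (h x) * (r s x * (h x - ?m)))" by (simp add: power2_eq_square)
        moreover have "(LBINT x. ?F n x) = (LBINT x. trunc n (h x) * (r s x * (h x - ?m)))"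
          unfolding eF using it ic by simp
        ultimately show ?thesis by simp
      qed
      have nF: "ennreal (e n s) = (\<integral>\<^sup>+x. ennreal (\<beta>\<^sup>2 * ?F n x) \<partial>lborel)" for n
        unfolding DF using iF[of n] F0 by (subst nn_integral_eq_integral) auto
      have e0: "0 \<le> e n s" for n unfolding DF by (rule mult_nonneg_nonneg[OF zero_le_power2 Bochner_Integration.integral_nonneg]) (rule F0)
      have "lagrangian h \<beta> (r s) (u s) = (\<integral>\<^sup>+x. ennreal (\<beta>\<^sup>2 * ((h x - ?m)\<^sup>2 * r s x)) \<partial>lborel)"
        using lagrangian_control_pde(1)[OF rp[OF s] h, of \<beta> "u s"] elim(2) s p(2)
        by (simp add: ennreal_mult' nn_integral_cmult)
      also have "\<dots> = (\<integral>\<^sup>+x. liminf (\<lambda>n. ennreal (\<beta>\<^sup>2 * ?F n x)) \<partial>lborel)"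
      proof (rule nn_integral_cong)
        fix x
        have "(\<lambda>n. \<beta>\<^sup>2 * ?F n x) \<longlonglongrightarrow> \<beta>\<^sup>2 * ((h x - ?m) * (h x - ?m) * r s x)"
          by (intro tendsto_intros trunc_tendsto)
        hence "liminf (\<lambda>n. ennreal (\<beta>\<^sup>2 * ?F n x)) = ennreal (\<beta>\<^sup>2 * ((h x - ?m) * (h x - ?m) * r s x))"
          by (intro lim_imp_Liminf tendsto_ennrealI) auto
        thus "ennreal (\<beta>\<^sup>2 * ((h x - ?m)\<^sup>2 * r s x)) = liminf (\<lambda>n. ennreal (\<beta>\<^sup>2 * ?F n x))"
          by (simp add: power2_eq_square)
      qed
      also have "\<dots> \<le> liminf (\<lambda>n. \<integral>\<^sup>+x. ennreal (\<beta>\<^sup>2 * ?F n x) \<partial>lborel)"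
        by (rule nn_integral_liminf) measurable
      finally show ?thesis using e0 s by (simp add: nF)
    qed
  qed
  have "(\<integral>\<^sup>+s. lagrangian h \<beta> (r s) (u s) * indicator {t..T} s \<partial>lborel) \<le> (\<integral>\<^sup>+s. liminf (\<lambda>n. ennreal (e n s)) \<partial>lborel)"
    by (rule nn_integral_mono_AE) (use key in \<open>auto elim: eventually_mono\<close>)
  also have "\<dots> \<le> liminf (\<lambda>n. \<integral>\<^sup>+s. ennreal (e n s) \<partial>lborel)"
    by (rule nn_integral_liminf) measurable
  also have "(\<lambda>n. \<integral>\<^sup>+s. ennreal (e n s) \<partial>lborel) = (\<lambda>n. ennreal (LBINT s. e n s))"
    using key ie by (intro ext nn_integral_eq_integral) (auto elim: eventually_mono)
  also have "liminf (\<lambda>n. ennreal (LBINT s. e n s)) = ennreal (\<beta> * ((LBINT x. h x * r t x) - (LBINT x. h x * r T x)))"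
    using lim by (intro lim_imp_Liminf tendsto_ennrealI) auto
  finally show "(\<integral>\<^sup>+s. lagrangian h \<beta> (r s) (u s) * indicator {t..T} s \<partial>lborel)
     \<le> ennreal (\<beta> * ((LBINT x. h x * r t x) - (LBINT x. h x * r T x)))" .
  have "0 \<le> (LBINT s. e n s)" for n
    using key by (intro integral_nonneg_AE) (auto elim: eventually_mono)
  thus "0 \<le> \<beta> * ((LBINT x. h x * r t x) - (LBINT x. h x * r T x))"
    by (intro LIMSEQ_le_const[OF lim]) auto
qed

section \<open>Costs of admissible pairs and an optimal pair\<close>

lemma enn2ereal_le_ereal: "I \<le> ennreal c \<Longrightarrow> 0 \<le> c \<Longrightarrow> enn2ereal I \<le> ereal c"
  by (simp add: less_eq_ennreal.rep_eq)

lemma cost_lower_bound: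
  fixes h :: "'a::euclidean_space \<Rightarrow> real"
  assumes adm: "admissible_pair h \<beta> t T \<rho> r u" and le: "t \<le> T" and h: "C2_bounded_hessian h g H" and \<beta>: "\<beta> > 0"
  shows "ereal (\<beta> * (LBINT x. h x * \<rho> x)) \<le> cost h \<beta> t T r u"
    and "cost h \<beta> t T r u = ereal (\<beta> * (LBINT x. h x * \<rho> x)) \<Longrightarrow>
      AE s\<in>{t..T} in lborel. control_pde h \<beta> (r s) (u s)"
proof -
  let ?I = "\<integral>\<^sup>+s. lagrangian h \<beta> (r s) (u s) * indicator {t..T} s \<partial>lborel"
  have rt: "r t = \<rho>" using adm by (simp add: admissible_pair_def)
  have *: "ereal (\<beta> * (LBINT x. h x * \<rho> x)) \<le> cost h \<beta> t T r u \<and>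
    (cost h \<beta> t T r u = ereal (\<beta> * (LBINT x. h x * \<rho> x)) \<longrightarrow>
      (AE s\<in>{t..T} in lborel. control_pde h \<beta> (r s) (u s)))"
  proof (cases "?I = \<infinity>")
    case True
    hence "cost h \<beta> t T r u = \<infinity>" by (simp add: cost_def)
    thus ?thesis by simp
  next
    case False
    hence fin: "?I < \<infinity>" by (simp add: less_top)
    have J0: "enn2real ?I \<ge> 0" by simp
    have "enn2ereal ?I = ereal (enn2real ?I)"
      using fin by (metis J0 enn2ereal_ennreal ennreal_enn2real infinity_ennreal_def)
    hence c: "cost h \<beta> t T r u = ereal (enn2real ?I + \<beta> * (LBINT x. h x * r T x))" by (simp add: cost_def)
    note b = running_cost_bound[OF adm le h \<beta> fin, unfolded rt]
    have "ereal (\<beta> * (LBINT x. h x * \<rho> x)) \<le> cost h \<beta> t T r u"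
      using b(1) unfolding c by (simp add: right_diff_distrib)
    moreover have "AE s\<in>{t..T} in lborel. control_pde h \<beta> (r s) (u s)"
      if "cost h \<beta> t T r u = ereal (\<beta> * (LBINT x. h x * \<rho> x))"
      by (rule b(2)) (use that in \<open>simp add: c right_diff_distrib\<close>)
    ultimately show ?thesis by blast
  qed
  show "ereal (\<beta> * (LBINT x. h x * \<rho> x)) \<le> cost h \<beta> t T r u" using * by (rule conjunct1)
  show "cost h \<beta> t T r u = ereal (\<beta> * (LBINT x. h x * \<rho> x)) \<Longrightarrow>
      AE s\<in>{t..T} in lborel. control_pde h \<beta> (r s) (u s)" using *[THEN conjunct2] by (rule mp)
qed

lemma cost_of_control_pde:
  fixes h :: "'a::euclidean_space \<Rightarrow> real"
  assumes adm: "admissible_pair h \<beta> t T \<rho> r u" and le: "t \<le> T" and h: "C2_bounded_hessian h g H" and \<beta>: "\<beta> > 0"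
    and bdd: "\<And>x. hmin \<le> h x"
    and pde: "AE s\<in>{t..T} in lborel. control_pde h \<beta> (r s) (u s)"
  shows "cost h \<beta> t T r u = ereal (\<beta> * (LBINT x. h x * \<rho> x))"
proof (rule antisym)
  have path: "continuity_path t T r u" and rt: "r t = \<rho>" using adm by (auto simp: admissible_pair_def)
  note c = running_cost_of_control_pde[OF path le h \<beta> bdd pde, unfolded rt]
  have "cost h \<beta> t T r u \<le> ereal (\<beta> * ((LBINT x. h x * \<rho> x) - (LBINT x. h x * r T x))) + ereal (\<beta> * (LBINT x. h x * r T x))"
    unfolding cost_def by (intro add_right_mono enn2ereal_le_ereal c)
  also have "\<dots> = ereal (\<beta> * (LBINT x. h x * \<rho> x))" by (simp add: right_diff_distrib)
  finally show "cost h \<beta> t T r u \<le> ereal (\<beta> * (LBINT x. h x * \<rho> x))" .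
  show "ereal (\<beta> * (LBINT x. h x * \<rho> x)) \<le> cost h \<beta> t T r u" by (rule cost_lower_bound(1)[OF adm le h \<beta>])
qed

lemma A2_cost_regularity:
  assumes "A2 h \<rho>"
  obtains g H where "C2_bounded_hessian h g H" "radially_bounded_below g"
  using assms radially_bounded_belowI_Liminf unfolding A2_def by blast

lemma C2_bounded_hessian_zero: "C2_bounded_hessian (\<lambda>x::'a::euclidean_space. 0) (\<lambda>_. 0) (\<lambda>_. 0)"
  unfolding C2_bounded_hessian_def by (auto simp: gderiv_def zero_blinfun.rep_eq)

lemma tilting_potential_scaled_excess:
  assumes "C2_bounded_hessian h g H" "radially_bounded_below g" "\<And>x. hmin \<le> h x" "\<beta> > 0"
  shows "tilting_potential (\<lambda>x. \<beta> * (h x - hmin))"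
proof -
  have "C2_bounded_hessian (\<lambda>x. 0 + \<beta> * h x + (- \<beta> * hmin)) (\<lambda>x. 0 + \<beta> *\<^sub>R g x) (\<lambda>x. 0 + \<beta> *\<^sub>R H x)"
    by (rule C2_bounded_hessian_affine[OF C2_bounded_hessian_zero assms(1)])
  hence "C2_bounded_hessian (\<lambda>x. \<beta> * (h x - hmin)) (\<lambda>x. \<beta> *\<^sub>R g x) (\<lambda>x. \<beta> *\<^sub>R H x)"
    by (simp add: right_diff_distrib)
  moreover have "radially_bounded_below (\<lambda>x. \<beta> *\<^sub>R g x)"
  proof -
    obtain M R where MR: "\<And>x. R \<le> norm x \<Longrightarrow> - M * norm x \<le> g x \<bullet> x"
      using assms(2) unfolding radially_bounded_below_def by blast
    have "- (\<beta> * M) * norm x \<le> (\<beta> *\<^sub>R g x) \<bullet> x" if "R \<le> norm x" for x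
      using mult_left_mono[OF MR[OF that], of \<beta>] assms(4) by simp
    thus ?thesis unfolding radially_bounded_below_def by blast
  qed
  ultimately show ?thesis unfolding tilting_potential_def using assms(3,4) by auto
qed

lemma mean_scaled_excess:
  assumes "\<rho> \<in> prob_densities" "C2_bounded_hessian h g H"
  shows "\<beta> * (h x - hmin) - mean (\<lambda>x. \<beta> * (h x - hmin)) \<rho> = \<beta> * (h x - mean h \<rho>)"
proof -
  have "mean (\<lambda>x. \<beta> * (h x - hmin)) \<rho> = (LBINT x. \<beta> * (h x * \<rho> x - hmin * \<rho> x))"
    unfolding mean_def by (intro Bochner_Integration.integral_cong refl) (simp add: algebra_simps)
  also have "\<dots> = \<beta> * (mean h \<rho> - hmin)"
    using prob_integrable_C2[OF assms] prob_densitiesD(3,4)[OF assms(1)] by (simp add: mean_def)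
  finally show ?thesis by (simp add: algebra_simps)
qed

text \<open>The excess \<open>h - hmin\<close> is nonnegative and has the same centered version as \<open>h\<close>, so tilting by its
  multiple solves the control equation.\<close>

lemma tilted_pair:
  fixes h :: "'a::euclidean_space \<Rightarrow> real"
  assumes \<rho>: "A1 \<rho>" and h: "C2_bounded_hessian h g H" "radially_bounded_below g" and bdd: "\<And>x. hmin \<le> h x" and \<beta>: "\<beta> > 0"
    and le: "t \<le> T"
  defines "k \<equiv> \<lambda>x. \<beta> * (h x - hmin)"
  shows "admissible_pair h \<beta> t T \<rho> (\<lambda>s. tilt \<rho> k (s - t)) (\<lambda>s. tilt_field \<rho> k (s - t))"
    and "\<And>s. s \<in> {t..T} \<Longrightarrow> control_pde h \<beta> (tilt \<rho> k (s - t)) (tilt_field \<rho> k (s - t))"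
proof -
  have k: "tilting_potential k" unfolding k_def by (rule tilting_potential_scaled_excess[OF h bdd \<beta>])
  have path: "continuity_path t T (\<lambda>s. tilt \<rho> k (s - t)) (\<lambda>s. tilt_field \<rho> k (s - t))"
    by (rule tilt_continuity_path[OF \<rho> k])
  have rp: "tilt \<rho> k (s - t) \<in> prob_densities" if "s \<in> {t..T}" for s
    using path that by (auto simp: continuity_path_def)
  show pde: "control_pde h \<beta> (tilt \<rho> k (s - t)) (tilt_field \<rho> k (s - t))" if s: "s \<in> {t..T}" for s
    using tilt_field_solves(1)[OF \<rho> k, of "s - t"] s
    unfolding control_pde_def k_def mean_scaled_excess[OF rp[OF s, unfolded k_def] h(1)] by simp
  have hm [measurable]: "h \<in> borel_measurable borel" by (rule C2_bounded_hessian_measurable[OF h(1)])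
  have km [measurable]: "k \<in> borel_measurable borel" unfolding k_def by measurable
  have rm [measurable]: "\<rho> \<in> borel_measurable borel" using \<rho> by (auto simp: A1_def prob_densities_def)
  note [measurable] = measurable_tilt
  have "(\<lambda>s. lagrangian h \<beta> (tilt \<rho> k (s - t)) (tilt_field \<rho> k (s - t)) * indicator {t..T} s)
     = (\<lambda>s. (ennreal (\<beta>\<^sup>2) * (\<integral>\<^sup>+x. ennreal ((h x - mean h (tilt \<rho> k (s - t)))\<^sup>2 * tilt \<rho> k (s - t) x) \<partial>lborel)) * indicator {t..T} s)"
  proof
    fix s
    show "lagrangian h \<beta> (tilt \<rho> k (s - t)) (tilt_field \<rho> k (s - t)) * indicator {t..T} s
       = (ennreal (\<beta>\<^sup>2) * (\<integral>\<^sup>+x. ennreal ((h x - mean h (tilt \<rho> k (s - t)))\<^sup>2 * tilt \<rho> k (s - t) x) \<partial>lborel)) * indicator {t..T} s"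
      using lagrangian_control_pde(1)[OF rp h(1) pde, of s] by (cases "s \<in> {t..T}") auto
  qed
  moreover have "(\<lambda>s. (ennreal (\<beta>\<^sup>2) * (\<integral>\<^sup>+x. ennreal ((h x - mean h (tilt \<rho> k (s - t)))\<^sup>2 * tilt \<rho> k (s - t) x) \<partial>lborel)) * indicator {t..T} s)
      \<in> borel_measurable borel"
    unfolding mean_def by measurable
  ultimately show "admissible_pair h \<beta> t T \<rho> (\<lambda>s. tilt \<rho> k (s - t)) (\<lambda>s. tilt_field \<rho> k (s - t))"
    unfolding admissible_pair_def using path tilt_0[OF \<rho>] by simp
qed

section \<open>Gateaux derivatives\<close>

lemma L2_functions_scale: "h \<in> L2_functions \<rho> \<Longrightarrow> (\<lambda>x. c * h x) \<in> L2_functions \<rho>"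
  unfolding L2_functions_def by (auto simp: power_mult_distrib mult.assoc)

text \<open>The error of the difference quotient is the pairing of \<open>h\<close> with the remainder of the expansion of
  the path, which tends to zero in the weighted \<open>L\<^sup>2\<close> norm; Cauchy-Schwarz applies.\<close>

lemma linear_functional_gateaux:
  fixes h :: "'a::euclidean_space \<Rightarrow> real"
  assumes \<rho>: "A1 \<rho>" and hL: "h \<in> L2_functions \<rho>" and h: "C2_bounded_hessian h g H"
    and A: "A \<subseteq> prob_densities"
  shows "is_gateaux_derivative A (\<lambda>\<rho>'. \<beta> * (LBINT x. h x * \<rho>' x)) \<rho> (\<lambda>x. \<beta> * h x)"
  unfolding is_gateaux_derivative_def
proof (intro conjI allI impI L2_functions_scale hL)
  fix \<epsilon> and r :: "real \<Rightarrow> 'a \<Rightarrow> real" and v w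
  assume var: "variation A \<rho> \<epsilon> r v w"
  have pos: "\<rho> x > 0" for x by (rule A1_pos[OF \<rho>])
  have \<rho>p: "\<rho> \<in> prob_densities" using \<rho> by (simp add: A1_def)
  have \<epsilon>: "\<epsilon> > 0" and r0: "r 0 = \<rho>" and rA: "\<And>s. s \<in> {0..\<epsilon>} \<Longrightarrow> r s \<in> prob_densities" and w: "w \<in> L2_functions \<rho>"
    and lim: "((\<lambda>s. \<integral>\<^sup>+x. ennreal (((r s x - \<rho> x) / s + \<rho> x * w x)\<^sup>2 / \<rho> x) \<partial>lborel) \<longlongrightarrow> 0) (at_right 0)"
    using var A by (auto simp: variation_def)
  have hm [measurable]: "h \<in> borel_measurable borel" by (rule C2_bounded_hessian_measurable[OF h])
  have wm [measurable]: "w \<in> borel_measurable borel" using w by (simp add: L2_functions_def)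
  note [measurable] = prob_densitiesD(1)[OF \<rho>p]
  let ?a = "\<lambda>s x. (r s x - \<rho> x) / s + \<rho> x * w x"
  let ?C = "\<integral>\<^sup>+x. ennreal ((h x)\<^sup>2 * \<rho> x) \<partial>lborel"
  have C: "?C < \<infinity>" using hL by (simp add: L2_functions_def integrable_iff_bounded abs_mult abs_of_pos[OF pos])
  have ihw: "integrable lborel (\<lambda>x. h x * (\<rho> x * w x))"
    by (rule L2_product_integrable[OF hL w less_imp_le[OF pos] prob_densitiesD(1)[OF \<rho>p]])
  define d where "d s = (LBINT x. h x * ?a s x)" for s
  have dint: "integrable lborel (\<lambda>x. h x * ?a s x)"
    and deq: "d s = ((LBINT x. h x * r s x) - (LBINT x. h x * \<rho> x)) / s + (LBINT x. h x * (\<rho> x * w x))"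
    if s: "s \<in> {0<..<\<epsilon>}" for s
  proof -
    have rs: "r s \<in> prob_densities" using rA s by auto
    have e: "(\<lambda>x. h x * ?a s x) = (\<lambda>x. (h x * r s x - h x * \<rho> x) / s + h x * (\<rho> x * w x))"
      by (simp add: fun_eq_iff distrib_left right_diff_distrib diff_divide_distrib)
    note i = prob_integrable_C2[OF rs h] prob_integrable_C2[OF \<rho>p h] ihw
    show "integrable lborel (\<lambda>x. h x * ?a s x)" unfolding e using i by simp
    show "d s = ((LBINT x. h x * r s x) - (LBINT x. h x * \<rho> x)) / s + (LBINT x. h x * (\<rho> x * w x))"
      unfolding d_def e using i by simp
  qed
  have bound: "ennreal ((d s)\<^sup>2) \<le> ?C * (\<integral>\<^sup>+x. ennreal ((?a s x)\<^sup>2 / \<rho> x) \<partial>lborel)" if s: "s \<in> {0<..<\<epsilon>}" for s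
  proof -
    have rs: "r s \<in> prob_densities" using rA s by auto
    note [measurable] = prob_densitiesD(1)[OF rs]
    have "ennreal \<bar>d s\<bar> \<le> (\<integral>\<^sup>+x. ennreal (norm (h x * ?a s x)) \<partial>lborel)"
      using integral_norm_bound_ennreal[OF dint[OF s]] by (simp add: d_def)
    also have "\<dots> = (\<integral>\<^sup>+x. ennreal (\<bar>h x\<bar> * sqrt (\<rho> x)) * ennreal (\<bar>?a s x\<bar> / sqrt (\<rho> x)) \<partial>lborel)"
      using pos by (intro nn_integral_cong) (simp add: ennreal_mult[symmetric] less_imp_le abs_mult less_imp_neq[THEN not_sym])
    finally have "(ennreal \<bar>d s\<bar>)\<^sup>2 \<le> (\<integral>\<^sup>+x. ennreal (\<bar>h x\<bar> * sqrt (\<rho> x)) * ennreal (\<bar>?a s x\<bar> / sqrt (\<rho> x)) \<partial>lborel)\<^sup>2"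
      by (rule power_mono) simp
    also have "\<dots> \<le> (\<integral>\<^sup>+x. (ennreal (\<bar>h x\<bar> * sqrt (\<rho> x)))\<^sup>2 \<partial>lborel) * (\<integral>\<^sup>+x. (ennreal (\<bar>?a s x\<bar> / sqrt (\<rho> x)))\<^sup>2 \<partial>lborel)"
      by (rule Cauchy_Schwarz_nn_integral) measurable
    also have "(\<integral>\<^sup>+x. (ennreal (\<bar>h x\<bar> * sqrt (\<rho> x)))\<^sup>2 \<partial>lborel) = ?C"
      using pos by (intro nn_integral_cong) (simp add: ennreal_power less_imp_le power_mult_distrib)
    also have "(\<integral>\<^sup>+x. (ennreal (\<bar>?a s x\<bar> / sqrt (\<rho> x)))\<^sup>2 \<partial>lborel) = (\<integral>\<^sup>+x. ennreal ((?a s x)\<^sup>2 / \<rho> x) \<partial>lborel)"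
      using pos by (intro nn_integral_cong) (simp add: ennreal_power less_imp_le power_divide)
    finally show ?thesis by (simp add: ennreal_power)
  qed
  have ev: "eventually (\<lambda>s. s \<in> {0<..<\<epsilon>}) (at_right 0)" by (rule eventually_at_rightI[OF _ \<epsilon>]) simp
  have "((\<lambda>s. ?C * (\<integral>\<^sup>+x. ennreal ((?a s x)\<^sup>2 / \<rho> x) \<partial>lborel)) \<longlongrightarrow> ?C * 0) (at_right 0)"
    using C by (intro ennreal_tendsto_cmult lim) (simp add: less_top)
  hence up: "((\<lambda>s. ?C * (\<integral>\<^sup>+x. ennreal ((?a s x)\<^sup>2 / \<rho> x) \<partial>lborel)) \<longlongrightarrow> 0) (at_right 0)" by simp
  have "((\<lambda>s. ennreal ((d s)\<^sup>2)) \<longlongrightarrow> 0) (at_right 0)"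
    by (rule tendsto_sandwich[OF _ _ tendsto_const up]) (use ev bound in \<open>auto elim: eventually_mono\<close>)
  hence "((\<lambda>s. ennreal ((d s)\<^sup>2)) \<longlongrightarrow> ennreal 0) (at_right 0)" by simp
  hence "((\<lambda>s. (d s)\<^sup>2) \<longlongrightarrow> 0) (at_right 0)" by (subst (asm) tendsto_ennreal_iff) auto
  hence "((\<lambda>s. sqrt ((d s)\<^sup>2)) \<longlongrightarrow> sqrt 0) (at_right 0)" by (rule tendsto_real_sqrt)
  hence "((\<lambda>s. \<bar>d s\<bar>) \<longlongrightarrow> 0) (at_right 0)" by simp
  hence d0: "(d \<longlongrightarrow> 0) (at_right 0)" by (rule tendsto_rabs_zero_cancel)
  have "((\<lambda>s. \<beta> * (d s - (LBINT x. h x * (\<rho> x * w x)))) \<longlongrightarrow> \<beta> * (0 - (LBINT x. h x * (\<rho> x * w x)))) (at_right 0)"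
    by (intro tendsto_intros d0)
  moreover have "eventually (\<lambda>s. \<beta> * (d s - (LBINT x. h x * (\<rho> x * w x)))
      = (\<beta> * (LBINT x. h x * r s x) - \<beta> * (LBINT x. h x * r 0 x)) / (s - 0)) (at_right 0)"
    using ev by eventually_elim (simp add: deq r0 right_diff_distrib)
  ultimately have "((\<lambda>s. (\<beta> * (LBINT x. h x * r s x) - \<beta> * (LBINT x. h x * r 0 x)) / (s - 0)) \<longlongrightarrow>
      \<beta> * (0 - (LBINT x. h x * (\<rho> x * w x)))) (at_right 0)"
    by (rule Lim_transform_eventually)
  moreover have "\<beta> * (0 - (LBINT x. h x * (\<rho> x * w x))) = - (LBINT x. \<beta> * h x * (\<rho> x * w x))"
    by (simp add: mult.assoc)
  ultimately show "((\<lambda>s. \<beta> * (LBINT x. h x * r s x)) has_real_derivative - (LBINT x. \<beta> * h x * (\<rho> x * w x))) (at 0 within {0..\<epsilon>})"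
    unfolding has_field_derivative_iff at_within_Icc_at_right[OF \<epsilon>] by simp
qed

text \<open>For bounded \<open>k\<close> the difference quotients of the tilted density relative to \<open>\<rho>\<close> are uniformly bounded,
  so their pointwise convergence is also strong \<open>L\<^sup>2\<close> convergence. All moments stay finite, which keeps the path
  inside the admissible class.\<close>

lemma tilt_variation:
  fixes k :: "'a::euclidean_space \<Rightarrow> real"
  assumes \<rho>: "\<rho> \<in> admissible_densities h" and k: "tilting_potential k" and b: "\<And>x. k x \<le> B"
  shows "variation (admissible_densities h) \<rho> 1 (tilt \<rho> k) (tilt_field \<rho> k 0) (\<lambda>x. k x - mean k \<rho>)"
  unfolding variation_def
proof (intro conjI ballI)
  have A1: "A1 \<rho>" and A2: "A2 h \<rho>" using \<rho> by (auto simp: admissible_densities_def)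
  have \<rho>p: "\<rho> \<in> prob_densities" using A1 by (simp add: A1_def)
  note p = prob_densitiesD[OF \<rho>p]
  obtain g H where h: "C2_bounded_hessian h g H" using A2 unfolding A2_def by blast
  have kg: "exp_growth k" by (rule tilting_potential_exp_growth[OF k])
  have wg: "exp_growth (\<lambda>x. k x - mean k \<rho>)" by (intro exp_growth_diff kg exp_growth_const)
  have k0: "0 \<le> k x" for x using k by (simp add: tilting_potential_def)
  have B0: "B \<ge> 0" using k0[of 0] b[of 0] by linarith
  note [measurable] = p(1) exp_growth_measurable[OF kg]
  show "(1::real) > 0" by simp
  show t0: "tilt \<rho> k 0 = \<rho>" by (rule tilt_0[OF A1])
  show "tilt \<rho> k s \<in> admissible_densities h" if "s \<in> {0..1}" for s
  proof -
    have A: "A1 (tilt \<rho> k s)" using that by (intro A1_tilt[OF A1 k]) auto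
    have "h \<in> L2_functions (tilt \<rho> k s)"
      unfolding L2_functions_def using C2_bounded_hessian_measurable[OF h]
        A1_integrable_exp_growth[OF A exp_growth_power2[OF C2_bounded_hessian_exp_growth[OF h]]] by simp
    thus ?thesis using A A2 by (simp add: admissible_densities_def A2_def)
  qed
  have "continuity_path 0 1 (\<lambda>s. tilt \<rho> k (s - 0)) (\<lambda>s. tilt_field \<rho> k (s - 0))" by (rule tilt_continuity_path[OF A1 k])
  thus "\<exists>u. continuity_path 0 1 (tilt \<rho> k) u \<and> u 0 = tilt_field \<rho> k 0"
    by (intro exI[of _ "tilt_field \<rho> k"]) simp
  show "(\<lambda>x. k x - mean k \<rho>) \<in> L2_functions \<rho>"
    unfolding L2_functions_def using exp_growth_measurable[OF wg] A1_integrable_exp_growth[OF A1 exp_growth_power2[OF wg]] by simp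
  show "has_weighted_div \<rho> (tilt_field \<rho> k 0) (\<lambda>x. k x - mean k \<rho>)"
    using tilt_field_solves(1)[OF A1 k, of 0] by (simp add: t0)
  define Z where "Z s = (LBINT y. exp (- s * k y) * \<rho> y)" for s
  have Z0: "Z 0 = 1" using p(4) by (simp add: Z_def)
  have ie: "integrable lborel (\<lambda>y. exp (- s * k y) * \<rho> y)" if "s \<ge> 0" for s
    by (intro A1_integrable_exp_growth A1 tilting_weight_exp_growth k that)
  have Zlow: "exp (- B) \<le> Z s" if s: "s \<in> {0..1}" for s
  proof -
    have "exp (- B) = (LBINT y. exp (- B) * \<rho> y)" using p(3,4) by simp
    also have "\<dots> \<le> Z s" unfolding Z_def
    proof (rule integral_mono)
      fix y
      have "s * k y \<le> 1 * B" using s k0[of y] b[of y] by (intro mult_mono) auto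
      thus "exp (- B) * \<rho> y \<le> exp (- s * k y) * \<rho> y" using p(2) by (intro mult_right_mono) auto
    qed (use ie s p(3) in auto)
    finally show ?thesis .
  qed
  have e1: "\<bar>exp (- s * k x) - 1\<bar> \<le> s * B" if "s \<ge> 0" for s x
  proof -
    have "\<bar>exp (- (s * k x)) - exp (- 0)\<bar> \<le> \<bar>s * k x - 0\<bar>" using that k0 by (intro exp_minus_diff_bound) auto
    also have "\<dots> \<le> s * B" using that k0[of x] b[of x] by (simp add: mult_left_mono)
    finally show ?thesis by simp
  qed
  have Z1: "\<bar>Z s - 1\<bar> \<le> s * B" if s: "s \<ge> 0" for s
  proof -
    have "\<bar>Z s - 1\<bar> = \<bar>\<integral>y. exp (- s * k y) * \<rho> y - \<rho> y \<partial>lborel\<bar>" using ie[OF s] p(3,4) by (simp add: Z_def)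
    also have "\<dots> \<le> (LBINT y. \<bar>exp (- s * k y) * \<rho> y - \<rho> y\<bar>)" by (rule integral_abs_bound)
    also have "\<dots> \<le> (LBINT y. s * B * \<rho> y)"
    proof (rule integral_mono)
      fix y
      have "\<bar>exp (- s * k y) * \<rho> y - \<rho> y\<bar> = \<bar>exp (- s * k y) - 1\<bar> * \<rho> y"
        using p(2)[of y] abs_mult[of "exp (- s * k y) - 1" "\<rho> y"] by (simp add: left_diff_distrib)
      also have "\<dots> \<le> s * B * \<rho> y" using e1[OF s, of y] p(2) by (intro mult_right_mono) auto
      finally show "\<bar>exp (- s * k y) * \<rho> y - \<rho> y\<bar> \<le> s * B * \<rho> y" .
    qed (use ie[OF s] p(3) in auto)
    also have "\<dots> = s * B" using p(3,4) by simp
    finally show ?thesis .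
  qed
  let ?c = "\<lambda>s x. (exp (- s * k x) / Z s - 1) / s + (k x - mean k \<rho>)"
  have integrand: "((tilt \<rho> k s x - \<rho> x) / s + \<rho> x * (k x - mean k \<rho>))\<^sup>2 / \<rho> x = (?c s x)\<^sup>2 * \<rho> x" for s x
  proof -
    have "(tilt \<rho> k s x - \<rho> x) / s + \<rho> x * (k x - mean k \<rho>) = \<rho> x * ?c s x"
      by (simp add: tilt_def Z_def algebra_simps diff_divide_distrib)
    thus ?thesis using A1_pos[OF A1, of x] by (simp add: power_mult_distrib power2_eq_square)
  qed
  (* The quotient (exp (- s k) - Z s) / (s Z s) has a numerator of size at most 2 s B, and Z s \<ge> exp (- B). *)
  define M where "M = 2 * B * exp B + (B + \<bar>mean k \<rho>\<bar>)"
  have cb: "\<bar>?c s x\<bar> \<le> M" if s: "s \<in> {0<..1}" for s x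
  proof -
    have Zs: "Z s \<ge> exp (- B)" using Zlow s by auto
    hence Zp: "Z s > 0" by (meson exp_gt_zero less_le_trans)
    have "\<bar>exp (- s * k x) - Z s\<bar> \<le> 2 * (s * B)" using e1[of s x] Z1[of s] s by auto
    hence "\<bar>exp (- s * k x) - Z s\<bar> / (s * Z s) \<le> 2 * (s * B) / (s * exp (- B))"
      using s Zs Zp B0 by (intro frac_le) auto
    also have "\<dots> = 2 * B * exp B" using s by (simp add: exp_minus field_simps)
    finally have q: "\<bar>exp (- s * k x) - Z s\<bar> / (s * Z s) \<le> 2 * B * exp B" .
    have "\<bar>(exp (- s * k x) / Z s - 1) / s\<bar> \<le> 2 * B * exp B"
    proof -
      have "(exp (- s * k x) / Z s - 1) / s = (exp (- s * k x) - Z s) / (s * Z s)" using Zp s by (simp add: field_simps)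
      hence "\<bar>(exp (- s * k x) / Z s - 1) / s\<bar> = \<bar>exp (- s * k x) - Z s\<bar> / (s * Z s)" using Zp s by (simp add: abs_mult)
      thus ?thesis using q by simp
    qed
    moreover have "\<bar>k x - mean k \<rho>\<bar> \<le> B + \<bar>mean k \<rho>\<bar>" using k0[of x] b[of x] by linarith
    ultimately show ?thesis unfolding M_def by linarith
  qed
  show "((\<lambda>s. \<integral>\<^sup>+x. ennreal (((tilt \<rho> k s x - \<rho> x) / s + \<rho> x * (k x - mean k \<rho>))\<^sup>2 / \<rho> x) \<partial>lborel) \<longlongrightarrow> 0) (at_right 0)"
    unfolding integrand at_within_Icc_at_right[OF zero_less_one, symmetric] tendsto_at_iff_sequentially
  proof (intro allI impI)
    fix X :: "nat \<Rightarrow> real" assume X: "\<forall>i. X i \<in> {0..1} - {0}" and lim: "X \<longlonglongrightarrow> 0"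
    have Xs: "X i \<in> {0<..1}" for i using X[rule_format, of i] by auto
    have "(\<lambda>i. \<integral>\<^sup>+x. ennreal ((?c (X i) x)\<^sup>2 * \<rho> x) \<partial>lborel) \<longlonglongrightarrow> (\<integral>\<^sup>+x. ennreal (0\<^sup>2 * \<rho> x) \<partial>(lborel :: 'a measure))"
    proof (rule nn_integral_dominated_convergence[where w = "\<lambda>x. ennreal (M\<^sup>2 * \<rho> x)"])
      show "AE x in lborel. ennreal ((?c (X i) x)\<^sup>2 * \<rho> x) \<le> ennreal (M\<^sup>2 * \<rho> x)" for i
        using cb[OF Xs[of i]] p(2) by (intro AE_I2 ennreal_leI mult_right_mono) (auto simp: abs_le_square_iff[symmetric] intro: order_trans[OF _ abs_ge_self])
      show "(\<integral>\<^sup>+x. ennreal (M\<^sup>2 * \<rho> x) \<partial>lborel) < \<infinity>"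
        using p(2,3) integrable_mult_right[of "M\<^sup>2" lborel \<rho>] unfolding integrable_iff_bounded by (simp add: abs_mult)
      show "AE x in lborel. (\<lambda>i. ennreal ((?c (X i) x)\<^sup>2 * \<rho> x)) \<longlonglongrightarrow> ennreal (0\<^sup>2 * \<rho> x)"
      proof (intro AE_I2 tendsto_ennrealI tendsto_intros)
        fix x
        have dZ: "(Z has_real_derivative - (LBINT x. 1 * k x * exp (- 0 * k x) * \<rho> x)) (at 0 within {0..})"
          unfolding Z_def [abs_def] using tilted_integral_derivative[OF A1 k exp_growth_const[of 1], of 0] by simp
        have dE: "((\<lambda>s. exp (- s * k x)) has_real_derivative - k x) (at 0 within {0..})"
          by (auto intro!: derivative_eq_intros)
        have "((\<lambda>s. exp (- s * k x) / Z s) has_real_derivative - (k x - mean k \<rho>)) (at 0 within {0..})"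
          using DERIV_divide[OF dE dZ] by (simp add: Z0 mean_def)
        hence "((\<lambda>s. exp (- s * k x) / Z s) has_real_derivative - (k x - mean k \<rho>)) (at 0 within {0..1})"
          by (rule DERIV_subset) auto
        hence "(\<lambda>i. (exp (- X i * k x) / Z (X i) - 1) / X i) \<longlonglongrightarrow> - (k x - mean k \<rho>)"
          unfolding has_field_derivative_iff tendsto_at_iff_sequentially using X lim by (auto simp: Z0 o_def)
        from tendsto_add[OF this tendsto_const[of "k x - mean k \<rho>"]]
        show "(\<lambda>i. ?c (X i) x) \<longlonglongrightarrow> 0" by simp
      qed
    qed (unfold Z_def, measurable)
    thus "((\<lambda>s. \<integral>\<^sup>+x. ennreal ((?c s x)\<^sup>2 * \<rho> x) \<partial>lborel) \<circ> X) \<longlonglongrightarrow> 0" by (simp add: o_def)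
  qed
qed

text \<open>Tilting by any bounded C2 function is a variation, so two derivatives have the same pairing with all
  centered functions of this kind; their difference is constant.\<close>

lemma gateaux_unique:
  fixes h :: "'a::euclidean_space \<Rightarrow> real"
  assumes \<rho>: "\<rho> \<in> admissible_densities h"
    and q: "is_gateaux_derivative (admissible_densities h) E \<rho> q"
    and q': "is_gateaux_derivative (admissible_densities h) E \<rho> q'"
  obtains c where "AE x in lborel. q x = q' x + c"
proof -
  have A1: "A1 \<rho>" using \<rho> by (auto simp: admissible_densities_def)
  have \<rho>p: "\<rho> \<in> prob_densities" using A1 by (simp add: A1_def)
  note p = prob_densitiesD[OF \<rho>p]
  have pos: "\<rho> x > 0" for x by (rule A1_pos[OF A1])
  have qL: "q \<in> L2_functions \<rho>" "q' \<in> L2_functions \<rho>" using q q' by (auto simp: is_gateaux_derivative_def)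
  have [measurable]: "q \<in> borel_measurable borel" "q' \<in> borel_measurable borel" using qL by (auto simp: L2_functions_def)
  note [measurable] = p(1)
  define G where "G x = q x - q' x" for x
  have iq: "integrable lborel (\<lambda>x. q x * \<rho> x)" "integrable lborel (\<lambda>x. q' x * \<rho> x)"
    using L2_product_integrable[OF qL(1) L2_constant[OF \<rho>p, of 1] p(2,1)] L2_product_integrable[OF qL(2) L2_constant[OF \<rho>p, of 1] p(2,1)]
    by simp_all
  have iG: "integrable lborel (\<lambda>x. G x * \<rho> x)" using iq by (simp add: G_def left_diff_distrib)
  define c where "c = (LBINT x. G x * \<rho> x)"
  have "AE x in lborel. (G x - c) * \<rho> x = 0"
  proof (rule AE_zero_if_orthogonal_to_C2_bounded)
    show "integrable lborel (\<lambda>x. (G x - c) * \<rho> x)" using iG p(3) by (simp add: left_diff_distrib)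
    fix k :: "'a \<Rightarrow> real" assume "C2_bounded k"
    then obtain g H where k: "C2_bounded_hessian k g H" "bounded (range k)" "bounded (range g)" unfolding C2_bounded_def by blast
    obtain b B where b: "\<And>x. \<bar>k x\<bar> \<le> b" and B: "\<And>x. norm (g x) \<le> B"
      using k(2,3) unfolding bounded_iff by (metis rangeI real_norm_def)
    have kmin: "- b \<le> k x" for x using b[of x] by linarith
    have rbb: "radially_bounded_below g"
      unfolding radially_bounded_below_def
    proof (intro exI allI impI)
      fix x
      have "\<bar>g x \<bullet> x\<bar> \<le> norm (g x) * norm x" by (rule Cauchy_Schwarz_ineq2)
      also have "\<dots> \<le> B * norm x" using B by (intro mult_right_mono) auto
      finally show "- B * norm x \<le> g x \<bullet> x" by linarith
    qed
    (* The shift makes k nonnegative and drops out of the centered function. *)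
    let ?K = "\<lambda>x. 1 * (k x - (- b))"
    have K: "tilting_potential ?K" by (rule tilting_potential_scaled_excess[OF k(1) rbb kmin]) simp
    have KB: "?K x \<le> 2 * b" for x using b[of x] by (simp add: abs_le_iff)
    have var: "variation (admissible_densities h) \<rho> 1 (tilt \<rho> ?K) (tilt_field \<rho> ?K 0) (\<lambda>x. ?K x - mean ?K \<rho>)"
      by (rule tilt_variation[OF \<rho> K KB])
    let ?w = "\<lambda>x. k x - mean k \<rho>"
    have wK: "(\<lambda>x. ?K x - mean ?K \<rho>) = ?w"
      by (rule ext, subst mean_scaled_excess[OF \<rho>p k(1)]) simp
    have wL: "?w \<in> L2_functions \<rho>" using var unfolding wK variation_def by blast
    have "((\<lambda>s. E (tilt \<rho> ?K s)) has_real_derivative - (LBINT x. q x * (\<rho> x * ?w x))) (at 0 within {0..1})"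
      "((\<lambda>s. E (tilt \<rho> ?K s)) has_real_derivative - (LBINT x. q' x * (\<rho> x * ?w x))) (at 0 within {0..1})"
      using q q' var unfolding is_gateaux_derivative_def wK by blast+
    hence "- (LBINT x. q x * (\<rho> x * ?w x)) = - (LBINT x. q' x * (\<rho> x * ?w x))"
      unfolding has_field_derivative_iff at_within_Icc_at_right[OF zero_less_one]
      by (rule tendsto_unique[rotated]) (rule trivial_limit_at_right_real)
    hence orth: "(LBINT x. q x * (\<rho> x * ?w x)) = (LBINT x. q' x * (\<rho> x * ?w x))" by simp
    have iqw: "integrable lborel (\<lambda>x. q x * (\<rho> x * ?w x))" "integrable lborel (\<lambda>x. q' x * (\<rho> x * ?w x))"
      by (rule L2_product_integrable[OF _ wL p(2,1)], rule qL)+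
    have ik: "integrable lborel (\<lambda>x. \<rho> x * ?w x)" "(LBINT x. \<rho> x * ?w x) = 0" by (rule integral_centered[OF \<rho>p k(1)])+
    have e: "(\<lambda>x. (G x - c) * \<rho> x * k x) = (\<lambda>x. (q x * (\<rho> x * ?w x) - q' x * (\<rho> x * ?w x)) - c * (\<rho> x * ?w x) + mean k \<rho> * (G x * \<rho> x - c * \<rho> x))"
      by (simp add: G_def fun_eq_iff algebra_simps)
    show "(LBINT x. (G x - c) * \<rho> x * k x) = 0"
      unfolding e using iqw ik iG p(3,4) orth by (simp add: c_def)
  qed
  hence "AE x in lborel. q x = q' x + c"
  proof eventually_elim
    case (elim x)
    thus ?case using pos[of x] by (simp add: G_def)
  qed
  thus thesis by (rule that)
qed

section \<open>The Hamiltonian and the dynamic programming equation\<close>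

text \<open>The constant in \<open>q\<close> pairs to zero with the divergence, so a finite Hamiltonian is half the integral of
  the completed square. It is infinite only if the Lagrangian is, and the control equation excludes that because
  \<open>h\<close> has exponential growth.\<close>

lemma hamiltonian_completed_square:
  fixes h :: "'a::euclidean_space \<Rightarrow> real"
  assumes \<rho>: "\<rho> \<in> admissible_densities h" and \<beta>: "\<beta> > 0" and u: "u \<in> L2_fields \<rho>"
    and qm: "q \<in> borel_measurable borel" and q: "AE x in lborel. q x = \<beta> * h x + c"
  shows "0 \<le> hamiltonian h \<beta> \<rho> q u"
    and "hamiltonian h \<beta> \<rho> q u = 0 \<longleftrightarrow> control_pde h \<beta> \<rho> u"
proof -
  have A1: "A1 \<rho>" and A2: "A2 h \<rho>" using \<rho> by (auto simp: admissible_densities_def)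
  have \<rho>p: "\<rho> \<in> prob_densities" using A1 by (simp add: A1_def)
  note p = prob_densitiesD[OF \<rho>p]
  obtain g H where h: "C2_bounded_hessian h g H" using A2 unfolding A2_def by blast
  note [measurable] = p(1) C2_bounded_hessian_measurable[OF h] qm
  have "0 \<le> hamiltonian h \<beta> \<rho> q u \<and> (hamiltonian h \<beta> \<rho> q u = 0 \<longleftrightarrow> control_pde h \<beta> \<rho> u)"
  proof (cases "lagrangian h \<beta> \<rho> u = \<infinity>")
    case True
    have "\<not> control_pde h \<beta> \<rho> u"
    proof
      assume "control_pde h \<beta> \<rho> u"
      from lagrangian_control_pde(1)[OF \<rho>p h this] True
      have "ennreal (\<beta>\<^sup>2) * (\<integral>\<^sup>+x. ennreal ((h x - mean h \<rho>)\<^sup>2 * \<rho> x) \<partial>lborel) = \<infinity>" by simp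
      moreover have "exp_growth (\<lambda>x. (h x - mean h \<rho>)\<^sup>2)"
        by (intro exp_growth_power2 exp_growth_diff exp_growth_const C2_bounded_hessian_exp_growth[OF h])
      from A1_integrable_exp_growth[OF A1 this]
      have "(\<integral>\<^sup>+x. ennreal ((h x - mean h \<rho>)\<^sup>2 * \<rho> x) \<partial>lborel) < \<infinity>"
        using p(2) by (simp add: integrable_iff_bounded abs_mult)
      ultimately show False by (simp add: ennreal_mult_eq_top_iff)
    qed
    moreover have "hamiltonian h \<beta> \<rho> q u = \<infinity>" by (simp add: hamiltonian_def True)
    ultimately show ?thesis by simp
  next
    case False
    hence fin: "lagrangian h \<beta> \<rho> u < \<infinity>" by (simp add: less_top)
    let ?w = "weighted_div \<rho> u"
    note L = lagrangian_finiteD[OF \<rho>p u h \<beta> fin]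
    note S = lagrangian_completed_square[OF \<rho>p u h \<beta> fin]
    have [measurable]: "?w \<in> borel_measurable borel" using L(1) by (simp add: has_weighted_div_def)
    let ?Q = "\<integral>x. (?w x - \<beta> * (h x - mean h \<rho>))\<^sup>2 * \<rho> x \<partial>lborel"
    have "(LBINT x. q x * (\<rho> x * ?w x)) = (LBINT x. \<beta> * (h x * (\<rho> x * ?w x)) + c * (\<rho> x * ?w x))"
      by (rule integral_cong_AE) (measurable, use q in \<open>auto elim!: eventually_mono simp: algebra_simps\<close>)
    also have "\<dots> = \<beta> * (LBINT x. h x * (\<rho> x * ?w x))" using S(1) L(5,6) by simp
    finally have qi: "(LBINT x. q x * (\<rho> x * ?w x)) = \<beta> * (LBINT x. h x * (\<rho> x * ?w x))" .
    have "enn2ereal (lagrangian h \<beta> \<rho> u) = ereal (enn2real (lagrangian h \<beta> \<rho> u))"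
      using fin by (metis enn2ereal_ennreal enn2real_nonneg ennreal_enn2real infinity_ennreal_def)
    hence Hq: "hamiltonian h \<beta> \<rho> q u = ereal (1 / 2 * ?Q)"
      unfolding hamiltonian_def qi by (simp add: S(3))
    have nn: "0 \<le> (?w x - \<beta> * (h x - mean h \<rho>))\<^sup>2 * \<rho> x" for x using p(2) by simp
    have Q0: "?Q \<ge> 0" using nn by (rule Bochner_Integration.integral_nonneg)
    have "?Q = 0 \<longleftrightarrow> control_pde h \<beta> \<rho> u"
    proof
      assume "?Q = 0"
      hence "AE x in lborel. (?w x - \<beta> * (h x - mean h \<rho>))\<^sup>2 * \<rho> x = 0"
        using integral_nonneg_eq_0_iff_AE[OF S(2)] nn by blast
      thus "control_pde h \<beta> \<rho> u" by (rule control_pde_if_weighted_div_eq[OF \<rho>p h L(1)])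
    next
      assume "control_pde h \<beta> \<rho> u"
      from lagrangian_control_pde(2)[OF \<rho>p h this]
      have "AE x in lborel. (?w x - \<beta> * (h x - mean h \<rho>))\<^sup>2 * \<rho> x = 0" by eventually_elim auto
      hence "?Q = (\<integral>x. 0 \<partial>(lborel :: 'a measure))" by (intro integral_cong_AE) auto
      thus "?Q = 0" by simp
    qed
    thus ?thesis unfolding Hq using Q0 by simp
  qed
  thus "0 \<le> hamiltonian h \<beta> \<rho> q u" "hamiltonian h \<beta> \<rho> q u = 0 \<longleftrightarrow> control_pde h \<beta> \<rho> u" by blast+
qed

lemma gateaux_derivative_cong:
  assumes "\<And>\<rho>'. \<rho>' \<in> A \<Longrightarrow> E \<rho>' = E' \<rho>'"
  shows "is_gateaux_derivative A E \<rho> q \<longleftrightarrow> is_gateaux_derivative A E' \<rho> q"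
proof -
  have "((\<lambda>s. E (r s)) has_real_derivative d) (at 0 within {0..\<epsilon>}) \<longleftrightarrow> ((\<lambda>s. E' (r s)) has_real_derivative d) (at 0 within {0..\<epsilon>})"
    if "variation A \<rho> \<epsilon> r v w" for \<epsilon> r v w d
  proof (rule has_field_derivative_cong_eventually)
    have e: "\<epsilon> > 0" and rA: "\<And>s. s \<in> {0..\<epsilon>} \<Longrightarrow> r s \<in> A" using that by (auto simp: variation_def)
    show "eventually (\<lambda>s. E (r s) = E' (r s)) (at 0 within {0..\<epsilon>})"
      unfolding eventually_at_filter using rA assms by (intro always_eventually) auto
    show "E (r 0) = E' (r 0)" using rA[of 0] e assms by simp
  qed
  thus ?thesis unfolding is_gateaux_derivative_def by blast
qed

theorem theorem2:
  fixes h p0 :: "'a::euclidean_space \<Rightarrow> real" and \<beta> T :: real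
  assumes "A1 p0" and "A2 h p0" and "A3 h" and "\<beta> > 0" and "T > 0"
  shows
    "p0 \<in> admissible_densities h
     \<and> solves_dpe h \<beta> T (value_function h \<beta> T)
     \<and> (\<forall>\<rho>\<in>admissible_densities h. \<forall>t\<in>{0..T}.
          value_function h \<beta> T \<rho> t = ereal (\<beta> * (\<integral>x. h x * \<rho> x \<partial>lborel)))
     \<and> (\<forall>\<rho>\<in>admissible_densities h. \<forall>t\<in>{0..<T}. \<forall>q u.
          is_gateaux_derivative (admissible_densities h)
            (\<lambda>\<rho>'. real_of_ereal (value_function h \<beta> T \<rho>' t)) \<rho> q \<longrightarrow> u \<in> L2_fields \<rho> \<longrightarrow>
          (hamiltonian h \<beta> \<rho> q u = (INF v\<in>L2_fields \<rho>. hamiltonian h \<beta> \<rho> q v)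
             \<longleftrightarrow> control_pde h \<beta> \<rho> u))
     \<and> (\<forall>\<rho>\<in>admissible_densities h. \<forall>t\<in>{0..T}.
          (\<exists>r u. optimal_pair h \<beta> t T \<rho> r u \<and> (\<forall>s\<in>{t..T}. control_pde h \<beta> (r s) (u s))) \<and>
          (\<forall>r u. admissible_pair h \<beta> t T \<rho> r u \<longrightarrow>
             (optimal_pair h \<beta> t T \<rho> r u \<longleftrightarrow>
              (AE s in lborel. s \<in> {t..T} \<longrightarrow> control_pde h \<beta> (r s) (u s)))))"
proof -
  let ?A = "admissible_densities h"
  obtain g H where h: "C2_bounded_hessian h g H" "radially_bounded_below g" using A2_cost_regularity[OF assms(2)] by blast
  obtain xb where "\<And>x. x \<noteq> xb \<Longrightarrow> h xb < h x" using assms(3) unfolding A3_def by blast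
  hence bdd: "h xb \<le> h x" for x by (cases "x = xb") (auto intro: less_imp_le)
  note \<beta> = \<open>\<beta> > 0\<close>
  let ?V = "\<lambda>\<rho>. \<beta> * (LBINT x. h x * \<rho> x)"
  have AD: "A1 \<rho>" "A2 h \<rho>" "\<rho> \<in> prob_densities" "h \<in> L2_functions \<rho>" if "\<rho> \<in> ?A" for \<rho>
    using that by (auto simp: admissible_densities_def A1_def A2_def)
  have lower: "ereal (?V \<rho>) \<le> cost h \<beta> t T r u" if "admissible_pair h \<beta> t T \<rho> r u" "t \<le> T" for t \<rho> r u
    by (rule cost_lower_bound(1)[OF that h(1) \<beta>])
  have attained: "\<exists>r u. admissible_pair h \<beta> t T \<rho> r u \<and> cost h \<beta> t T r u = ereal (?V \<rho>)
      \<and> (\<forall>s\<in>{t..T}. control_pde h \<beta> (r s) (u s))" if "\<rho> \<in> ?A" "t \<le> T" for \<rho> t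
  proof -
    note P = tilted_pair[OF AD(1)[OF that(1)] h bdd \<beta> that(2)]
    show ?thesis
      by (intro exI conjI ballI, rule P(1), rule cost_of_control_pde[OF P(1) that(2) h(1) \<beta> bdd]) (use P(2) in auto)
  qed
  have val: "value_function h \<beta> T \<rho> t = ereal (?V \<rho>)" if A: "\<rho> \<in> ?A" "t \<le> T" for \<rho> t
  proof (rule antisym)
    obtain r u where ru: "admissible_pair h \<beta> t T \<rho> r u" "cost h \<beta> t T r u = ereal (?V \<rho>)"
      using attained[OF A] by blast
    show "value_function h \<beta> T \<rho> t \<le> ereal (?V \<rho>)"
      unfolding value_function_def by (rule INF_lower2[of "(r, u)"]) (use ru in auto)
    show "ereal (?V \<rho>) \<le> value_function h \<beta> T \<rho> t"
      unfolding value_function_def by (rule INF_greatest) (use lower[OF _ A(2)] in auto)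
  qed
  have optimal: "optimal_pair h \<beta> t T \<rho> r u \<longleftrightarrow> cost h \<beta> t T r u = ereal (?V \<rho>)"
    if A: "\<rho> \<in> ?A" "t \<le> T" "admissible_pair h \<beta> t T \<rho> r u" for \<rho> t r u
  proof
    obtain r' u' where r': "admissible_pair h \<beta> t T \<rho> r' u'" "cost h \<beta> t T r' u' = ereal (?V \<rho>)"
      using attained[OF A(1,2)] by blast
    assume "optimal_pair h \<beta> t T \<rho> r u"
    hence "cost h \<beta> t T r u \<le> ereal (?V \<rho>)" using r' unfolding optimal_pair_def by metis
    thus "cost h \<beta> t T r u = ereal (?V \<rho>)" using lower[OF A(3,2)] by (rule antisym)
  next
    assume "cost h \<beta> t T r u = ereal (?V \<rho>)"
    thus "optimal_pair h \<beta> t T \<rho> r u" unfolding optimal_pair_def using A(3) lower[OF _ A(2)] by simp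
  qed
  have gat: "is_gateaux_derivative ?A (\<lambda>\<rho>'. real_of_ereal (value_function h \<beta> T \<rho>' t)) \<rho> q \<longleftrightarrow>
      is_gateaux_derivative ?A ?V \<rho> q" if "t \<le> T" for \<rho> t q
    by (rule gateaux_derivative_cong) (simp add: val that)
  have gatV: "is_gateaux_derivative ?A ?V \<rho> (\<lambda>x. \<beta> * h x)" if "\<rho> \<in> ?A" for \<rho>
    by (rule linear_functional_gateaux[OF AD(1)[OF that] AD(4)[OF that] h(1)]) (use AD(3) in blast)
  have ham: "0 \<le> hamiltonian h \<beta> \<rho> q u" "hamiltonian h \<beta> \<rho> q u = 0 \<longleftrightarrow> control_pde h \<beta> \<rho> u"
    if A: "\<rho> \<in> ?A" "is_gateaux_derivative ?A ?V \<rho> q" "u \<in> L2_fields \<rho>" for \<rho> q u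
  proof -
    obtain c where c: "AE x in lborel. q x = \<beta> * h x + c"
      using gateaux_unique[OF A(1,2) gatV[OF A(1)]] by blast
    have qm: "q \<in> borel_measurable borel" using A(2) by (simp add: is_gateaux_derivative_def L2_functions_def)
    show "0 \<le> hamiltonian h \<beta> \<rho> q u" "hamiltonian h \<beta> \<rho> q u = 0 \<longleftrightarrow> control_pde h \<beta> \<rho> u"
      by (rule hamiltonian_completed_square[OF A(1) \<beta> A(3) qm c])+
  qed
  have infH: "(INF v\<in>L2_fields \<rho>. hamiltonian h \<beta> \<rho> q v) = 0"
    if "\<rho> \<in> ?A" "is_gateaux_derivative ?A ?V \<rho> q" for \<rho> q
  proof (rule antisym)
    note P = tilted_pair[OF AD(1)[OF that(1)] h bdd \<beta>, of 0 0]
    define v where "v = tilt_field \<rho> (\<lambda>x. \<beta> * (h x - h xb)) 0"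
    have pde: "control_pde h \<beta> \<rho> v" using P(2)[of 0] tilt_0[OF AD(1)[OF that(1)]] by (simp add: v_def)
    have vL: "v \<in> L2_fields \<rho>"
      using tilt_field_solves(2)[OF AD(1)[OF that(1)] tilting_potential_scaled_excess[OF h bdd \<beta>], of 0]
      by (simp add: v_def tilt_0[OF AD(1)[OF that(1)]])
    show "(INF v\<in>L2_fields \<rho>. hamiltonian h \<beta> \<rho> q v) \<le> 0"
      by (rule INF_lower2[OF vL]) (use ham(2)[OF that vL] pde in simp)
    show "0 \<le> (INF v\<in>L2_fields \<rho>. hamiltonian h \<beta> \<rho> q v)"
      by (rule INF_greatest) (rule ham(1)[OF that])
  qed
  have "solves_dpe h \<beta> T (value_function h \<beta> T)"
    unfolding solves_dpe_def
  proof (intro ballI conjI)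
    fix \<rho> assume \<rho>: "\<rho> \<in> ?A"
    show "\<bar>value_function h \<beta> T \<rho> t\<bar> \<noteq> \<infinity>" if "t \<in> {0..T}" for t using val[OF \<rho>, of t] that by simp
    show "value_function h \<beta> T \<rho> T = ereal (?V \<rho>)" by (rule val[OF \<rho>]) simp
    fix t assume t: "t \<in> {0..<T}"
    hence tT: "t \<le> T" by simp
    show "\<exists>D. ((\<lambda>s. real_of_ereal (value_function h \<beta> T \<rho> s)) has_real_derivative D) (at t within {0..T}) \<and>
        (\<exists>q. is_gateaux_derivative ?A (\<lambda>\<rho>'. real_of_ereal (value_function h \<beta> T \<rho>' t)) \<rho> q) \<and>
        (\<forall>q. is_gateaux_derivative ?A (\<lambda>\<rho>'. real_of_ereal (value_function h \<beta> T \<rho>' t)) \<rho> q \<longrightarrow>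
           ereal D + (INF u\<in>L2_fields \<rho>. hamiltonian h \<beta> \<rho> q u) = 0)"
    proof (intro exI[of _ 0] conjI allI impI)
      have "((\<lambda>s. ?V \<rho>) has_real_derivative 0) (at t within {0..T})" by simp
      thus "((\<lambda>s. real_of_ereal (value_function h \<beta> T \<rho> s)) has_real_derivative 0) (at t within {0..T})"
        by (rule has_field_derivative_transform_within[where d = 1]) (use t val[OF \<rho>] in auto)
      show "\<exists>q. is_gateaux_derivative ?A (\<lambda>\<rho>'. real_of_ereal (value_function h \<beta> T \<rho>' t)) \<rho> q"
        unfolding gat[OF tT] using gatV[OF \<rho>] by blast
      fix q assume "is_gateaux_derivative ?A (\<lambda>\<rho>'. real_of_ereal (value_function h \<beta> T \<rho>' t)) \<rho> q"
      thus "ereal 0 + (INF u\<in>L2_fields \<rho>. hamiltonian h \<beta> \<rho> q u) = 0"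
        unfolding gat[OF tT] using infH[OF \<rho>] by simp
    qed
  qed
  moreover have "p0 \<in> ?A" using assms(1,2) by (simp add: admissible_densities_def)
  moreover have "hamiltonian h \<beta> \<rho> q u = (INF v\<in>L2_fields \<rho>. hamiltonian h \<beta> \<rho> q v) \<longleftrightarrow> control_pde h \<beta> \<rho> u"
    if "\<rho> \<in> ?A" "t \<in> {0..<T}" "is_gateaux_derivative ?A (\<lambda>\<rho>'. real_of_ereal (value_function h \<beta> T \<rho>' t)) \<rho> q"
      "u \<in> L2_fields \<rho>" for \<rho> t q u
  proof -
    have "is_gateaux_derivative ?A ?V \<rho> q" using gat[of t \<rho> q] that(2,3) by simp
    thus ?thesis using infH[OF that(1)] ham(2)[OF that(1) _ that(4)] by simp
  qed
  moreover have "\<exists>r u. optimal_pair h \<beta> t T \<rho> r u \<and> (\<forall>s\<in>{t..T}. control_pde h \<beta> (r s) (u s))"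
    if "\<rho> \<in> ?A" "t \<in> {0..T}" for \<rho> t
    using attained[OF that(1), of t] optimal[OF that(1), of t] that(2) by auto
  moreover have "optimal_pair h \<beta> t T \<rho> r u \<longleftrightarrow> (AE s\<in>{t..T} in lborel. control_pde h \<beta> (r s) (u s))"
    if "\<rho> \<in> ?A" "t \<in> {0..T}" "admissible_pair h \<beta> t T \<rho> r u" for \<rho> t r u
  proof -
    have tT: "t \<le> T" using that(2) by simp
    show ?thesis unfolding optimal[OF that(1) tT that(3)]
    proof
      assume "cost h \<beta> t T r u = ereal (?V \<rho>)"
      thus "AE s\<in>{t..T} in lborel. control_pde h \<beta> (r s) (u s)"
        by (rule cost_lower_bound(2)[OF that(3) tT h(1) \<beta>])
    next
      assume "AE s\<in>{t..T} in lborel. control_pde h \<beta> (r s) (u s)"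
      thus "cost h \<beta> t T r u = ereal (?V \<rho>)" by (rule cost_of_control_pde[OF that(3) tT h(1) \<beta> bdd])
    qed
  qed
  ultimately show ?thesis using val by (intro conjI ballI allI impI) auto
qed

end
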